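(* Let $A\in\mathbb{R}^{n\times n}$ and $B\in\mathbb{R}^{n\times m}$ be such that $(A,B)$ is stabilizable and all eigenvalues of $A$ lie in the closed left half plane. Let $\bar\tau\ge 0$ satisfy \[ \bar{\tau}\,\omega_{\max}<\frac{\pi}{2}, \] where $\omega_{\max}=0$ if $A$ is Hurwitz and $\omega_{\max}=\max\{\omega\in\mathbb{R} : \det(j\omega I-A)=0\}$ otherwise. Then there exist $\rho>1$ and $\varepsilon^*>0$, depending only on $A$, $B$ and $\bar\tau$, such that the following holds for every $\varepsilon\in(0,\varepsilon^*]$. Let $P_\varepsilon$ be the unique positive definite solution of \[ A^{T}P_\varepsilon+P_\varepsilon A-P_\varepsilon BB^{T}P_\varepsilon+\varepsilon I=0 . \] Consider any integer $N\ge1$, any nonempty node set $\mathcal{C}\subseteq\{1,\dots,N\}$, and any weighted directed graph $\mathcal{G}\in\mathbb{G}_{\mathcal{C}}^N$ with adjacency weights $a_{ij}\ge0$ ($a_{ii}=0$). Consider any delays $\tau_1,\dots,\tau_N\in[0,\bar\tau]$. Let the multi-agent system be \[ \dot x_i(t)=Ax_i(t)+Bu_i(t-\tau_i),\qquad x_i(\delta)=\phi_i(\delta),\ \delta\in[-\bar\tau,0],\qquad i=1,\dots,N, \] with arbitrary continuous initial functions $\phi_i$. Let the exosystem be $\dot x_r(t)=Ax_r(t)$ with arbitrary initial condition. Let each agent $i$ use the protocol \[ \dot\chi_i(t)=A\chi_i(t)+Bu_i(t-\tau_i)+\bar\zeta_i(t)-\hat\zeta_i(t)-\iota_i\chi_i(t),\qquad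 u_i(t)=-\rho B^{T}P_\varepsilon\chi_i(t), \] with arbitrary initial conditions, where \[ \bar\zeta_i(t)=\sum_{j=1}^N a_{ij}(x_i(t)-x_j(t))+\iota_i(x_i(t)-x_r(t)),\qquad \hat\zeta_i(t)=\sum_{j=1}^N a_{ij}(\chi_i(t)-\chi_j(t)), \] and $\iota_i=1$ if $i\in\mathcal{C}$, $\iota_i=0$ otherwise. Then $\lim_{t\to\infty}(x_i(t)-x_r(t))=0$ for all $i=1,\dots,N$; that is, the scalable regulated state synchronization problem with additional information exchange is solved.
   Context: A weighted directed graph on nodes $\{1,\dots,N\}$ has adjacency matrix $[a_{ij}]$ with $a_{ij}>0$ iff there is an edge from $j$ to $i$, and $a_{ii}=0$. A directed tree is a subgraph in which every node has exactly one parent except one node, the root, which has none. For a node set $\mathcal{C}$, $\mathbb{G}_{\mathcal{C}}^N$ denotes the set of all such graphs with $N$ nodes containing $\mathcal{C}$ in which every node is a member of a directed tree whose root lies in $\mathcal{C}$. $j=\sqrt{-1}$. "Hurwitz" means all eigenvalues lie in the open left half plane. *)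

theory Defs
  imports "HOL-Analysis.Analysis"
begin

definition cmat :: "real^'n^'n \<Rightarrow> complex^'n^'n" where
  "cmat A = (\<chi> i j. complex_of_real (A $ i $ j))"

definition is_eig :: "real^'n^'n \<Rightarrow> complex \<Rightarrow> bool" where
  "is_eig A lam \<longleftrightarrow> det (mat lam - cmat A) = 0"

definition hurwitz :: "real^'n^'n \<Rightarrow> bool" where
  "hurwitz A \<longleftrightarrow> (\<forall>lam. is_eig A lam \<longrightarrow> Re lam < 0)"

definition stabilizable :: "real^'n^'n \<Rightarrow> real^'m^'n \<Rightarrow> bool" where
  "stabilizable A B \<longleftrightarrow> (\<exists>F :: real^'n^'m. hurwitz (A + B ** F))"

definition omega_max :: "real^'n^'n \<Rightarrow> real" where
  "omega_max A = (if hurwitz A then 0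
                  else Max {w::real. det (mat (\<i> * complex_of_real w) - cmat A) = 0})"

definition pos_def :: "real^'n^'n \<Rightarrow> bool" where
  "pos_def P \<longleftrightarrow> transpose P = P \<and> (\<forall>x. x \<noteq> 0 \<longrightarrow> x \<bullet> (P *v x) > 0)"

text \<open>Directed tree in the graph with weights a on nodes {1..N}: node set T, root r,
  every non-root node i has a parent p i in T with an edge from p i to i (a i (p i) > 0),
  and following parents from any node reaches the root (so the root has no parent and
  there are no cycles).\<close>
definition is_directed_tree :: "nat \<Rightarrow> (nat \<Rightarrow> nat \<Rightarrow> real) \<Rightarrow> nat set \<Rightarrow> nat \<Rightarrow> bool" where
  "is_directed_tree N a T r \<longleftrightarrow> T \<subseteq> {1..N} \<and> r \<in> T \<and>
     (\<exists>p. \<forall>i\<in>T - {r}. p i \<in> T \<and> a i (p i) > 0 \<and> (\<exists>k. (p ^^ k) i = r))"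

definition graph_class :: "nat \<Rightarrow> nat set \<Rightarrow> (nat \<Rightarrow> nat \<Rightarrow> real) \<Rightarrow> bool" where
  "graph_class N C a \<longleftrightarrow> C \<subseteq> {1..N} \<and>
     (\<forall>i\<in>{1..N}. \<forall>j\<in>{1..N}. a i j \<ge> 0) \<and> (\<forall>i\<in>{1..N}. a i i = 0) \<and>
     (\<forall>i\<in>{1..N}. \<exists>T r. is_directed_tree N a T r \<and> r \<in> C \<and> i \<in> T)"

end

theory Submission
  imports Defs "HOL-Computational_Algebra.Fundamental_Theorem_Algebra"
begin

text \<open>
  The errors \<open>e\<^sub>i = x\<^sub>i - x\<^sub>r - \<chi>\<^sub>i\<close> obey \<open>e' = (I \<otimes> A - L \<otimes> I) e\<close> with the pinned
  Laplacian \<open>L\<close>, an M-matrix, and so decay exponentially. Hence every \<open>\<chi>\<^sub>i\<close> solves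
  \<open>\<chi>' = A \<chi> - \<rho> B B\<^sup>T P \<chi>(t - \<tau>) + w\<close> with decaying \<open>w\<close>, and the agents decouple.

  For \<open>V = \<chi>\<^sup>T P \<chi>\<close> and \<open>v = B\<^sup>T P \<chi>\<close> the Riccati equation gives
  \<open>V' = - \<epsilon> |\<chi>|\<^sup>2 + |v|\<^sup>2 - 2 \<rho> v \<bullet> v(t - \<tau>) + 2 \<chi>\<^sup>T P w\<close>, so it suffices that
  \<open>\<integral> v \<bullet> v(t - \<tau>)\<close> is at least about \<open>c \<integral> |v|\<^sup>2\<close> with \<open>c = cos (taubar * omega_max A) > 0\<close>.
  This frequency-domain statement is proved in the time domain: for the eigenvalues \<open>\<lambda>\<^sub>k\<close>
  of \<open>A\<close>, the notch filters \<open>(s - \<lambda>\<^sub>k) / (s - \<lambda>\<^sub>k + \<gamma>)\<close> split \<open>v\<close> into nearly pure tones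
  \<open>w\<^sub>k\<close> with \<open>w\<^sub>k' = \<lambda>\<^sub>k w\<^sub>k + O(\<gamma>)\<close> and a remainder. Delaying a tone multiplies it by almost
  \<open>exp (- \<lambda>\<^sub>k \<tau>)\<close>, tones with different eigenvalues are almost orthogonal in time average,
  and since the product of all \<open>A - \<lambda>\<^sub>k\<close> vanishes, the remainder is bounded by the input,
  hence is \<open>O(|P|)\<close> relative to \<open>v\<close>. Finally \<open>P \<rightarrow> 0\<close> as \<open>\<epsilon> \<rightarrow> 0\<close> by compactness.
\<close>

text \<open>The price is a boundary term: near orthogonality of two tones costs the supremum of
  |v|^2 over [0, T]. As |v|^2 \<le> |B|^2 |P| V, low gain turns this into half the maximum of V, and
  the estimate taken at the time where V is largest absorbs it.

  The smallness conditions are not circular because of the order of choice: c fixes \<rho> = 2 / c;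
  the tone constant K depends on eigenvalues, taubar and c but not on \<gamma>; \<gamma> is chosen
  against \<rho> and K; the cascade constant, which contains powers of 1 / \<gamma>, comes next; the
  bound on |P|, and with it eps, comes last.

  The other obstacle is Jordan blocks: A need not be dissipative in any inner product. A list of
  eigenvalues with repetitions replaces the Jordan form, and the network error and the cascade are
  both treated one factor A - \<lambda> at a time, where Re \<lambda> \<le> 0 is enough.\<close>

declare transpose_matrix_vector [simp del]

subsection \<open>Complex vectors and annihilating products\<close>

definition cvec :: "real^'n \<Rightarrow> complex^'n" where
  "cvec x = (\<chi> i. complex_of_real (x $ i))"

lemma norm_smult: "norm (c *s x) = cmod c * norm (x :: complex^'n)"
  by (simp add: norm_vec_def L2_set_right_distrib norm_mult)

text \<open>The inner product on complex vectors is the real part of the Hermitian one; with respect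
  to it the adjoint of multiplication by c is multiplication by cnj c.\<close>

lemma inner_smult_adjoint: "(c *s x) \<bullet> y = x \<bullet> (cnj c *s (y :: complex^'n))"
  by (simp add: inner_vec_def inner_complex_def algebra_simps)

lemma inner_smult_self: "(c *s x) \<bullet> x = Re c * (norm (x :: complex^'n))^2"
proof -
  have "(c *s x) \<bullet> x = (\<Sum>i\<in>UNIV. Re c * (x $ i \<bullet> x $ i))"
    by (simp add: inner_vec_def inner_complex_def algebra_simps)
  also have "\<dots> = Re c * (x \<bullet> x)"
    by (simp add: inner_vec_def sum_distrib_left)
  finally show ?thesis by (simp add: power2_norm_eq_inner)
qed

lemma bounded_bilinear_smult: "bounded_bilinear (\<lambda>c (x :: complex^'n). c *s x)"
proof
  fix a a' :: complex and b b' :: "complex^'n" and r :: real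
  show "(a + a') *s b = a *s b + a' *s b" by (simp add: vec_eq_iff algebra_simps)
  show "a *s (b + b') = a *s b + a *s b'" by (simp add: vec_eq_iff algebra_simps)
  show "(r *\<^sub>R a) *s b = r *\<^sub>R (a *s b)" by (simp add: vec_eq_iff)
  show "a *s (r *\<^sub>R b) = r *\<^sub>R (a *s b)" by (simp add: vec_eq_iff)
  show "\<exists>K. \<forall>a (b :: complex^'n). norm (a *s b) \<le> norm a * norm b * K"
    by (rule exI[of _ 1]) (simp add: norm_smult)
qed

lemma linear_cvec: "linear cvec"
  by (rule linearI) (simp_all add: cvec_def vec_eq_iff scaleR_conv_of_real[where 'a=complex])

lemma bounded_linear_cvec: "bounded_linear cvec"
  using linear_cvec by (rule linear_conv_bounded_linear[THEN iffD1])

lemma norm_cvec [simp]: "norm (cvec x) = norm x"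
  by (simp add: cvec_def norm_vec_def L2_set_def)

lemma inner_cvec [simp]: "cvec x \<bullet> cvec y = x \<bullet> y"
  by (simp add: cvec_def inner_vec_def inner_complex_def)

lemma cmat_mult_cvec: "cmat A *v cvec x = cvec (A *v x)"
  by (simp add: cmat_def cvec_def matrix_vector_mult_def vec_eq_iff)

definition shift_op :: "complex^'n^'n \<Rightarrow> complex \<Rightarrow> complex^'n \<Rightarrow> complex^'n" where
  "shift_op A l y = A *v y - l *s y"

text \<open>The product of the factors A - l over a list, kept as an operator on vectors. Repeated
  entries record multiplicities, so no diagonalizability is assumed; the head is the outermost
  factor.\<close>

primrec shifts :: "complex^'n^'n \<Rightarrow> complex list \<Rightarrow> complex^'n \<Rightarrow> complex^'n" where
  "shifts A [] y = y"
| "shifts A (l # ls) y = shift_op A l (shifts A ls y)"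

lemma shift_op_commute: "shift_op A l (shift_op A k y) = shift_op A k (shift_op A l y)"
  by (simp add: shift_op_def matrix_vector_mult_diff_distrib vector_scalar_commute
      vector_ssub_ldistrib vector_smult_assoc algebra_simps)

lemma shift_op_0 [simp]: "shift_op A l 0 = 0"
  by (simp add: shift_op_def)

lemma shifts_shift_op: "shifts A ls (shift_op A l y) = shift_op A l (shifts A ls y)"
  by (induction ls) (simp_all add: shift_op_commute)

lemma shifts_append: "shifts A (ls @ ks) y = shifts A ls (shifts A ks y)"
  by (induction ls) simp_all

lemma shifts_0 [simp]: "shifts A ls 0 = 0"
  by (induction ls) simp_all

lemma shifts_commute: "shifts A ls (shifts A ks y) = shifts A ks (shifts A ls y)"
  by (induction ls) (simp_all add: shifts_shift_op)

lemma linear_shift_op: "Vector_Spaces.linear (*s) (*s) (shift_op A l)"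
  unfolding shift_op_def
  by (intro vec.linear_compose_sub matrix_vector_mul_linear_gen) (simp add: vec.linear_scale_self)

lemma linear_shifts: "Vector_Spaces.linear (*s) (*s) (shifts A ls)"
proof (induction ls)
  case Nil
  then show ?case by (simp add: vec.linear_id[unfolded id_def] cong: if_cong)
next
  case (Cons l ls)
  have "shifts A (l # ls) = shift_op A l \<circ> shifts A ls" by auto
  then show ?case using Vector_Spaces.linear_compose[OF Cons linear_shift_op] by (simp only:)
qed

section \<open>Annihilating polynomials and their linear factors\<close>

primrec mpow :: "complex^'n^'n \<Rightarrow> nat \<Rightarrow> complex^'n \<Rightarrow> complex^'n" where
  "mpow A 0 y = y"
| "mpow A (Suc k) y = A *v mpow A k y"

definition poly_act :: "complex^'n^'n \<Rightarrow> complex poly \<Rightarrow> complex^'n \<Rightarrow> complex^'n" where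
  "poly_act A p y = (\<Sum>i\<le>degree p. coeff p i *s mpow A i y)"

lemma poly_act_bound: "degree p \<le> n \<Longrightarrow> poly_act A p y = (\<Sum>i\<le>n. coeff p i *s mpow A i y)"
  unfolding poly_act_def
  by (rule sum.mono_neutral_left) (auto simp: coeff_eq_0)

lemma poly_act_linear_factor:
  "poly_act A ([:-r, 1:] * q) y = shift_op A r (poly_act A q y)"
proof -
  let ?n = "degree q"
  have d: "degree ([:-r, 1:] * q) \<le> Suc ?n"
    by (rule order_trans[OF degree_mult_le]) simp
  have c: "coeff ([:-r, 1:] * q) i = (case i of 0 \<Rightarrow> 0 | Suc j \<Rightarrow> coeff q j) - r * coeff q i" for i
    by (simp add: coeff_pCons split: nat.split)
  have "poly_act A ([:-r, 1:] * q) y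
      = (\<Sum>i\<le>Suc ?n. (case i of 0 \<Rightarrow> 0 | Suc j \<Rightarrow> coeff q j) *s mpow A i y)
        - (\<Sum>i\<le>Suc ?n. (r * coeff q i) *s mpow A i y)"
    unfolding poly_act_bound[OF d] c by (simp add: vector_sub_rdistrib sum_subtractf)
  also have "(\<Sum>i\<le>Suc ?n. (case i of 0 \<Rightarrow> 0 | Suc j \<Rightarrow> coeff q j) *s mpow A i y)
      = (\<Sum>i\<le>?n. coeff q i *s mpow A (Suc i) y)"
    by (subst sum.atMost_Suc_shift) simp
  also have "\<dots> = A *v poly_act A q y"
    by (simp add: poly_act_def vec.linear_sum[OF matrix_vector_mul_linear_gen] vector_scalar_commute)
  also have "(\<Sum>i\<le>Suc ?n. (r * coeff q i) *s mpow A i y) = r *s poly_act A q y"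
    by (simp add: poly_act_def coeff_eq_0 vec.scale_sum_right)
  finally show ?thesis by (simp add: shift_op_def)
qed

text \<open>Induction on the degree, splitting off one complex root at a time; the leading
  coefficient is what remains as c.\<close>

lemma poly_act_factor: "p \<noteq> 0 \<Longrightarrow> \<exists>ls c. c \<noteq> 0 \<and> (\<forall>y. poly_act A p y = shifts A ls (c *s y))"
proof (induction "degree p" arbitrary: p)
  case 0
  then obtain c where "p = [:c:]" by (metis degree_eq_zeroE)
  with 0 show ?case by (intro exI[of _ "[]"] exI[of _ c]) (simp add: poly_act_def)
next
  case (Suc n)
  then have "\<not> constant (poly p)" by (simp add: constant_degree)
  then obtain r where "poly p r = 0" using fundamental_theorem_of_algebra by blast
  then obtain q where q: "p = [:-r, 1:] * q" by (metis poly_eq_0_iff_dvd dvdE)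
  with Suc have "q \<noteq> 0" by auto
  moreover have "degree q = n" using Suc(2) \<open>q \<noteq> 0\<close> unfolding q by (subst (asm) degree_mult_eq) auto
  ultimately obtain ls c where "c \<noteq> 0" "\<forall>y. poly_act A q y = shifts A ls (c *s y)"
    using Suc(1) by blast
  then show ?case unfolding q poly_act_linear_factor
    by (intro exI[of _ "r # ls"] exI[of _ c]) simp
qed

text \<open>The CARD('n) + 1 vectors y, A y, A^2 y, ... are too many to be independent. Linear
  dependence speaks about a set, so coinciding powers are treated apart: there
  \<open>monom 1 i - monom 1 j\<close> annihilates y.\<close>

lemma ex_poly_act_zero:
  fixes A :: "complex^'n^'n"
  shows "\<exists>p. p \<noteq> 0 \<and> poly_act A p y = 0"
proof (cases "inj_on (\<lambda>k. mpow A k y) {..CARD('n)}")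
  case False
  then obtain i j where ij: "i \<noteq> j" "mpow A i y = mpow A j y" by (auto simp: inj_on_def)
  let ?p = "monom 1 i - monom (1::complex) j"
  have "coeff ?p i = 1" using ij by simp
  then have "?p \<noteq> 0" by (metis coeff_0 zero_neq_one)
  moreover have "poly_act A ?p y = 0"
  proof -
    have "degree ?p \<le> max i j" by (meson degree_diff_le degree_monom_le max.coboundedI1 max.coboundedI2)
    then have "poly_act A ?p y = (\<Sum>k\<le>max i j. coeff ?p k *s mpow A k y)" by (rule poly_act_bound)
    also have "\<dots> = (\<Sum>k\<le>max i j. (if i = k then mpow A k y else 0) - (if j = k then mpow A k y else 0))"
      by (rule sum.cong) (auto simp: vector_sub_rdistrib)
    also have "\<dots> = mpow A i y - mpow A j y" by (simp add: sum_subtractf)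
    finally show ?thesis using ij by simp
  qed
  ultimately show ?thesis by blast
next
  case True
  let ?S = "(\<lambda>k. mpow A k y) ` {..CARD('n)}"
  have "card ?S = Suc CARD('n)" using card_image[OF True] by simp
  then have "vec.dependent ?S"
    using vec.independent_bound_general[of ?S] vec.dim_subset_UNIV[of ?S] by (auto simp: vec.dimension_def card_cart_basis)
  then obtain u v where u: "v \<in> ?S" "u v \<noteq> 0" "(\<Sum>v\<in>?S. u v *s v) = 0"
    using vec.dependent_finite[of ?S] by auto
  define p where "p = (\<Sum>k\<le>CARD('n). monom (u (mpow A k y)) k)"
  have cp: "coeff p k = (if k \<le> CARD('n) then u (mpow A k y) else 0)" for k
    by (simp add: p_def coeff_sum)
  from u have "p \<noteq> 0" using cp by (metis (no_types, lifting) atMost_iff coeff_0 imageE)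
  moreover have "degree p \<le> CARD('n)" by (rule degree_le) (simp add: cp)
  then have "poly_act A p y = (\<Sum>k\<le>CARD('n). coeff p k *s mpow A k y)" by (rule poly_act_bound)
  then have "poly_act A p y = (\<Sum>v\<in>?S. u v *s v)" using True by (simp add: cp sum.reindex)
  ultimately show ?thesis using u by auto
qed

lemma ex_shifts_zero_vec: "\<exists>ls. shifts A ls y = 0"
proof -
  obtain p where "p \<noteq> 0" "poly_act A p y = 0" using ex_poly_act_zero by blast
  then obtain ls c where "c \<noteq> 0" "shifts A ls (c *s y) = 0" using poly_act_factor by metis
  moreover have "shifts A ls (c *s y) = c *s shifts A ls y"
    using linear_shifts by (rule vec.linear_scale)
  ultimately show ?thesis by auto
qed

text \<open>A substitute for Cayley-Hamilton. Every basis vector has an annihilating product of its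
  own; products commute, so the concatenation of these lists annihilates all basis vectors, and
  linearity does the rest.\<close>

lemma ex_shifts_zero: "\<exists>ls. \<forall>y. shifts (A :: complex^'n^'n) ls y = 0"
proof -
  have "finite S \<Longrightarrow> \<exists>ls. \<forall>i\<in>S. shifts A ls (axis i 1) = 0" for S :: "'n set"
  proof (induction S rule: finite_induct)
    case empty
    then show ?case by simp
  next
    case (insert i S)
    then obtain ls where ls: "\<forall>i\<in>S. shifts A ls (axis i 1) = 0" by blast
    obtain ks where "shifts A ks (axis i 1) = 0" using ex_shifts_zero_vec by blast
    then show ?case using ls
      by (intro exI[of _ "ks @ ls"]) (metis shifts_append shifts_commute shifts_0 insert_iff)
  qed
  from this[of UNIV] obtain ls where ls: "\<forall>i. shifts A ls (axis i 1) = 0" by auto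
  have "shifts A ls y = 0" for y
  proof -
    have "shifts A ls y = shifts A ls (\<Sum>i\<in>UNIV. (y $ i) *s axis i 1)" by (simp add: basis_expansion)
    also have "\<dots> = 0" by (simp add: vec.linear_sum[OF linear_shifts] vec.linear_scale[OF linear_shifts] ls)
    finally show ?thesis .
  qed
  then show ?thesis by blast
qed

section \<open>Eigenvalues and annihilating products\<close>

lemma mat_vec: "mat l *v y = l *s (y :: complex^'n)"
  by (simp add: mat_def matrix_vector_mult_def vec_eq_iff if_distrib[where f="\<lambda>x. x * _"] cong: if_cong)

lemma is_eig_iff: "is_eig A l \<longleftrightarrow> (\<exists>y. y \<noteq> 0 \<and> cmat A *v y = l *s y)"
proof -
  have "is_eig A l \<longleftrightarrow> \<not> invertible (mat l - cmat A)"
    by (simp add: is_eig_def invertible_det_nz)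
  also have "\<dots> \<longleftrightarrow> (\<exists>y. y \<noteq> 0 \<and> (mat l - cmat A) *v y = 0)"
    by (metis invertible_left_inverse matrix_left_invertible_ker matrix_vector_mult_0_right)
  finally show ?thesis by (auto simp: matrix_vector_mult_diff_rdistrib mat_vec)
qed

lemma is_eig_transpose: "is_eig (transpose A) l = is_eig A l"
proof -
  have "mat l - cmat (transpose A) = transpose (mat l - cmat A)"
    by (simp add: vec_eq_iff transpose_def mat_def cmat_def)
  then show ?thesis by (simp add: is_eig_def det_transpose)
qed

text \<open>A factor A - l with l not an eigenvalue is injective and can be cancelled from a product
  that vanishes identically. \<open>ks\<close> holds the factors already known to be eigenvalues,
  \<open>ls\<close> those still to be inspected.\<close>

lemma ex_eigenvalue_shifts_zero:
  "\<exists>ls. (\<forall>l\<in>set ls. is_eig A l) \<and> (\<forall>y. shifts (cmat A) ls y = 0)"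
proof -
  have "(\<forall>y. shifts (cmat A) (ks @ ls) y = 0) \<Longrightarrow> (\<forall>l\<in>set ks. is_eig A l) \<Longrightarrow> ?thesis" for ls ks
  proof (induction ls arbitrary: ks)
    case Nil
    then show ?case by auto
  next
    case (Cons l ls)
    show ?case
    proof (cases "is_eig A l")
      case True
      with Cons.prems Cons.IH[of "ks @ [l]"] show ?thesis by simp
    next
      case False
      have "shift_op (cmat A) l (shifts (cmat A) (ks @ ls) y) = 0" for y
        using Cons.prems by (simp add: shifts_append shifts_shift_op)
      with False have "shifts (cmat A) (ks @ ls) y = 0" for y
        by (auto simp: is_eig_iff shift_op_def)
      with Cons.prems Cons.IH[of ks] show ?thesis by simp
    qed
  qed
  from this[of "[]"] show ?thesis using ex_shifts_zero[of "cmat A"] by auto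
qed

lemma shifts_eigenvector:
  "A *v y = l *s y \<Longrightarrow> shifts A ls y = (\<Prod>k\<leftarrow>ls. l - k) *s y"
proof (induction ls)
  case (Cons k ls)
  then show ?case
    by (simp add: shift_op_def vector_scalar_commute) (simp add: vec_eq_iff algebra_simps)
qed simp

text \<open>On an eigenvector for l an annihilating product acts as multiplication by the product of
  the l - k, so l must occur in the list. Finiteness gives \<open>Max\<close> in
  \<open>omega_max\<close> its meaning.\<close>

lemma finite_eigenvalues: "finite {l. is_eig A l}"
proof -
  obtain ls where ls: "\<And>y. shifts (cmat A) ls y = 0" using ex_shifts_zero by blast
  have "{l. is_eig A l} \<subseteq> set ls"
  proof clarify
    fix l assume "is_eig A l"
    then obtain y where y: "y \<noteq> 0" "cmat A *v y = l *s y" by (auto simp: is_eig_iff)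
    from shifts_eigenvector[OF y(2), of ls] ls y(1) have "(\<Prod>k\<leftarrow>ls. l - k) = 0" by simp
    then show "l \<in> set ls" by (auto simp: prod_list_zero_iff)
  qed
  then show ?thesis using finite_subset by blast
qed

subsection \<open>Low gain\<close>

lemma transpose_add: "transpose (X + Y) = transpose X + transpose (Y :: real^'n^'m)"
  by (simp add: transpose_def vec_eq_iff)

text \<open>The form at x - t S x is a quadratic in t without constant term and with slope -2 |S
  x|^2 at t = 0; it can stay nonnegative for small t > 0 only if S x = 0.\<close>

lemma pos_semidef_kernel:
  fixes S :: "real^'n^'n"
  assumes sym: "transpose S = S" and psd: "\<And>x. x \<bullet> (S *v x) \<ge> 0" and z: "x \<bullet> (S *v x) = 0"
  shows "S *v x = 0"
proof -
  let ?q = "(S *v x) \<bullet> (S *v (S *v x))"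
  have sw: "x \<bullet> (S *v y) = (S *v x) \<bullet> y" for x y
    by (metis dot_lmul_matrix sym transpose_matrix_vector)
  have "0 \<le> -2 * t * (norm (S *v x))^2 + t^2 * ?q" for t
  proof -
    have "0 \<le> (x - t *\<^sub>R (S *v x)) \<bullet> (S *v (x - t *\<^sub>R (S *v x)))" by (rule psd)
    also have "\<dots> = x \<bullet> (S *v x) - t * (x \<bullet> (S *v (S *v x))) - t * ((S *v x) \<bullet> (S *v x)) + t * t * ?q"
      by (simp add: matrix_vector_mult_diff_distrib matrix_vector_mult_scaleR inner_diff_left
        inner_diff_right algebra_simps)
    also have "x \<bullet> (S *v (S *v x)) = (S *v x) \<bullet> (S *v x)" by (rule sw)
    finally show ?thesis by (simp add: z dot_square_norm power2_eq_square)
  qed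
  note q = this
  have "(norm (S *v x))^2 \<le> 0"
  proof (rule ccontr)
    assume "\<not> ?thesis"
    then have n: "(norm (S *v x))^2 > 0" by simp
    have q0: "?q \<ge> 0" by (rule psd)
    \<comment> \<open>With this t the term t q is less than |S x|^2, half the coefficient of the
      linear term; the 1 in the denominator covers q = 0.\<close>
    define t where "t = (norm (S *v x))^2 / (?q + 1)"
    have t: "t > 0" "t * (?q + 1) = (norm (S *v x))^2" using n q0 by (auto simp: t_def)
    have "0 \<le> t * (-2 * (norm (S *v x))^2 + t * ?q)"
      using q[of t] by (simp add: power2_eq_square algebra_simps)
    with t have "0 \<le> -2 * (norm (S *v x))^2 + t * ?q" by (simp add: zero_le_mult_iff)
    with t n show False by (simp add: algebra_simps)
  qed
  then show ?thesis by simp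
qed

text \<open>The component w of x orthogonal to the range satisfies |R w|^2 = w . R (R w) = 0, so it
  lies in the kernel; it is then orthogonal to x and thus to itself. The range of a symmetric matrix
  is the orthogonal complement of its kernel.\<close>

lemma range_symmetric_matrix:
  fixes R :: "real^'n^'n"
  assumes sym: "transpose R = R" and orth: "\<And>w. R *v w = 0 \<Longrightarrow> x \<bullet> w = 0"
  shows "x \<in> range ((*v) R)"
proof -
  have sub: "subspace (range ((*v) R))"
    by (simp add: linear_subspace_image)
  obtain u w where uw: "u \<in> span (range ((*v) R))" "\<And>v. v \<in> span (range ((*v) R)) \<Longrightarrow> orthogonal w v"
      "x = u + w"
    using orthogonal_subspace_decomp_exists[of "range ((*v) R)" x] by blast
  have sp: "span (range ((*v) R)) = range ((*v) R)" using sub by (simp add: span_eq_iff)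
  have "(R *v w) \<bullet> (R *v w) = w \<bullet> (R *v (R *v w))"
    by (metis dot_lmul_matrix sym transpose_matrix_vector)
  also have "\<dots> = 0" using uw(2)[of "R *v (R *v w)"] sp by (auto simp: orthogonal_def)
  finally have "R *v w = 0" by simp
  then have "x \<bullet> w = 0" by (rule orth)
  moreover have "u \<bullet> w = 0" using uw(1,2) by (metis orthogonal_def inner_commute)
  ultimately have "w \<bullet> w = 0" using uw(3) by (simp add: inner_add_left)
  then show ?thesis using uw sp by simp
qed

text \<open>Applying the factors to y one after the other reaches zero at some first factor; the
  vector just before it is an eigenvector, and it has not left the invariant set S.\<close>

lemma shifts_first_zero:
  "shifts A ls y = 0 \<Longrightarrow> y \<noteq> 0 \<Longrightarrow> y \<in> S \<Longrightarrow> (\<And>l y. y \<in> S \<Longrightarrow> shift_op A l y \<in> S)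
   \<Longrightarrow> \<exists>l z. z \<noteq> 0 \<and> z \<in> S \<and> A *v z = l *s z"
proof (induction ls arbitrary: y)
  case (Cons l ls)
  show ?case
  proof (cases "shift_op A l y = 0")
    case True
    then show ?thesis using Cons.prems by (auto simp: shift_op_def)
  next
    case False
    then show ?thesis using Cons.IH[of "shift_op A l y"] Cons.prems by (simp add: shifts_shift_op)
  qed
qed simp

text \<open>The vector a + i b. Keeping both real parts visible lets quadratic forms of real
  matrices be evaluated on a and b separately.\<close>

definition cpart :: "real^'n \<Rightarrow> real^'n \<Rightarrow> complex^'n" where
  "cpart a b = (\<chi> i. Complex (a $ i) (b $ i))"

lemma cmat_mult_cpart: "cmat M *v cpart a b = cpart (M *v a) (M *v b)"
  by (simp add: cmat_def cpart_def matrix_vector_mult_def vec_eq_iff complex_eq_iff)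

lemma smult_cpart:
  "l *s cpart a b = cpart (Re l *\<^sub>R a - Im l *\<^sub>R b) (Im l *\<^sub>R a + Re l *\<^sub>R b)"
  by (simp add: cpart_def vec_eq_iff complex_eq_iff)

lemma cpart_diff: "cpart a b - cpart c d = cpart (a - c) (b - d)"
  by (simp add: cpart_def vec_eq_iff complex_eq_iff)

lemma cpart_eq_iff: "cpart a b = cpart c d \<longleftrightarrow> a = c \<and> b = d"
  by (auto simp: cpart_def vec_eq_iff)

lemma cpart_eq_0_iff: "cpart a b = 0 \<longleftrightarrow> a = 0 \<and> b = 0"
  by (auto simp: cpart_def vec_eq_iff complex_eq_iff)

text \<open>A real invariant subspace may contain no real eigenvector, so the search takes place in
  the complexified range of R; G maps this set to itself, and so do all G - l.\<close>

lemma invariant_range_eigenvector: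
  fixes G R :: "real^'n^'n"
  assumes inv: "\<And>x. G *v (R *v x) \<in> range ((*v) R)" and nz: "R \<noteq> 0"
  shows "\<exists>l a b. (R *v a \<noteq> 0 \<or> R *v b \<noteq> 0) \<and> cmat G *v cpart (R *v a) (R *v b) = l *s cpart (R *v a) (R *v b)"
proof -
  define S where "S = {cpart (R *v a) (R *v b) | a b. True}"
  obtain x where x: "R *v x \<noteq> 0" using nz by (metis matrix_eq matrix_vector_mult_0)
  obtain ls where ls: "\<And>y. shifts (cmat G) ls y = 0" using ex_shifts_zero by blast
  have "\<exists>l z. z \<noteq> 0 \<and> z \<in> S \<and> cmat G *v z = l *s z"
  proof (rule shifts_first_zero[OF ls])
    show "cpart (R *v x) (R *v 0) \<noteq> 0" using x by (simp add: cpart_eq_0_iff)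
    show "cpart (R *v x) (R *v 0) \<in> S" unfolding S_def by blast
    fix l y assume "y \<in> S"
    then obtain a b where y: "y = cpart (R *v a) (R *v b)" by (auto simp: S_def)
    obtain a' b' where "G *v (R *v a) = R *v a'" "G *v (R *v b) = R *v b'"
      using inv by (metis imageE)
    then have "shift_op (cmat G) l y
      = cpart (R *v (a' - (Re l *\<^sub>R a - Im l *\<^sub>R b))) (R *v (b' - (Im l *\<^sub>R a + Re l *\<^sub>R b)))"
      by (simp add: y shift_op_def cmat_mult_cpart smult_cpart cpart_diff matrix_vector_mult_diff_distrib
          matrix_vector_right_distrib matrix_vector_mult_scaleR)
    then show "shift_op (cmat G) l y \<in> S" unfolding S_def by blast
  qed
  then obtain l z where z: "z \<noteq> 0" "z \<in> S" "cmat G *v z = l *s z" by blast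
  then obtain a b where "z = cpart (R *v a) (R *v b)" by (auto simp: S_def)
  with z show ?thesis by (metis cpart_eq_0_iff)
qed

text \<open>A Hautus argument. The hypothesis \<open>le\<close> makes
  \<open>transpose A ** R + R ** A\<close> positive semidefinite, which forces the kernel of R to be
  A-invariant and, dually, the range of R to be invariant under \<open>transpose A\<close>. An
  eigenvector of \<open>transpose A\<close> in that range has Re l \<le> 0, so both sides of
  \<open>le\<close> vanish on its parts; it is then annihilated by \<open>transpose B\<close>, and
  stabilizability forces Re l < 0, which leaves only the zero vector.\<close>

lemma stabilizable_no_semidefinite:
  fixes A R :: "real^'n^'n" and B :: "real^'m^'n"
  assumes stab: "stabilizable A B" and lhp: "\<forall>lam. is_eig A lam \<longrightarrow> Re lam \<le> 0"
    and sym: "transpose R = R" and psd: "\<And>x. x \<bullet> (R *v x) \<ge> 0"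
    and le: "\<And>x. (norm (transpose B *v (R *v x)))^2 \<le> k * (x \<bullet> (R *v (A *v x)))" and k: "k > 0"
  shows "R = 0"
proof (rule ccontr)
  assume nz: "R \<noteq> 0"
  have sw: "x \<bullet> (R *v y) = (R *v x) \<bullet> y" for x y
    by (metis dot_lmul_matrix sym transpose_matrix_vector)
  have tr: "x \<bullet> (transpose M *v y) = (M *v x) \<bullet> y" for x y and M :: "real^'n^'n"
    by (metis dot_lmul_matrix transpose_matrix_vector transpose_transpose)
  define M where "M = transpose A ** R + R ** A"
  have Mx: "M *v x = transpose A *v (R *v x) + R *v (A *v x)" for x
    by (simp add: M_def matrix_vector_mult_add_rdistrib matrix_vector_mul_assoc)
  have Mq: "x \<bullet> (M *v x) = 2 * (x \<bullet> (R *v (A *v x)))" for x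
  proof -
    have "x \<bullet> (transpose A *v (R *v x)) = x \<bullet> (R *v (A *v x))" by (metis tr sw inner_commute)
    then show ?thesis by (simp add: Mx inner_add_right)
  qed
  have Msym: "transpose M = M"
    by (simp add: M_def transpose_add matrix_transpose_mul sym add.commute)
  have RA: "0 \<le> x \<bullet> (R *v (A *v x))" for x
    using le[of x] k by (metis mult_less_cancel_left_pos mult_zero_right not_le order_trans zero_le_power2)
  \<comment> \<open>Where the semidefinite form of M vanishes, M itself vanishes; as R w = 0, the
    only term left of M w is R A w.\<close>
  have ker: "R *v (A *v w) = 0" if "R *v w = 0" for w
  proof -
    have "w \<bullet> (M *v w) = 0" using that by (simp add: Mq sw)
    then have "M *v w = 0" using RA by (intro pos_semidef_kernel[OF Msym]) (auto simp: Mq)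
    with that show ?thesis by (simp add: Mx)
  qed
  have "transpose A *v (R *v x) \<in> range ((*v) R)" for x
  proof (rule range_symmetric_matrix[OF sym])
    fix w assume "R *v w = 0"
    from ker[OF this] have "x \<bullet> (R *v (A *v w)) = 0" by simp
    then show "(transpose A *v (R *v x)) \<bullet> w = 0" by (metis inner_commute tr sw)
  qed
  from invariant_range_eigenvector[OF this nz]
  obtain l a b where nz2: "R *v a \<noteq> 0 \<or> R *v b \<noteq> 0"
    and ev: "cmat (transpose A) *v cpart (R *v a) (R *v b) = l *s cpart (R *v a) (R *v b)" by blast
  have nz3: "cpart (R *v a) (R *v b) \<noteq> 0" using nz2 by (simp add: cpart_eq_0_iff)
  have "is_eig A l" using ev nz3 by (metis is_eig_iff is_eig_transpose)
  then have l: "Re l \<le> 0" using lhp by blast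
  from ev have ea: "transpose A *v (R *v a) = Re l *\<^sub>R (R *v a) - Im l *\<^sub>R (R *v b)"
    and eb: "transpose A *v (R *v b) = Im l *\<^sub>R (R *v a) + Re l *\<^sub>R (R *v b)"
    by (auto simp: cmat_mult_cpart smult_cpart cpart_eq_iff)
  have qa: "a \<bullet> (R *v (A *v a)) = Re l * (a \<bullet> (R *v a)) - Im l * (a \<bullet> (R *v b))"
  proof -
    have "a \<bullet> (R *v (A *v a)) = a \<bullet> (transpose A *v (R *v a))" by (metis tr sw inner_commute)
    then show ?thesis by (simp add: ea inner_diff_right)
  qed
  have qb: "b \<bullet> (R *v (A *v b)) = Im l * (a \<bullet> (R *v b)) + Re l * (b \<bullet> (R *v b))"
  proof -
    have "b \<bullet> (R *v (A *v b)) = b \<bullet> (transpose A *v (R *v b))" by (metis tr sw inner_commute)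
    moreover have "b \<bullet> (R *v a) = a \<bullet> (R *v b)" by (metis sw inner_commute)
    ultimately show ?thesis by (simp add: eb inner_add_right)
  qed
  \<comment> \<open>Adding the forms at a and at b cancels the two mixed terms with Im l.\<close>
  have s: "a \<bullet> (R *v (A *v a)) + b \<bullet> (R *v (A *v b)) = Re l * (a \<bullet> (R *v a) + b \<bullet> (R *v b))"
    by (simp add: qa qb algebra_simps)
  also have "\<dots> \<le> 0" using l psd[of a] psd[of b] by (simp add: mult_nonpos_nonneg)
  finally have z: "a \<bullet> (R *v (A *v a)) = 0" "b \<bullet> (R *v (A *v b)) = 0" using RA[of a] RA[of b] by auto
  have Ba: "transpose B *v (R *v a) = 0" using le[of a] z by simp
  have Bb: "transpose B *v (R *v b) = 0" using le[of b] z by simp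
  obtain F :: "real^'n^'m" where F: "hurwitz (A + B ** F)" using stab by (auto simp: stabilizable_def)
  have tF: "transpose (A + B ** F) = transpose A + transpose F ** transpose B"
    by (simp add: transpose_add matrix_transpose_mul)
  \<comment> \<open>Feedback cannot move this eigenvalue: \<open>transpose B\<close> annihilates
    both parts of the vector, so F drops out.\<close>
  have "cmat (transpose (A + B ** F)) *v cpart (R *v a) (R *v b) = l *s cpart (R *v a) (R *v b)"
    unfolding ev[symmetric] cmat_mult_cpart tF
    by (simp add: matrix_vector_mult_add_rdistrib matrix_vector_mul_assoc[symmetric] Ba Bb)
  then have "is_eig (A + B ** F) l" using nz3 by (metis is_eig_iff is_eig_transpose)
  then have "Re l < 0" using F by (simp add: hurwitz_def)
  with s z have "a \<bullet> (R *v a) + b \<bullet> (R *v b) = 0" by simp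
  then have "a \<bullet> (R *v a) = 0" "b \<bullet> (R *v b) = 0" using psd[of a] psd[of b] by auto
  then have "R *v a = 0" "R *v b = 0" using pos_semidef_kernel[OF sym psd] by auto
  with nz2 show False by simp
qed

section \<open>The Riccati solution for vanishing eps\<close>

abbreviation riccati :: "real^'n^'n \<Rightarrow> real^'m^'n \<Rightarrow> real \<Rightarrow> real^'n^'n \<Rightarrow> bool" where
  "riccati A B eps P \<equiv> transpose A ** P + P ** A - P ** B ** transpose B ** P + mat eps = 0"

lemma riccati_quadratic:
  fixes A P :: "real^'n^'n" and B :: "real^'m^'n"
  assumes sym: "transpose P = P"
    and are: "riccati A B eps P"
  shows "2 * (x \<bullet> (P *v (A *v x))) = (norm (transpose B *v (P *v x)))^2 - eps * (norm x)^2"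
proof -
  have sw: "x \<bullet> (P *v y) = (P *v x) \<bullet> y" for x y
    by (metis dot_lmul_matrix sym transpose_matrix_vector)
  have tr: "x \<bullet> (transpose A *v y) = (A *v x) \<bullet> y" for x y
    by (metis dot_lmul_matrix transpose_matrix_vector transpose_transpose)
  have trB: "x \<bullet> (B *v y) = (transpose B *v x) \<bullet> y" for x y
    by (metis dot_lmul_matrix transpose_matrix_vector)
  have m: "mat eps *v x = eps *\<^sub>R x" for x :: "real^'n"
    by (simp add: mat_def matrix_vector_mult_def vec_eq_iff if_distrib[where f="\<lambda>x. x * _"] cong: if_cong)
  have "x \<bullet> ((transpose A ** P + P ** A - P ** B ** transpose B ** P + mat eps) *v x) = 0"
    by (simp add: are)
  then have "x \<bullet> (transpose A *v (P *v x)) + x \<bullet> (P *v (A *v x))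
     - x \<bullet> (P *v (B *v (transpose B *v (P *v x)))) + eps * (x \<bullet> x) = 0"
    by (simp add: matrix_vector_mult_add_rdistrib matrix_vector_mult_diff_rdistrib
       matrix_vector_mul_assoc[symmetric] m inner_add_right inner_diff_right)
  moreover have "x \<bullet> (transpose A *v (P *v x)) = x \<bullet> (P *v (A *v x))"
    by (metis tr sw inner_commute)
  moreover have "x \<bullet> (P *v (B *v (transpose B *v (P *v x)))) = (norm (transpose B *v (P *v x)))^2"
    by (simp add: sw trB power2_norm_eq_inner)
  ultimately show ?thesis by (simp add: power2_norm_eq_inner)
qed

text \<open>If P stayed away from zero while eps tends to zero, the normalized matrices P / |P|
  would have a limit of norm one, and that limit would satisfy the inequality excluded by
  \<open>stabilizable_no_semidefinite\<close>.\<close>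

lemma low_gain:
  fixes A :: "real^'n^'n" and B :: "real^'m^'n"
  assumes stab: "stabilizable A B" and lhp: "\<forall>lam. is_eig A lam \<longrightarrow> Re lam \<le> 0" and eta: "eta > 0"
  shows "\<exists>e0>0. \<forall>eps P. 0 < eps \<and> eps \<le> e0 \<and> pos_def P \<and>
      riccati A B eps P \<longrightarrow> norm P \<le> eta"
proof (rule ccontr)
  assume neg: "\<not> ?thesis"
  have "\<exists>eps P. 0 < eps \<and> eps \<le> inverse (real (Suc k)) \<and> pos_def P \<and>
      riccati A B eps P \<and> norm P > eta" for k
    using neg[simplified, rule_format, of "inverse (real (Suc k))"] by (auto simp: not_le)
  then obtain eps P where ep: "\<And>k. 0 < eps k" "\<And>k. eps k \<le> inverse (real (Suc k))" "\<And>k. pos_def (P k)"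
    "\<And>k. riccati A B (eps k) (P k)"
    "\<And>k. norm (P k :: real^'n^'n) > eta" by metis
  define R where "R k = (1 / norm (P k)) *\<^sub>R P k" for k
  have pos: "norm (P k) > 0" for k using ep(5)[of k] eta by linarith
  have nR: "norm (R k) = 1" for k using pos[of k] by (simp add: R_def)
  have "bounded (range R)" by (intro boundedI[of _ 1]) (auto simp: nR)
  then obtain L r where r: "strict_mono r" and lim: "(R \<circ> r) \<longlonglongrightarrow> L"
    using bounded_imp_convergent_subsequence by blast
  have bl: "bounded_linear (\<lambda>M :: real^'n^'n. M *v x)" for x
    by (rule linear_conv_bounded_linear[THEN iffD1])
       (intro linearI; simp add: matrix_vector_mult_add_rdistrib scaleR_matrix_vector_assoc)
  have limv: "(\<lambda>k. R (r k) *v x) \<longlonglongrightarrow> L *v x" for x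
    using bounded_linear.tendsto[OF bl lim] by (simp add: o_def)
  have eps0: "(\<lambda>k. eps (r k)) \<longlonglongrightarrow> 0"
  proof (rule LIMSEQ_subseq_LIMSEQ[OF _ r, unfolded o_def])
    show "eps \<longlonglongrightarrow> 0"
      by (rule real_tendsto_sandwich[OF _ _ tendsto_const LIMSEQ_inverse_real_of_nat])
         (use ep(1,2) in \<open>auto intro: always_eventually less_imp_le\<close>)
  qed
  have Rsym: "transpose (R k) = R k" for k
    using ep(3)[of k] by (simp add: R_def pos_def_def transpose_scalar)
  have Rpsd: "x \<bullet> (R k *v x) \<ge> 0" for k x
    using ep(3)[of k] pos[of k] by (cases "x = 0")
      (auto simp: R_def pos_def_def scaleR_matrix_vector_assoc[symmetric] less_imp_le)
  have le: "(norm (transpose B *v (R k *v x)))^2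
      \<le> (2 / eta) * (x \<bullet> (R k *v (A *v x))) + (eps k / eta^2) * (norm x)^2" for k x
  proof -
    let ?p = "norm (P k)" and ?n = "(norm (transpose B *v (R k *v x)))^2"
    have "transpose (P k) = P k" using ep(3)[of k] by (simp add: pos_def_def)
    from riccati_quadratic[OF this ep(4), of x]
    have "2 * (x \<bullet> (P k *v (A *v x))) + eps k * (norm x)^2 = (norm (transpose B *v (P k *v x)))^2" by simp
    moreover have P: "P k = ?p *\<^sub>R R k" using pos[of k] by (simp add: R_def)
    have "P k *v y = ?p *\<^sub>R (R k *v y)" for y
      by (subst P) (simp add: scaleR_matrix_vector_assoc)
    ultimately have eq: "2 * ?p * (x \<bullet> (R k *v (A *v x))) + eps k * (norm x)^2 = ?p^2 * ?n"
      by (simp add: matrix_vector_mult_scaleR power_mult_distrib)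
    \<comment> \<open>Only the lower bound |P| > eta enters: trading one factor |P| for eta keeps
      the coefficients finite in the limit even if the norms are unbounded.\<close>
    have "eta * ?p * ?n \<le> ?p^2 * ?n"
      using ep(5)[of k] pos[of k] by (simp add: power2_eq_square mult_right_mono)
    with eq have "?p * (eta * ?n) \<le> ?p * (2 * (x \<bullet> (R k *v (A *v x))) + (eps k / ?p) * (norm x)^2)"
      using pos[of k] by (simp add: algebra_simps)
    then have "eta * ?n \<le> 2 * (x \<bullet> (R k *v (A *v x))) + (eps k / ?p) * (norm x)^2"
      using pos[of k] by (simp only: mult_le_cancel_left_pos)
    also have "\<dots> \<le> 2 * (x \<bullet> (R k *v (A *v x))) + (eps k / eta) * (norm x)^2"
      using ep(1,5)[of k] eta by (intro add_left_mono mult_right_mono divide_left_mono) (auto intro: mult_pos_pos pos)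
    finally have "?n \<le> (2 * (x \<bullet> (R k *v (A *v x))) + (eps k / eta) * (norm x)^2) / eta"
      using eta by (simp add: pos_le_divide_eq mult.commute)
    then show ?thesis by (simp add: add_divide_distrib power2_eq_square)
  qed
  have "L = 0"
  proof (rule stabilizable_no_semidefinite[OF stab lhp])
    have "transpose (R (r k)) $ i $ j = R (r k) $ i $ j" for k i j by (simp add: Rsym)
    then have swap: "R (r k) $ j $ i = R (r k) $ i $ j" for k i j by (simp add: transpose_def)
    have lc: "(\<lambda>k. R (r k) $ i $ j) \<longlonglongrightarrow> L $ i $ j" for i j
      using lim by (intro tendsto_vec_nth) (simp add: o_def)
    have "L $ j $ i = L $ i $ j" for i j
      using LIMSEQ_unique[OF lc[of j i] lc[of i j, folded swap[of _ j i]]] .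
    then show "transpose L = L" by (simp add: transpose_def vec_eq_iff)
    show "x \<bullet> (L *v x) \<ge> 0" for x
      by (rule LIMSEQ_le_const[of "\<lambda>k. x \<bullet> (R (r k) *v x)"]) (auto intro!: tendsto_intros limv Rpsd)
    fix x
    have "(norm (transpose B *v (L *v x)))^2
      \<le> (2 / eta) * (x \<bullet> (L *v (A *v x))) + (0 / eta^2) * (norm x)^2"
    proof (rule LIMSEQ_le)
      show "(\<lambda>k. (norm (transpose B *v (R (r k) *v x)))^2) \<longlonglongrightarrow> (norm (transpose B *v (L *v x)))^2"
        by (intro tendsto_intros bounded_linear.tendsto[OF matrix_vector_mul_bounded_linear] limv)
      show "(\<lambda>k. (2 / eta) * (x \<bullet> (R (r k) *v (A *v x))) + (eps (r k) / eta^2) * (norm x)^2)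
         \<longlonglongrightarrow> (2 / eta) * (x \<bullet> (L *v (A *v x))) + (0 / eta^2) * (norm x)^2"
        using eta by (intro tendsto_intros limv eps0) auto
    qed (use le in blast)
    then show "(norm (transpose B *v (L *v x)))^2 \<le> (2 / eta) * (x \<bullet> (L *v (A *v x)))" by simp
    show "2 / eta > 0" using eta by simp
  qed
  moreover have "norm L = 1"
    using tendsto_norm[OF lim] by (simp add: o_def nR LIMSEQ_const_iff)
  ultimately show False by simp
qed

subsection \<open>Decay of the network error\<close>

lemma has_real_derivative_inner:
  fixes f g :: "real \<Rightarrow> 'a::real_inner"
  assumes "(f has_vector_derivative f') (at t within S)" "(g has_vector_derivative g') (at t within S)"
  shows "((\<lambda>t. f t \<bullet> g t) has_real_derivative (f t \<bullet> g' + f' \<bullet> g t)) (at t within S)"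
  using bounded_bilinear.has_vector_derivative[OF bounded_bilinear_inner assms]
  by (simp add: has_real_derivative_iff_has_vector_derivative)

lemma has_real_derivative_norm_power2:
  fixes f :: "real \<Rightarrow> 'a::real_inner"
  assumes "(f has_vector_derivative f') (at t within S)"
  shows "((\<lambda>t. (norm (f t))^2) has_real_derivative (2 * (f t \<bullet> f'))) (at t within S)"
  using has_real_derivative_inner[OF assms assms] by (simp add: power2_norm_eq_inner inner_commute)

lemma two_inner_le: "2 * (u \<bullet> w) \<le> c * (norm u)^2 + (norm w)^2 / c" if "c > 0" for u w :: "'a::real_inner"
proof -
  have "0 \<le> (norm (sqrt c *\<^sub>R u - (1 / sqrt c) *\<^sub>R w))^2" by simp
  also have "\<dots> = c * (norm u)^2 + (norm w)^2 / c - 2 * (u \<bullet> w)"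
    using that by (simp add: power2_norm_eq_inner inner_diff_left inner_diff_right inner_commute)
  finally show ?thesis by simp
qed

text \<open>At the first time s at which some component reaches zero all components are still \<le>
  0, so \<open>neg\<close> applies there; a negative derivative means that this component was
  positive just before s, contradicting minimality. Finiteness of I makes the first time
  exist.\<close>

lemma maximum_principle:
  fixes m m' :: "'i \<Rightarrow> real \<Rightarrow> real"
  assumes fin: "finite I"
    and der: "\<And>i t. i \<in> I \<Longrightarrow> t \<ge> 0 \<Longrightarrow> (m i has_real_derivative m' i t) (at t within {0..})"
    and init: "\<And>i. i \<in> I \<Longrightarrow> m i 0 < 0"
    and neg: "\<And>i t. i \<in> I \<Longrightarrow> t \<ge> 0 \<Longrightarrow> m i t = 0 \<Longrightarrow> (\<And>j. j \<in> I \<Longrightarrow> m j t \<le> 0) \<Longrightarrow> m' i t < 0"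
    and i: "i \<in> I" and t: "t \<ge> 0"
  shows "m i t < 0"
proof (rule ccontr)
  assume not: "\<not> m i t < 0"
  have cont: "continuous_on {0..s} (m i)" if "i \<in> I" for i s
    by (rule continuous_on_subset[of "{0..}"], rule DERIV_continuous_on) (use der[OF that] in auto)
  define S where "S = (\<Union>i\<in>I. {s \<in> {0..t}. 0 \<le> m i s})"
  have "closed {s \<in> {0..t}. 0 \<le> m i s}" if "i \<in> I" for i
    by (intro continuous_on_closed_Collect_le cont that) auto
  then have "closed S" unfolding S_def using fin by blast
  moreover have "S \<subseteq> {0..t}" by (auto simp: S_def)
  ultimately have "compact S" by (metis compact_Icc compact_Int_closed inf.absorb_iff2)
  moreover have "S \<noteq> {}" using not i t by (auto simp: S_def not_less)
  ultimately obtain s where s: "s \<in> S" "\<And>r. r \<in> S \<Longrightarrow> s \<le> r"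
    using compact_attains_inf by metis
  then obtain k where k: "k \<in> I" "0 \<le> s" "s \<le> t" "0 \<le> m k s" by (auto simp: S_def)
  have before: "m j r < 0" if "j \<in> I" "0 \<le> r" "r < s" for j r
    using s(2)[of r] that k by (force simp: S_def)
  have le: "m j s \<le> 0" if j: "j \<in> I" for j
  proof (rule ccontr)
    assume "\<not> ?thesis"
    then have "\<exists>r\<ge>0. r \<le> s \<and> m j r = 0"
      by (intro IVT') (use init[OF j] k cont[OF j] in auto)
    then obtain r where "0 \<le> r" "r \<le> s" "m j r = 0" by auto
    with before[OF j] \<open>\<not> ?thesis\<close> show False by (cases "r = s") force+
  qed
  with k have k0: "m k s = 0" by force
  have "s \<noteq> 0" using k init[of k] by auto
  with k have sp: "s > 0" by simp
  have "m' k s < 0" by (rule neg) (use k k0 le in auto)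
  from has_real_derivative_neg_dec_left[OF der[OF k(1,2)] this]
  obtain d where d: "d > 0" "\<And>h. h > 0 \<Longrightarrow> s - h \<in> {0..} \<Longrightarrow> h < d \<Longrightarrow> m k s < m k (s - h)" by blast
  define h where "h = min s (d/2)"
  have "m k s < m k (s - h)" by (rule d) (use d sp in \<open>auto simp: h_def\<close>)
  moreover have "m k (s - h) < 0" by (rule before) (use k d sp in \<open>auto simp: h_def\<close>)
  ultimately show False using k0 by simp
qed

section \<open>Depth in the pinned graph and a supersolution of its Laplacian\<close>

inductive_set at_depth :: "nat \<Rightarrow> nat set \<Rightarrow> (nat \<Rightarrow> nat \<Rightarrow> real) \<Rightarrow> (nat \<times> nat) set"
  for N C a where
  root: "i \<in> C \<Longrightarrow> (i, 0) \<in> at_depth N C a"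
| step: "(j, k) \<in> at_depth N C a \<Longrightarrow> j \<in> {1..N} \<Longrightarrow> a i j > 0 \<Longrightarrow> (i, Suc k) \<in> at_depth N C a"

text \<open>A shortest path from C to i ends with an edge from a node of smaller depth, and depth 0
  means membership in C. Measuring the distance from the whole of C merges the trees, which may have
  different roots.\<close>

lemma graph_class_depth:
  assumes "graph_class N C a"
  shows "\<exists>d :: nat \<Rightarrow> nat. \<forall>i\<in>{1..N}. (d i = 0 \<longrightarrow> i \<in> C) \<and> (d i > 0 \<longrightarrow> (\<exists>j\<in>{1..N}. a i j > 0 \<and> d j < d i))"
proof -
  have ex: "\<exists>k. (i, k) \<in> at_depth N C a" if i: "i \<in> {1..N}" for i
  proof -
    obtain T r where tree: "is_directed_tree N a T r" "r \<in> C" "i \<in> T"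
      using assms i unfolding graph_class_def by blast
    then obtain p where p: "\<And>i. i \<in> T - {r} \<Longrightarrow> p i \<in> T \<and> a i (p i) > 0 \<and> (\<exists>k. (p ^^ k) i = r)"
      and T: "T \<subseteq> {1..N}"
      unfolding is_directed_tree_def by blast
    have "(p ^^ k) i = r \<Longrightarrow> i \<in> T \<Longrightarrow> \<exists>k. (i, k) \<in> at_depth N C a" for k i
    proof (induction k arbitrary: i)
      case 0
      then show ?case using tree by (auto intro: at_depth.root)
    next
      case (Suc k)
      show ?case
      \<comment> \<open>\<open>p\<close> is constrained only away from the root, so
        \<open>i = r\<close> must be split off before passing to \<open>p i\<close>.\<close>
      proof (cases "i = r")
        case True
        then show ?thesis using tree by (auto intro: at_depth.root)
      next
        case False
        with Suc p have pi: "p i \<in> T" "a i (p i) > 0" by auto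
        have "(p ^^ k) (p i) = r" using Suc.prems by (simp add: funpow_swap1)
        from Suc.IH[OF this pi(1)] pi T show ?thesis by (blast intro: at_depth.step)
      qed
    qed
    then show ?thesis using p[of i] tree at_depth.root[of r C N a] by (metis DiffI singletonD)
  qed
  define d where "d i = (LEAST k. (i, k) \<in> at_depth N C a)" for i
  have d: "(i, d i) \<in> at_depth N C a" if "i \<in> {1..N}" for i
    unfolding d_def using ex[OF that] by (rule LeastI_ex)
  have "(d i = 0 \<longrightarrow> i \<in> C) \<and> (d i > 0 \<longrightarrow> (\<exists>j\<in>{1..N}. a i j > 0 \<and> d j < d i))"
    if i: "i \<in> {1..N}" for i
    using d[OF i]
  proof cases
    case root
    then show ?thesis by simp
  next
    case (step j k)
    have "d j \<le> k" unfolding d_def using step by (intro Least_le) auto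
    with step show ?thesis by auto
  qed
  then show ?thesis by blast
qed

text \<open>\<open>\<xi>\<close> increases with the depth in steps that shrink so fast that the one edge
  coming from a smaller depth outweighs all other edges.\<close>
lemma graph_class_supersolution:
  assumes g: "graph_class N C a"
  shows "\<exists>\<xi> \<kappa>. \<kappa> > 0 \<and> (\<forall>i\<in>{1..N}. \<xi> i > 0 \<and>
     2 * \<kappa> * \<xi> i \<le> (\<Sum>j=1..N. a i j * (\<xi> i - \<xi> j)) + (if i \<in> C then 1 else 0) * \<xi> i)"
proof -
  obtain d :: "nat \<Rightarrow> nat" where d: "\<And>i. i \<in> {1..N} \<Longrightarrow> d i = 0 \<Longrightarrow> i \<in> C"
     "\<And>i. i \<in> {1..N} \<Longrightarrow> d i > 0 \<Longrightarrow> (\<exists>j\<in>{1..N}. a i j > 0 \<and> d j < d i)"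
    using graph_class_depth[OF g] by metis
  have a0: "a i j \<ge> 0" if "i \<in> {1..N}" "j \<in> {1..N}" for i j using g that by (simp add: graph_class_def)
  obtain p where p: "\<And>i. i \<in> {1..N} \<Longrightarrow> d i > 0 \<Longrightarrow> p i \<in> {1..N} \<and> a i (p i) > 0 \<and> d (p i) < d i"
    using d(2) by metis
  define s where "s i = (\<Sum>j=1..N. a i j)" for i
  have s0: "s i \<ge> 0" if "i \<in> {1..N}" for i unfolding s_def using a0 that by (intro sum_nonneg) auto
  \<comment> \<open>M - 1 exceeds every ratio of the total incoming weight \<open>s i\<close> to the
    weight of the edge from the parent; a sum instead of a maximum needs no nonempty index set. With
    q = 1 / M the increase from depth d - 1 to d is q^d (M - 1).\<close>
  define M where "M = 2 + (\<Sum>i\<in>{i\<in>{1..N}. d i > 0}. s i / a i (p i))"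
  have M2: "M \<ge> 2" unfolding M_def using s0 p by (auto intro!: sum_nonneg divide_nonneg_pos)
  have M: "s i < a i (p i) * (M - 1)" if i: "i \<in> {1..N}" "d i > 0" for i
  proof -
    have "s i / a i (p i) \<le> (\<Sum>i\<in>{i\<in>{1..N}. d i > 0}. s i / a i (p i))"
      by (rule member_le_sum) (use i s0 p in \<open>auto intro!: divide_nonneg_pos\<close>)
    then have "s i / a i (p i) < M - 1" by (simp add: M_def)
    then show ?thesis using p[OF i] by (simp add: divide_less_eq mult.commute)
  qed
  define q where "q = 1 / M"
  have q: "q > 0" "q < 1" using M2 by (auto simp: q_def)
  \<comment> \<open>At depth 0 the pinning term K - 1 alone has to outweigh the loss of at most
    \<open>s i\<close> through incoming edges.\<close>
  define K where "K = 2 + (\<Sum>i=1..N. s i)"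
  define \<xi> where "\<xi> i = K - q ^ d i" for i
  have qp: "0 < q ^ k" "q ^ k \<le> 1" for k using q by (auto intro: power_le_one)
  have sK: "s i \<le> (\<Sum>i=1..N. s i)" if "i \<in> {1..N}" for i by (rule member_le_sum) (use that s0 in auto)
  have K2: "K \<ge> 2" unfolding K_def using s0 by (auto intro!: sum_nonneg)
  have \<xi>0: "\<xi> i > 0" for i using qp[of "d i"] K2 by (simp add: \<xi>_def)
  define L where "L i = (\<Sum>j=1..N. a i j * (\<xi> i - \<xi> j)) + (if i \<in> C then 1 else 0) * \<xi> i" for i
  have L: "L i > 0" if i: "i \<in> {1..N}" for i
  proof -
    \<comment> \<open>All \<xi> stay below K, so an edge loses at most q^(d i) times its
      weight.\<close>
    have ge: "a i j * (\<xi> i - \<xi> j) \<ge> - (q ^ d i) * a i j" if j: "j \<in> {1..N}" for j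
    proof -
      have "a i j * (\<xi> i - \<xi> j) \<ge> a i j * (- (q ^ d i))"
        by (rule mult_left_mono) (use a0 i j qp[of "d j"] in \<open>auto simp: \<xi>_def\<close>)
      then show ?thesis by (simp add: mult.commute)
    qed
    show ?thesis
    proof (cases "d i = 0")
      case True
      then have iC: "i \<in> C" using d(1) i by blast
      have "(\<Sum>j=1..N. a i j * (\<xi> i - \<xi> j)) \<ge> (\<Sum>j=1..N. - (q ^ d i) * a i j)"
        by (rule sum_mono) (use ge in auto)
      then have "(\<Sum>j=1..N. a i j * (\<xi> i - \<xi> j)) \<ge> - s i" using True by (simp add: s_def sum_negf)
      moreover have "\<xi> i = K - 1" using True by (simp add: \<xi>_def)
      ultimately have "L i \<ge> K - 1 - s i" using iC by (simp add: L_def)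
      then show ?thesis using sK[OF i] by (simp add: K_def)
    next
      case False
      then have di: "d i > 0" by simp
      note pi = p[OF i di]
      have "(\<Sum>j=1..N. a i j * (\<xi> i - \<xi> j))
          = a i (p i) * (\<xi> i - \<xi> (p i)) + (\<Sum>j\<in>{1..N}-{p i}. a i j * (\<xi> i - \<xi> j))"
        by (rule sum.remove) (use pi in auto)
      moreover have "(\<Sum>j\<in>{1..N}-{p i}. a i j * (\<xi> i - \<xi> j)) \<ge> (\<Sum>j\<in>{1..N}-{p i}. - (q ^ d i) * a i j)"
        by (rule sum_mono) (use ge in auto)
      moreover have "(\<Sum>j\<in>{1..N}-{p i}. - (q ^ d i) * a i j) \<ge> - (q ^ d i) * s i"
      proof -
        have "(\<Sum>j\<in>{1..N}-{p i}. a i j) \<le> s i" unfolding s_def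
          by (rule sum_mono2) (use a0 i in auto)
        then have "q ^ d i * (\<Sum>j\<in>{1..N}-{p i}. a i j) \<le> q ^ d i * s i"
          using qp(1)[of "d i"] by (intro mult_left_mono) auto
        then show ?thesis by (simp add: sum_distrib_left[symmetric] sum_negf)
      qed
      moreover have "a i (p i) * (\<xi> i - \<xi> (p i)) \<ge> q ^ d i * (a i (p i) * (M - 1))"
      proof -
        have "q ^ (d i - 1) \<le> q ^ d (p i)" by (rule power_decreasing) (use pi q in auto)
        moreover have "q ^ (d i - 1) = q ^ d i * M"
          using di M2 by (cases "d i") (auto simp: q_def)
        ultimately have "q ^ d i * (M - 1) \<le> \<xi> i - \<xi> (p i)" by (simp add: \<xi>_def algebra_simps)
        then have "a i (p i) * (q ^ d i * (M - 1)) \<le> a i (p i) * (\<xi> i - \<xi> (p i))"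
          using pi by (intro mult_left_mono) auto
        then show ?thesis by (simp add: algebra_simps)
      qed
      moreover have "(if i \<in> C then 1 else 0) * \<xi> i \<ge> 0" using \<xi>0[of i] by simp
      moreover have "q ^ d i * s i < q ^ d i * (a i (p i) * (M - 1))"
        using M[OF i di] qp(1)[of "d i"] by (intro mult_strict_left_mono) auto
      ultimately show ?thesis unfolding L_def by linarith
    qed
  qed
  \<comment> \<open>The 1 covers the empty node set; the factor 2 keeps one \<kappa> in reserve for
    a forcing term.\<close>
  define \<kappa> where "\<kappa> = Min (insert 1 ((\<lambda>i. L i / (2 * \<xi> i)) ` {1..N}))"
  have "\<kappa> > 0" unfolding \<kappa>_def using L \<xi>0 by (subst Min_gr_iff) auto
  moreover have "2 * \<kappa> * \<xi> i \<le> L i" if "i \<in> {1..N}" for i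
  proof -
    have "\<kappa> \<le> L i / (2 * \<xi> i)" unfolding \<kappa>_def by (rule Min_le) (use that in auto)
    then show ?thesis using \<xi>0[of i] by (simp add: field_simps)
  qed
  ultimately show ?thesis using \<xi>0 unfolding L_def by blast
qed

text \<open>The weighted squares |E_i|^2 exp (k' t) are compared with the constants M \<xi>_i. Re l
  \<le> 0 removes the scalar l, and 2 E_i . (E_i - E_j) \<ge> |E_i|^2 - |E_j|^2 turns the coupling
  into the scalar Laplacian, for which \<xi> is a strict supersolution.\<close>

lemma network_decay_step:
  fixes E G :: "nat \<Rightarrow> real \<Rightarrow> complex^'n"
  assumes a0: "\<And>i j. i \<in> {1..N} \<Longrightarrow> j \<in> {1..N} \<Longrightarrow> a i j \<ge> 0" and c0: "\<And>i. c i \<ge> 0"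
    and kappa: "\<kappa> > 0" and xi: "\<And>i. i \<in> {1..N} \<Longrightarrow> \<xi> i > 0"
    and super: "\<And>i. i \<in> {1..N} \<Longrightarrow> 2 * \<kappa> * \<xi> i \<le> (\<Sum>j=1..N. a i j * (\<xi> i - \<xi> j)) + c i * \<xi> i"
    and der: "\<And>i t. i \<in> {1..N} \<Longrightarrow> t \<ge> 0 \<Longrightarrow> (E i has_vector_derivative
       (l *s E i t + G i t - (\<Sum>j=1..N. a i j *\<^sub>R (E i t - E j t)) - c i *\<^sub>R E i t)) (at t within {0..})"
    and l: "Re l \<le> 0" and k: "k > 0" and K0: "K \<ge> 0"
    and G: "\<And>i t. i \<in> {1..N} \<Longrightarrow> t \<ge> 0 \<Longrightarrow> (norm (G i t))^2 \<le> K * exp (- k * t)"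
  shows "\<exists>K' k'. K' \<ge> 0 \<and> k' > 0 \<and> (\<forall>i\<in>{1..N}. \<forall>t\<ge>0. (norm (E i t))^2 \<le> K' * exp (- k' * t))"
proof -
  \<comment> \<open>Of the rate 2 \<kappa>, one \<kappa> pays for Young's inequality with G,
    \<kappa> / 2 for the growth of exp (k' t), and \<kappa> / 2 stays to beat the forcing K /
    \<kappa>; k' \<le> k keeps the weighted forcing bounded.\<close>
  define k' where "k' = min k (\<kappa> / 2)"
  have k': "k' > 0" "k' \<le> k" "k' \<le> \<kappa> / 2" using k kappa by (auto simp: k'_def)
  \<comment> \<open>The threshold 2 K / \<kappa>^2 is where the remaining \<kappa> / 2 balances K /
    \<kappa>.\<close>
  define h where "h i = ((norm (E i 0))^2 + 2 * K / \<kappa>^2) / \<xi> i" for i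
  have h0: "h i \<ge> 0" if "i \<in> {1..N}" for i unfolding h_def using xi[OF that] K0 by auto
  define M where "M = 1 + (\<Sum>i=1..N. h i)"
  have M1: "M \<ge> 1" unfolding M_def using h0 by (auto intro!: sum_nonneg)
  have M: "(norm (E i 0))^2 + 2 * K / \<kappa>^2 < M * \<xi> i" if i: "i \<in> {1..N}" for i
  proof -
    have "h i \<le> (\<Sum>i=1..N. h i)" by (rule member_le_sum) (use i h0 in auto)
    then have "h i < M" by (simp add: M_def)
    then show ?thesis using xi[OF i] unfolding h_def by (simp add: divide_less_eq)
  qed
  define E' where "E' i t = l *s E i t + G i t - (\<Sum>j=1..N. a i j *\<^sub>R (E i t - E j t)) - c i *\<^sub>R E i t" for i t
  define m where "m i t = (norm (E i t))^2 * exp (k' * t) - M * \<xi> i" for i t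
  define m' where "m' i t = exp (k' * t) * (2 * (E i t \<bullet> E' i t) + k' * (norm (E i t))^2)" for i t
  have "m i t < 0" if "i \<in> {1..N}" "t \<ge> 0" for i t
  proof (rule maximum_principle[of "{1..N}" m m'])
    fix i t assume i: "i \<in> {1..N}" and t: "(t::real) \<ge> 0"
    show "(m i has_real_derivative m' i t) (at t within {0..})"
      unfolding m_def m'_def E'_def
      by (rule derivative_eq_intros has_real_derivative_norm_power2[OF der[OF i t]] refl)+
         (simp add: algebra_simps)
  next
    fix i assume i: "i \<in> {1..N}"
    have "2 * K / \<kappa>^2 \<ge> 0" using K0 by simp
    then show "m i 0 < 0" using M[OF i] by (simp add: m_def)
  next
    fix i t assume i: "i \<in> {1..N}" and t: "(t::real) \<ge> 0" and mi: "m i t = 0"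
      and mj: "\<And>j. j \<in> {1..N} \<Longrightarrow> m j t \<le> 0"
    define z where "z j = (norm (E j t))^2" for j
    define x where "x = exp (k' * t)"
    have x: "x > 0" by (simp add: x_def)
    have zi: "x * z i = M * \<xi> i" using mi by (simp add: m_def z_def x_def mult.commute)
    have zj: "x * z j \<le> M * \<xi> j" if "j \<in> {1..N}" for j
      using mj[OF that] by (simp add: m_def z_def x_def mult.commute)
    have "2 * (E i t \<bullet> E' i t) = 2 * Re l * z i + 2 * (E i t \<bullet> G i t)
        - (\<Sum>j=1..N. a i j * (2 * z i - 2 * (E i t \<bullet> E j t))) - 2 * c i * z i"
    proof -
      have "E i t \<bullet> (l *s E i t) = Re l * z i" using inner_smult_self[of l "E i t"] by (simp add: z_def inner_commute)
      moreover have "2 * (E i t \<bullet> (\<Sum>j=1..N. a i j *\<^sub>R (E i t - E j t)))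
          = (\<Sum>j=1..N. a i j * (2 * z i - 2 * (E i t \<bullet> E j t)))"
        by (simp add: inner_sum_right sum_distrib_left inner_diff_right z_def dot_square_norm algebra_simps)
      ultimately show ?thesis
        by (simp add: E'_def inner_add_right inner_diff_right z_def dot_square_norm algebra_simps)
    qed
    also have "\<dots> \<le> 0 + (\<kappa> * z i + (norm (G i t))^2 / \<kappa>) - (\<Sum>j=1..N. a i j * (z i - z j)) - c i * z i"
    proof (intro add_mono diff_mono)
      show "2 * Re l * z i \<le> 0" using l by (simp add: z_def mult_nonpos_nonneg)
      show "2 * (E i t \<bullet> G i t) \<le> \<kappa> * z i + (norm (G i t))^2 / \<kappa>"
        unfolding z_def by (rule two_inner_le[OF kappa])
      show "(\<Sum>j=1..N. a i j * (z i - z j)) \<le> (\<Sum>j=1..N. a i j * (2 * z i - 2 * (E i t \<bullet> E j t)))"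
      proof (intro sum_mono mult_left_mono)
        fix j assume "j \<in> {1..N}"
        then show "a i j \<ge> 0" using a0 i by blast
        show "z i - z j \<le> 2 * z i - 2 * (E i t \<bullet> E j t)"
          using two_inner_le[of 1 "E i t" "E j t"] by (simp add: z_def)
      qed
      show "c i * z i \<le> 2 * c i * z i" using c0[of i] by (simp add: z_def)
    qed
    finally have "x * (2 * (E i t \<bullet> E' i t)) \<le> x * (0 + (\<kappa> * z i + (norm (G i t))^2 / \<kappa>)
        - (\<Sum>j=1..N. a i j * (z i - z j)) - c i * z i)" using x by (intro mult_left_mono) auto
    also have "\<dots> = \<kappa> * (x * z i) + x * (norm (G i t))^2 / \<kappa> - (\<Sum>j=1..N. a i j * (x * z i - x * z j)) - c i * (x * z i)"
      by (simp add: algebra_simps sum_distrib_left)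
    also have "\<dots> \<le> \<kappa> * (M * \<xi> i) + K / \<kappa> - (\<Sum>j=1..N. a i j * (M * \<xi> i - M * \<xi> j)) - c i * (M * \<xi> i)"
    proof -
      have "x * (norm (G i t))^2 \<le> x * (K * exp (- k * t))" using G[OF i t] x by simp
      also have "\<dots> = K * exp ((k' - k) * t)" by (simp add: x_def algebra_simps flip: exp_add)
      also have "\<dots> \<le> K * 1" using K0 k' t by (intro mult_left_mono) (auto simp: mult_nonpos_nonneg)
      finally have "x * (norm (G i t))^2 / \<kappa> \<le> K / \<kappa>" using kappa by (simp add: divide_right_mono)
      moreover have "(\<Sum>j=1..N. a i j * (M * \<xi> i - M * \<xi> j)) \<le> (\<Sum>j=1..N. a i j * (x * z i - x * z j))"
        using a0 i zj unfolding zi by (intro sum_mono mult_left_mono) auto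
      ultimately show ?thesis unfolding zi by linarith
    qed
    also have "\<dots> = \<kappa> * (M * \<xi> i) + K / \<kappa> - M * ((\<Sum>j=1..N. a i j * (\<xi> i - \<xi> j)) + c i * \<xi> i)"
      by (simp add: algebra_simps sum_distrib_left)
    also have "\<dots> \<le> \<kappa> * (M * \<xi> i) + K / \<kappa> - M * (2 * \<kappa> * \<xi> i)"
      using super[OF i] M1 by simp
    finally have b: "x * (2 * (E i t \<bullet> E' i t)) \<le> K / \<kappa> - \<kappa> * (M * \<xi> i)" by (simp add: algebra_simps)
    have "m' i t = x * (2 * (E i t \<bullet> E' i t)) + k' * (x * z i)"
      by (simp add: m'_def x_def z_def algebra_simps)
    also have "\<dots> \<le> K / \<kappa> - \<kappa> * (M * \<xi> i) + k' * (M * \<xi> i)" using b unfolding zi by simp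
    also have "\<dots> \<le> K / \<kappa> - \<kappa> * (M * \<xi> i) + (\<kappa> / 2) * (M * \<xi> i)"
      using k' M1 xi[OF i] by (intro add_left_mono mult_right_mono) auto
    also have "\<dots> = (\<kappa> / 2) * (2 * K / \<kappa>^2 - M * \<xi> i)" using kappa by (simp add: field_simps power2_eq_square)
    also have "\<dots> < 0"
    proof -
      have "2 * K / \<kappa>^2 - M * \<xi> i < 0" using M[OF i] zero_le_power2[of "norm (E i 0)"] by linarith
      then show ?thesis using kappa by (intro mult_pos_neg) auto
    qed
    finally show "m' i t < 0" .
  qed (use that in auto)
  then have "(norm (E i t))^2 \<le> (M * (\<Sum>i=1..N. \<xi> i)) * exp (- k' * t)" if i: "i \<in> {1..N}" and t: "t \<ge> 0" for i t
  proof -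
    have "(norm (E i t))^2 * exp (k' * t) \<le> M * \<xi> i"
      using \<open>\<And>i t. i \<in> {1..N} \<Longrightarrow> t \<ge> 0 \<Longrightarrow> m i t < 0\<close>[OF i t] by (simp add: m_def)
    also have "\<dots> \<le> M * (\<Sum>i=1..N. \<xi> i)"
      using M1 xi i by (intro mult_left_mono member_le_sum) (auto intro: less_imp_le)
    finally show ?thesis by (simp add: exp_minus field_simps)
  qed
  moreover have "M * (\<Sum>i=1..N. \<xi> i) \<ge> 0" using M1 xi by (intro mult_nonneg_nonneg sum_nonneg) (auto intro: less_imp_le)
  ultimately show ?thesis using k' by blast
qed

section \<open>Descent through the annihilating product\<close>

lemma bounded_linear_shift_op: "bounded_linear (shift_op A l)"
  unfolding shift_op_def
  by (intro bounded_linear_sub matrix_vector_mul_bounded_linear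
      bounded_bilinear.bounded_linear_right[OF bounded_bilinear_smult])

lemma bounded_linear_shifts: "bounded_linear (shifts A ls)"
proof (induction ls)
  case Nil
  then show ?case by (simp add: bounded_linear_ident)
next
  case (Cons l ls)
  then show ?case using bounded_linear_compose[OF bounded_linear_shift_op] by (simp add: o_def)
qed

lemma shifts_mult_vec: "shifts A ls (A *v y) = A *v shifts A ls y"
  using shifts_shift_op[of A ls 0 y] by (simp add: shift_op_def)

text \<open>An imaginary eigenvalue with a Jordan block makes A dissipative in no inner product. The
  descent avoids this: with E the image of e under the remaining factors, A E = l E + G, where G
  carries one more factor and already decays, so A acts like the scalar l. The coupling mixes nodes
  only and commutes with the factors.\<close>

lemma network_decay:
  fixes e :: "nat \<Rightarrow> real \<Rightarrow> real^'n"
  assumes g: "graph_class N C a" and lhp: "\<forall>lam. is_eig A lam \<longrightarrow> Re lam \<le> 0"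
    and der: "\<And>i t. i \<in> {1..N} \<Longrightarrow> t \<ge> 0 \<Longrightarrow> (e i has_vector_derivative
       (A *v e i t - (\<Sum>j=1..N. a i j *\<^sub>R (e i t - e j t)) - (if i \<in> C then 1 else 0) *\<^sub>R e i t)) (at t within {0..})"
  shows "\<exists>K k. K \<ge> 0 \<and> k > 0 \<and> (\<forall>i\<in>{1..N}. \<forall>t\<ge>0. (norm (e i t))^2 \<le> K * exp (- k * t))"
proof -
  obtain \<xi> \<kappa> where kappa: "\<kappa> > 0" and xi: "\<And>i. i \<in> {1..N} \<Longrightarrow> \<xi> i > 0"
    and super: "\<And>i. i \<in> {1..N} \<Longrightarrow> 2 * \<kappa> * \<xi> i \<le> (\<Sum>j=1..N. a i j * (\<xi> i - \<xi> j)) + (if i \<in> C then 1 else 0) * \<xi> i"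
    using graph_class_supersolution[OF g] by metis
  obtain ls where ls: "\<And>l. l \<in> set ls \<Longrightarrow> is_eig A l" "\<And>y. shifts (cmat A) ls y = 0"
    using ex_eigenvalue_shifts_zero[of A] by blast
  define P where "P ks \<longleftrightarrow> (\<exists>K k. K \<ge> 0 \<and> k > 0 \<and>
      (\<forall>i\<in>{1..N}. \<forall>t\<ge>0. (norm (shifts (cmat A) ks (cvec (e i t))))^2 \<le> K * exp (- k * t)))" for ks
  have step: "P ks" if "P (l # ks)" and l: "Re l \<le> 0" for l ks
  proof -
    define E where "E i t = shifts (cmat A) ks (cvec (e i t))" for i t
    define G where "G i t = shifts (cmat A) (l # ks) (cvec (e i t))" for i t
    obtain K k where Kk: "K \<ge> 0" "k > 0" "\<And>i t. i \<in> {1..N} \<Longrightarrow> t \<ge> 0 \<Longrightarrow> (norm (G i t))^2 \<le> K * exp (- k * t)"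
      using \<open>P (l # ks)\<close> unfolding P_def G_def by blast
    have bl: "bounded_linear (\<lambda>y. shifts (cmat A) ks (cvec y))"
      by (rule bounded_linear_compose[OF bounded_linear_shifts bounded_linear_cvec])
    note lin = bounded_linear.linear[OF bl]
    have dE: "(E i has_vector_derivative
       (l *s E i t + G i t - (\<Sum>j=1..N. a i j *\<^sub>R (E i t - E j t)) - (if i \<in> C then 1 else 0) *\<^sub>R E i t)) (at t within {0..})"
      if i: "i \<in> {1..N}" and t: "t \<ge> 0" for i t
    proof -
      have "l *s E i t + G i t = shifts (cmat A) ks (cvec (A *v e i t))"
        by (simp add: G_def E_def shift_op_def shifts_mult_vec flip: cmat_mult_cvec)
      then have eq: "l *s E i t + G i t - (\<Sum>j=1..N. a i j *\<^sub>R (E i t - E j t)) - (if i \<in> C then 1 else 0) *\<^sub>R E i t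
        = shifts (cmat A) ks (cvec (A *v e i t - (\<Sum>j=1..N. a i j *\<^sub>R (e i t - e j t)) - (if i \<in> C then 1 else 0) *\<^sub>R e i t))"
        unfolding E_def
        by (simp only: linear_diff[OF lin] linear_sum[OF lin] linear_scale[OF lin])
      show ?thesis unfolding eq unfolding E_def
        by (rule bounded_linear.has_vector_derivative[OF bl der[OF i t]])
    qed
    have a0: "a i j \<ge> 0" if "i \<in> {1..N}" "j \<in> {1..N}" for i j using g that by (simp add: graph_class_def)
    have "\<exists>K' k'. K' \<ge> 0 \<and> k' > 0 \<and> (\<forall>i\<in>{1..N}. \<forall>t\<ge>0. (norm (E i t))^2 \<le> K' * exp (- k' * t))"
      by (rule network_decay_step[OF a0 _ kappa xi super dE l Kk(2,1,3)]) auto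
    then show ?thesis by (simp add: P_def E_def)
  qed
  have "P (ks @ []) \<Longrightarrow> set ks \<subseteq> set ls \<Longrightarrow> P []" for ks
  proof (induction ks)
    case (Cons l ks)
    then show ?case using step[of l ks] lhp ls(1) by auto
  qed simp
  \<comment> \<open>The descent starts from the full product, which is identically zero.\<close>
  moreover have "P (ls @ [])" unfolding P_def by (intro exI[of _ 0] exI[of _ 1]) (simp add: ls(2))
  ultimately have "P []" by blast
  then show ?thesis by (simp add: P_def)
qed

subsection \<open>Filters\<close>

lemma continuous_on_from_vector_derivative:
  assumes "\<And>t. t \<ge> 0 \<Longrightarrow> (f has_vector_derivative f' t) (at t within {0..})"
  shows "continuous_on {0::real..} f"
  unfolding continuous_on_eq_continuous_within
  using assms has_vector_derivative_continuous by fastforce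

lemma continuous_on_Icc:
  "continuous_on {0::real..} f \<Longrightarrow> 0 \<le> a \<Longrightarrow> continuous_on {a..b} f"
  by (erule continuous_on_subset) auto

lemma integrable_Icc:
  fixes f :: "real \<Rightarrow> real"
  shows "continuous_on {0..} f \<Longrightarrow> 0 \<le> a \<Longrightarrow> f integrable_on {a..b}"
  by (intro integrable_continuous_interval continuous_on_Icc)

lemma integral_nonneg_Icc:
  fixes f :: "real \<Rightarrow> real"
  shows "continuous_on {0..} f \<Longrightarrow> 0 \<le> a \<Longrightarrow> (\<And>t. t \<ge> 0 \<Longrightarrow> f t \<ge> 0) \<Longrightarrow> integral {a..b} f \<ge> 0"
  by (intro integral_nonneg integrable_Icc) auto

lemma integral_le_Icc:
  fixes f g :: "real \<Rightarrow> real"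
  assumes "continuous_on {0..} f" "continuous_on {0..} g" "0 \<le> a" "\<And>t. a \<le> t \<Longrightarrow> t \<le> b \<Longrightarrow> f t \<le> g t"
  shows "integral {a..b} f \<le> integral {a..b} g"
  by (rule integral_le) (use assms integrable_Icc in auto)

lemma integral_subinterval_le:
  fixes f :: "real \<Rightarrow> real"
  assumes "continuous_on {0..} f" "0 \<le> a" "a \<le> a'" "b' \<le> b" "\<And>t. t \<ge> 0 \<Longrightarrow> f t \<ge> 0"
  shows "integral {a'..b'} f \<le> integral {a..b} f"
  by (rule integral_subset_le) (use assms integrable_Icc in auto)

lemma integral_combine_Icc:
  fixes f :: "real \<Rightarrow> real"
  assumes "continuous_on {0..} f" "0 \<le> a" "a \<le> b" "b \<le> c"
  shows "integral {a..b} f + integral {b..c} f = integral {a..c} f"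
  using assms by (intro Henstock_Kurzweil_Integration.integral_combine integrable_Icc)

abbreviation energy :: "real \<Rightarrow> real \<Rightarrow> (real \<Rightarrow> 'a::real_normed_vector) \<Rightarrow> real" where
  "energy a b f \<equiv> integral {a..b} (\<lambda>t. (norm (f t))^2)"

lemma growth_le_integral:
  fixes F h :: "real \<Rightarrow> real"
  assumes ab: "0 \<le> a" "a \<le> b"
    and der: "\<And>t. a \<le> t \<Longrightarrow> t \<le> b \<Longrightarrow> (F has_real_derivative F' t) (at t within {0..})"
    and le: "\<And>t. a \<le> t \<Longrightarrow> t \<le> b \<Longrightarrow> F' t \<le> h t" and cont: "continuous_on {0..} h"
  shows "F b - F a \<le> integral {a..b} h"
proof -
  have "(F' has_integral (F b - F a)) {a..b}"
  proof (rule fundamental_theorem_of_calculus[OF ab(2)])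
    fix t assume "t \<in> {a..b}"
    then have "(F has_real_derivative F' t) (at t within {a..b})"
      using ab by (intro DERIV_subset[OF der]) auto
    then show "(F has_vector_derivative F' t) (at t within {a..b})"
      by (simp add: has_real_derivative_iff_has_vector_derivative)
  qed
  moreover have "(h has_integral integral {a..b} h) {a..b}"
    using integrable_Icc[OF cont ab(1)] by (rule integrable_integral)
  ultimately show ?thesis by (rule has_integral_le) (use le in auto)
qed

lemma integral_has_vector_derivative_atLeast:
  fixes h :: "real \<Rightarrow> 'a::banach"
  assumes "continuous_on {c..} h" "t \<ge> c"
  shows "((\<lambda>t. integral {c..t} h) has_vector_derivative h t) (at t within {c..})"
proof -
  have "continuous_on {c..t+1} h" using assms(1) by (rule continuous_on_subset) auto
  then have "((\<lambda>t. integral {c..t} h) has_vector_derivative h t) (at t within {c..t+1})"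
    by (rule integral_has_vector_derivative) (use assms in auto)
  moreover have "at t within {c..t+1} = at t within {c..}"
    by (rule at_within_nhd[of _ "{..<t+1}"]) auto
  ultimately show ?thesis by simp
qed

lemma norm_add_power2_le: "(norm (u + w))^2 \<le> 2 * (norm u)^2 + 2 * (norm w)^2" for u w :: "'a::real_inner"
proof -
  have "(norm (u + w))^2 = (norm u)^2 + (norm w)^2 + 2 * (u \<bullet> w)"
    by (simp add: power2_norm_eq_inner inner_add_left inner_add_right inner_commute)
  with two_inner_le[of 1 u w] show ?thesis by simp
qed

text \<open>The zero-state response of 1 / (s - \<mu>): variation of constants for y' = \<mu> y + h
  with y 0 = 0.\<close>

definition causal_filter :: "complex \<Rightarrow> (real \<Rightarrow> complex^'n) \<Rightarrow> real \<Rightarrow> complex^'n" where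
  "causal_filter \<mu> h t = exp (of_real t * \<mu>) *s integral {0..t} (\<lambda>s. exp (- of_real s * \<mu>) *s h s)"

lemma causal_filter_0: "causal_filter \<mu> h 0 = 0"
  by (simp add: causal_filter_def)

lemma continuous_on_smult:
  "continuous_on S c \<Longrightarrow> continuous_on S x \<Longrightarrow> continuous_on S (\<lambda>t. c t *s (x t :: complex^'n))"
  by (rule bounded_bilinear.continuous_on[OF bounded_bilinear_smult])

lemma has_vector_derivative_exp_of_real:
  fixes \<mu> :: complex
  shows "((\<lambda>t. exp (of_real t * \<mu>)) has_vector_derivative \<mu> * exp (of_real t * \<mu>)) (at t within S)"
proof -
  have "((\<lambda>z. exp (z * \<mu>)) has_field_derivative \<mu> * exp (of_real t * \<mu>)) (at (of_real t))"
    by (auto intro!: derivative_eq_intros)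
  from has_vector_derivative_real_field[OF this] show ?thesis
    by (rule has_vector_derivative_at_within)
qed

lemma causal_filter_derivative:
  assumes h: "continuous_on {0..} h" and t: "t \<ge> 0"
  shows "(causal_filter \<mu> h has_vector_derivative (\<mu> *s causal_filter \<mu> h t + h t)) (at t within {0..})"
proof -
  let ?I = "\<lambda>t. integral {0..t} (\<lambda>s. exp (- of_real s * \<mu>) *s h s)"
  have "continuous_on {0..} (\<lambda>s. exp (- of_real s * \<mu>) *s h s)"
    by (intro continuous_on_smult continuous_intros h)
  from integral_has_vector_derivative_atLeast[OF this t]
  have I: "(?I has_vector_derivative exp (- of_real t * \<mu>) *s h t) (at t within {0..})" .
  have e: "exp (of_real t * \<mu>) * exp (- of_real t * \<mu>) = 1"
    by (simp flip: exp_add)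
  show ?thesis unfolding causal_filter_def
    using bounded_bilinear.has_vector_derivative[OF bounded_bilinear_smult has_vector_derivative_exp_of_real I, of \<mu>] e
    by (simp add: vector_smult_assoc add.commute)
qed

text \<open>w is the low-pass and v - w the notch output for v. With Re l \<le> 0 the derivative of
  |w|^2 / \<gamma> is at most 2 w . (v - w) = |v|^2 - |w|^2 - |v - w|^2, so the two outputs share
  the energy of the input.\<close>

lemma filter_contraction:
  fixes w v :: "real \<Rightarrow> complex^'n"
  assumes der: "\<And>t. t \<ge> 0 \<Longrightarrow> (w has_vector_derivative (l *s w t + \<gamma> *\<^sub>R (v t - w t))) (at t within {0..})"
    and v: "continuous_on {0..} v" and w0: "w 0 = 0" and l: "Re l \<le> 0" and g: "\<gamma> > 0" and T: "T \<ge> 0"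
  shows "energy 0 T w + energy 0 T (\<lambda>t. v t - w t)
     \<le> energy 0 T v"
proof -
  have w: "continuous_on {0..} w" using der by (rule continuous_on_from_vector_derivative)
  let ?h = "\<lambda>t. (norm (v t))^2 - ((norm (w t))^2 + (norm (v t - w t))^2)"
  have "(norm (w T))^2 / \<gamma> - (norm (w 0))^2 / \<gamma> \<le> integral {0..T} ?h"
  proof (rule growth_le_integral[where F = "\<lambda>t. (norm (w t))^2 / \<gamma>" and a = 0 and b = T])
    fix t assume t: "0 \<le> t" "t \<le> T"
    show "((\<lambda>t. (norm (w t))^2 / \<gamma>) has_real_derivative
       2 * (w t \<bullet> (l *s w t + \<gamma> *\<^sub>R (v t - w t))) / \<gamma>) (at t within {0..})"
      by (rule DERIV_cdivide has_real_derivative_norm_power2 der t)+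
    have "w t \<bullet> (l *s w t) \<le> 0"
      using inner_smult_self[of l "w t"] l by (simp add: inner_commute mult_nonpos_nonneg)
    then have "2 * (w t \<bullet> (l *s w t + \<gamma> *\<^sub>R (v t - w t))) / \<gamma> \<le> 2 * (w t \<bullet> (v t - w t))"
      using g by (simp add: inner_add_right divide_le_eq distrib_left mult.assoc mult.commute)
    also have "\<dots> = ?h t"
      by (simp add: power2_norm_eq_inner inner_diff_left inner_diff_right inner_commute)
    finally show "2 * (w t \<bullet> (l *s w t + \<gamma> *\<^sub>R (v t - w t))) / \<gamma> \<le> ?h t" .
  qed (use T in \<open>auto intro!: continuous_intros v w\<close>)
  moreover have "integral {0..T} ?h = energy 0 T v -
      (energy 0 T w + energy 0 T (\<lambda>t. v t - w t))"
    by (subst integral_diff integral_add, (intro integrable_Icc continuous_intros v w order_refl)+)+ simp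
  moreover have "(norm (w T))^2 / \<gamma> \<ge> 0" using g by simp
  ultimately show ?thesis using w0 by simp
qed

text \<open>Half of the decay -2 \<gamma> |g|^2 absorbs the product with f by Young's inequality,
  which gives the energy gain 1 / \<gamma>^2. Initial values are allowed, since the residuals to
  which this is applied need not start at zero.\<close>

lemma filter_gain:
  fixes g f :: "real \<Rightarrow> complex^'n"
  assumes der: "\<And>t. t \<ge> 0 \<Longrightarrow> (g has_vector_derivative ((l - of_real \<gamma>) *s g t + f t)) (at t within {0..})"
    and f: "continuous_on {0..} f" and l: "Re l \<le> 0" and gam: "\<gamma> > 0" and T: "T \<ge> 0"
  shows "energy 0 T g \<le> energy 0 T f / \<gamma>^2 + (norm (g 0))^2 / \<gamma>"
proof -
  have g: "continuous_on {0..} g" using der by (rule continuous_on_from_vector_derivative)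
  let ?h = "\<lambda>t. (norm (f t))^2 / \<gamma> - \<gamma> * (norm (g t))^2"
  have "(norm (g T))^2 - (norm (g 0))^2 \<le> integral {0..T} ?h"
  proof (rule growth_le_integral[where F = "\<lambda>t. (norm (g t))^2" and a = 0 and b = T])
    fix t assume t: "0 \<le> t" "t \<le> T"
    show "((\<lambda>t. (norm (g t))^2) has_real_derivative
       2 * (g t \<bullet> ((l - of_real \<gamma>) *s g t + f t))) (at t within {0..})"
      by (rule has_real_derivative_norm_power2 der t)+
    have "g t \<bullet> ((l - of_real \<gamma>) *s g t) = (Re l - \<gamma>) * (norm (g t))^2"
      using inner_smult_self[of "l - of_real \<gamma>" "g t"] by (simp add: inner_commute)
    also have "\<dots> \<le> - \<gamma> * (norm (g t))^2" using l by (intro mult_right_mono) auto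
    finally show "2 * (g t \<bullet> ((l - of_real \<gamma>) *s g t + f t)) \<le> ?h t"
      using two_inner_le[OF gam, of "g t" "f t"] by (simp add: inner_add_right)
  qed (use T gam in \<open>auto intro!: continuous_intros f g\<close>)
  moreover have "integral {0..T} ?h = energy 0 T f / \<gamma> - \<gamma> * energy 0 T g"
    by (subst integral_diff) (use gam in \<open>auto intro!: integrable_Icc continuous_intros f g\<close>)
  ultimately have "\<gamma> * energy 0 T g \<le> energy 0 T f / \<gamma> + (norm (g 0))^2"
    using zero_le_power2[of "norm (g T)"] by linarith
  then have "energy 0 T g \<le> (energy 0 T f / \<gamma> + (norm (g 0))^2) / \<gamma>"
    using gam by (simp add: pos_le_divide_eq mult.commute)
  then show ?thesis by (simp add: add_divide_distrib power2_eq_square)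
qed

section \<open>Cascades of notch filters\<close>

lemmas has_vector_derivative_smult_right =
  bounded_linear.has_vector_derivative[OF bounded_bilinear.bounded_linear_right[OF bounded_bilinear_smult]]

lemmas has_vector_derivative_matrix_mult =
  bounded_linear.has_vector_derivative[OF matrix_vector_mul_bounded_linear]

lemmas continuous_on_matrix_mult = bounded_linear.continuous_on[OF matrix_vector_mul_bounded_linear]

text \<open>\<open>cascade\<close> applies successively the notch filters \<open>(s - \<lambda>) / (s - \<lambda> + \<gamma>)\<close>, and \<open>lowpass\<close>
  the filters \<open>1 / (s - \<lambda> + \<gamma>)\<close>.\<close>

primrec cascade :: "(nat \<Rightarrow> complex) \<Rightarrow> real \<Rightarrow> (real \<Rightarrow> complex^'n) \<Rightarrow> nat \<Rightarrow> real \<Rightarrow> complex^'n" where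
  "cascade l \<gamma> x 0 = x"
| "cascade l \<gamma> x (Suc k) =
    (\<lambda>t. cascade l \<gamma> x k t - \<gamma> *\<^sub>R causal_filter (l k - of_real \<gamma>) (cascade l \<gamma> x k) t)"

primrec lowpass :: "(nat \<Rightarrow> complex) \<Rightarrow> real \<Rightarrow> (real \<Rightarrow> complex^'n) \<Rightarrow> nat \<Rightarrow> real \<Rightarrow> complex^'n" where
  "lowpass l \<gamma> x 0 = x"
| "lowpass l \<gamma> x (Suc k) = causal_filter (l k - of_real \<gamma>) (lowpass l \<gamma> x k)"

lemma causal_filter_continuous: "continuous_on {0..} h \<Longrightarrow> continuous_on {0..} (causal_filter \<mu> h)"
  by (rule continuous_on_from_vector_derivative[OF causal_filter_derivative])

lemma cascade_continuous: "continuous_on {0..} x \<Longrightarrow> continuous_on {0..} (cascade l \<gamma> x k)"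
  by (induction k) (auto intro!: continuous_intros causal_filter_continuous)

lemma lowpass_continuous: "continuous_on {0..} x \<Longrightarrow> continuous_on {0..} (lowpass l \<gamma> x k)"
  by (induction k) (auto intro!: causal_filter_continuous)

text \<open>Regrouping l - \<gamma>: the tone, \<gamma> times the filter output, obeys the pure
  oscillation with eigenvalue l, driven only by \<gamma> times the signal that the notch leaves
  over.\<close>

lemma cascade_tone_derivative:
  assumes "continuous_on {0..} x" "t \<ge> 0"
  shows "((\<lambda>t. \<gamma> *\<^sub>R causal_filter (l k - of_real \<gamma>) (cascade l \<gamma> x k) t) has_vector_derivative
     (l k *s (\<gamma> *\<^sub>R causal_filter (l k - of_real \<gamma>) (cascade l \<gamma> x k) t) + \<gamma> *\<^sub>R cascade l \<gamma> x (Suc k) t))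
     (at t within {0..})"
proof -
  let ?f = "causal_filter (l k - of_real \<gamma>) (cascade l \<gamma> x k)"
  have "((\<lambda>t. \<gamma> *\<^sub>R ?f t) has_vector_derivative \<gamma> *\<^sub>R ((l k - of_real \<gamma>) *s ?f t + cascade l \<gamma> x k t)) (at t within {0..})"
    using bounded_linear.has_vector_derivative[OF bounded_linear_scaleR_right
        causal_filter_derivative[OF cascade_continuous[OF assms(1)] assms(2)]] .
  moreover have "\<gamma> *\<^sub>R ((l k - of_real \<gamma>) *s ?f t + cascade l \<gamma> x k t)
      = l k *s (\<gamma> *\<^sub>R ?f t) + \<gamma> *\<^sub>R cascade l \<gamma> x (Suc k) t"
    by (simp add: vec_eq_iff scaleR_conv_of_real[where 'a=complex] algebra_simps)
  ultimately show ?thesis by simp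
qed

text \<open>K is fixed before the solution, its forcing and the horizon. The right-hand side
  contains no energy of x, although x itself may grow.\<close>

definition cascade_estimate ::
  "complex^'n^'n \<Rightarrow> (nat \<Rightarrow> complex) \<Rightarrow> real \<Rightarrow> nat \<Rightarrow> real \<Rightarrow> bool" where
  "cascade_estimate A l \<gamma> n K \<longleftrightarrow> (\<forall>x f T. (\<forall>t\<ge>0. (x has_vector_derivative (A *v x t + f t)) (at t within {0..})) \<and>
     continuous_on {0..} f \<and> T \<ge> 0 \<longrightarrow>
     energy 0 T (cascade l \<gamma> x n)
       \<le> K * (energy 0 T f + (norm (x 0))^2))"

text \<open>On solutions of x' = A x + f the symbol s acts as A up to forcing, so the product of the
  factors (s - l) / (s - l + \<gamma>) should equal the matrix product \<open>M k\<close> applied to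
  the lowpass iterate, and \<open>M n\<close> is zero. Two defects of this heuristic are controlled:
  the residual g, which is the derivative of a lowpass iterate minus A times it and passes through
  the same low-pass filters starting from f; and F, the difference between the cascade and
  \<open>M k\<close> of the lowpass iterate.\<close>

lemma cascade_bound:
  fixes A :: "complex^'n^'n"
  assumes gam: "\<gamma> > 0" and l: "\<And>k. k < n \<Longrightarrow> Re (l k) \<le> 0"
    and ann: "\<And>y. shifts A (map l [0..<n]) y = 0"
  shows "\<exists>K\<ge>0. cascade_estimate A l \<gamma> n K"
proof -
  define M where "M k = shifts A (map l [0..<k])" for k
  have MS: "M (Suc k) y = M k (A *v y - l k *s y)" for k y
    by (simp add: M_def shifts_append shift_op_def)
  have blM: "bounded_linear (M k)" for k unfolding M_def by (rule bounded_linear_shifts)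
  define g where "g x f k = (case k of 0 \<Rightarrow> f
    | Suc k \<Rightarrow> (\<lambda>t. (l k - of_real \<gamma>) *s lowpass l \<gamma> x (Suc k) t + lowpass l \<gamma> x k t - A *v lowpass l \<gamma> x (Suc k) t))"
    for x f k
  define F where "F x k t = cascade l \<gamma> x k t - M k (lowpass l \<gamma> x k t)" for x k t
  define sol where "sol x f \<longleftrightarrow> (\<forall>t\<ge>0. (x has_vector_derivative (A *v x t + f t)) (at t within {0..})) \<and>
     continuous_on {0..} f" for x f
  have xc: "continuous_on {0..} x" if "sol x f" for x f
    using that unfolding sol_def by (intro continuous_on_from_vector_derivative) auto
  have dZS: "(lowpass l \<gamma> x (Suc k) has_vector_derivative
     ((l k - of_real \<gamma>) *s lowpass l \<gamma> x (Suc k) t + lowpass l \<gamma> x k t)) (at t within {0..})"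
    if "sol x f" "t \<ge> 0" for x f k t
    unfolding lowpass.simps
    by (rule causal_filter_derivative[OF lowpass_continuous[OF xc[OF that(1)]] that(2)])
  have dZ: "(lowpass l \<gamma> x k has_vector_derivative (A *v lowpass l \<gamma> x k t + g x f k t)) (at t within {0..})"
    if "sol x f" "t \<ge> 0" for x f k t
  proof (cases k)
    case 0
    then show ?thesis using that by (simp add: g_def sol_def)
  next
    case (Suc j)
    then show ?thesis using dZS[OF that, of j] by (simp add: g_def algebra_simps)
  qed
  \<comment> \<open>The filters commute with A, hence the residual of the next iterate is the
    filtered residual.\<close>
  have dg: "(g x f (Suc k) has_vector_derivative ((l k - of_real \<gamma>) *s g x f (Suc k) t + g x f k t)) (at t within {0..})"
    if "sol x f" "t \<ge> 0" for x f k t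
  proof -
    let ?m = "l k - of_real \<gamma>" and ?Z = "lowpass l \<gamma> x"
    have "((\<lambda>t. ?m *s ?Z (Suc k) t + ?Z k t - A *v ?Z (Suc k) t) has_vector_derivative
       (?m *s (A *v ?Z (Suc k) t + g x f (Suc k) t) + (A *v ?Z k t + g x f k t)
         - A *v (?m *s ?Z (Suc k) t + ?Z k t))) (at t within {0..})"
      by (intro has_vector_derivative_add has_vector_derivative_diff dZ[OF that] dZS[OF that]
          has_vector_derivative_smult_right
          has_vector_derivative_matrix_mult)
    note d = this
    have eq: "?m *s (A *v ?Z (Suc k) t + g x f (Suc k) t) + (A *v ?Z k t + g x f k t)
         - A *v (?m *s ?Z (Suc k) t + ?Z k t) = ?m *s g x f (Suc k) t + g x f k t"
      by (simp add: matrix_vector_right_distrib matrix_vector_mult_diff_distrib vector_scalar_commute vector_add_ldistrib)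
    have gd: "g x f (Suc k) = (\<lambda>t. ?m *s ?Z (Suc k) t + ?Z k t - A *v ?Z (Suc k) t)"
      by (simp add: g_def)
    have "(g x f (Suc k) has_vector_derivative (?m *s (A *v ?Z (Suc k) t + g x f (Suc k) t)
        + (A *v ?Z k t + g x f k t) - A *v (?m *s ?Z (Suc k) t + ?Z k t))) (at t within {0..})"
      using d by (simp only: gd)
    then show ?thesis by (simp only: eq)
  qed
  have gc: "continuous_on {0..} (g x f k)" if "sol x f" for x f k
  proof (cases k)
    case 0
    then show ?thesis using that by (simp add: g_def sol_def)
  next
    case (Suc j)
    show ?thesis unfolding Suc using dg[OF that] by (rule continuous_on_from_vector_derivative)
  qed
  have Fc: "continuous_on {0..} (F x k)" if "sol x f" for x f k
    unfolding F_def
    by (intro continuous_intros cascade_continuous lowpass_continuous xc[OF that]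
        bounded_linear.continuous_on[OF blM])
  define D where "D x f T = energy 0 T f + (norm (x 0))^2"
    for x f :: "real \<Rightarrow> complex^'n" and T
  have D0: "norm (x 0) ^ 2 \<le> D x f T" if "sol x f" for x f T
    unfolding D_def using that
    by (auto simp: sol_def intro!: integral_nonneg_Icc continuous_intros)
  have G: "\<exists>K\<ge>0. \<forall>x f T. sol x f \<and> T \<ge> 0 \<longrightarrow> energy 0 T (g x f k) \<le> K * D x f T"
    if "k \<le> n" for k
    using that
  proof (induction k)
    case 0
    then show ?case by (intro exI[of _ 1]) (simp add: g_def D_def)
  next
    case (Suc k)
    then obtain K where K: "K \<ge> 0"
      "\<And>x f T. sol x f \<Longrightarrow> T \<ge> 0 \<Longrightarrow> energy 0 T (g x f k) \<le> K * D x f T"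
      by auto
    show ?case
    proof (intro exI[of _ "K / \<gamma>^2 + 1 / \<gamma>"] conjI allI impI; (elim conjE)?)
      show "K / \<gamma>^2 + 1 / \<gamma> \<ge> 0" using K gam by simp
      fix x f and T :: real assume s: "sol x f" and T: "T \<ge> 0"
      have "energy 0 T (g x f (Suc k))
          \<le> energy 0 T (g x f k) / \<gamma>^2 + (norm (g x f (Suc k) 0))^2 / \<gamma>"
        by (rule filter_gain[OF dg[OF s] gc[OF s] l gam T]) (use Suc in auto)
      also have "\<dots> \<le> K * D x f T / \<gamma>^2 + D x f T / \<gamma>"
      proof (intro add_mono divide_right_mono K s T)
        \<comment> \<open>All filters start at zero, so among the filtered residuals only the one
          with index 1 has a nonzero initial value, namely x 0.\<close>
        have "g x f (Suc k) 0 = lowpass l \<gamma> x k 0" by (simp add: g_def causal_filter_0)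
        also have "\<dots> = (if k = 0 then x 0 else 0)" by (cases k) (simp_all add: causal_filter_0)
        finally show "(norm (g x f (Suc k) 0))^2 \<le> D x f T"
          using D0[OF s, of T] order_trans[OF zero_le_power2 D0[OF s, of T]] by simp
      qed (use gam in auto)
      finally show "energy 0 T (g x f (Suc k)) \<le> (K / \<gamma>^2 + 1 / \<gamma>) * D x f T"
        by (simp add: algebra_simps)
    qed
  qed
  have FF: "\<exists>K\<ge>0. \<forall>x f T. sol x f \<and> T \<ge> 0 \<longrightarrow> energy 0 T (F x k) \<le> K * D x f T"
    if "k \<le> n" for k
    using that
  proof (induction k)
    case 0
    then show ?case by (intro exI[of _ 0]) (simp add: F_def M_def)
  next
    case (Suc k)
    then obtain K where K: "K \<ge> 0"
      "\<And>x f T. sol x f \<Longrightarrow> T \<ge> 0 \<Longrightarrow> energy 0 T (F x k) \<le> K * D x f T"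
      by auto
    obtain K' where K': "K' \<ge> 0"
      "\<And>x f T. sol x f \<Longrightarrow> T \<ge> 0 \<Longrightarrow> energy 0 T (g x f (Suc k)) \<le> K' * D x f T"
      using G[OF Suc.prems] by auto
    obtain b where b: "b > 0" "\<And>y. norm (M k y) \<le> norm y * b"
      using bounded_linear.pos_bounded[OF blM] by metis
    show ?case
    proof (intro exI[of _ "2 * b^2 * K' + 2 * K"] conjI allI impI; (elim conjE)?)
      show "2 * b^2 * K' + 2 * K \<ge> 0" using K(1) K'(1) by simp
      fix x f and T :: real assume s: "sol x f" and T: "T \<ge> 0"
      let ?m = "l k - of_real \<gamma>" and ?Z = "lowpass l \<gamma> x" and ?X = "cascade l \<gamma> x"
      \<comment> \<open>By linearity this is \<gamma> times the filter applied to
        \<open>F x k\<close>, so \<open>F x k t - w t\<close> is a notch output of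
        \<open>F x k\<close> and costs no energy.\<close>
      define w where "w t = \<gamma> *\<^sub>R causal_filter ?m (?X k) t - \<gamma> *\<^sub>R M k (?Z (Suc k) t)" for t
      have Mlin: "linear (M k)" using blM by (rule bounded_linear.linear)
      have Ms: "M k (c *s y) = c *s M k y" for c y
        unfolding M_def by (rule vec.linear_scale[OF linear_shifts])
      \<comment> \<open>Solving the definition of g for (A - l k) applied to the next lowpass
        iterate expresses the term with \<open>M (Suc k)\<close> through \<open>M k\<close>.\<close>
      have FS: "F x (Suc k) t = M k (g x f (Suc k) t) + (F x k t - w t)" for t
      proof -
        have "g x f (Suc k) t = l k *s ?Z (Suc k) t - \<gamma> *\<^sub>R ?Z (Suc k) t + ?Z k t - A *v ?Z (Suc k) t"
          by (simp add: g_def vector_sub_rdistrib vec_eq_iff scaleR_conv_of_real[where 'a=complex])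
        then have "M k (g x f (Suc k) t) = M k (l k *s ?Z (Suc k) t) - \<gamma> *\<^sub>R M k (?Z (Suc k) t)
            + M k (?Z k t) - M k (A *v ?Z (Suc k) t)"
          by (simp only: linear_diff[OF Mlin] linear_add[OF Mlin] linear_scale[OF Mlin])
        then show ?thesis
          by (simp only: F_def w_def MS linear_diff[OF Mlin] cascade.simps) simp
      qed
      have dw: "(w has_vector_derivative (l k *s w t + \<gamma> *\<^sub>R (F x k t - w t))) (at t within {0..})"
        if t: "t \<ge> 0" for t
      proof -
        have "(w has_vector_derivative (\<gamma> *\<^sub>R (?m *s causal_filter ?m (?X k) t + ?X k t)
            - \<gamma> *\<^sub>R M k (?m *s ?Z (Suc k) t + ?Z k t))) (at t within {0..})"
          unfolding w_def
          by (intro has_vector_derivative_diff dZS[OF s t]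
            bounded_linear.has_vector_derivative[OF bounded_linear_scaleR_right]
            bounded_linear.has_vector_derivative[OF blM]
            causal_filter_derivative[OF cascade_continuous[OF xc[OF s]] t])
        moreover have "\<gamma> *\<^sub>R (?m *s causal_filter ?m (?X k) t + ?X k t)
            - \<gamma> *\<^sub>R M k (?m *s ?Z (Suc k) t + ?Z k t) = l k *s w t + \<gamma> *\<^sub>R (F x k t - w t)"
          unfolding linear_add[OF Mlin] Ms w_def F_def
          by (simp add: vec_eq_iff scaleR_conv_of_real[where 'a=complex] algebra_simps)
        ultimately show ?thesis by simp
      qed
      have w0: "w 0 = 0" by (simp add: w_def causal_filter_0 linear_0[OF Mlin])
      have wc: "continuous_on {0..} w" using dw by (rule continuous_on_from_vector_derivative)
      have "energy 0 T w + energy 0 T (\<lambda>t. F x k t - w t)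
          \<le> energy 0 T (F x k)"
        by (rule filter_contraction[OF dw Fc[OF s] w0 l gam T]) (use Suc in auto)
      moreover have "energy 0 T w \<ge> 0"
        by (rule integral_nonneg_Icc) (auto intro!: continuous_intros wc)
      ultimately have Fw: "energy 0 T (\<lambda>t. F x k t - w t) \<le> K * D x f T"
        using K(2)[OF s T] by linarith
      have "energy 0 T (F x (Suc k))
          \<le> integral {0..T} (\<lambda>t. 2 * b^2 * (norm (g x f (Suc k) t))^2 + 2 * (norm (F x k t - w t))^2)"
      proof (rule integral_le_Icc)
        show "continuous_on {0..} (\<lambda>t. (norm (F x (Suc k) t))^2)"
          by (intro continuous_intros Fc[OF s])
        show "continuous_on {0..} (\<lambda>t. 2 * b^2 * (norm (g x f (Suc k) t))^2 + 2 * (norm (F x k t - w t))^2)"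
          by (intro continuous_intros Fc[OF s] gc[OF s] wc)
        fix t
        have "(norm (M k (g x f (Suc k) t)))^2 \<le> (norm (g x f (Suc k) t) * b)^2"
          by (rule power_mono[OF b(2)]) simp
        then show "(norm (F x (Suc k) t))^2 \<le> 2 * b^2 * (norm (g x f (Suc k) t))^2 + 2 * (norm (F x k t - w t))^2"
          unfolding FS using norm_add_power2_le[of "M k (g x f (Suc k) t)" "F x k t - w t"]
          by (simp add: power_mult_distrib mult.commute)
      qed simp
      also have "\<dots> = 2 * b^2 * energy 0 T (g x f (Suc k))
          + 2 * energy 0 T (\<lambda>t. F x k t - w t)"
        by (subst integral_add, (intro integrable_Icc continuous_intros Fc[OF s] gc[OF s] wc order_refl)+) simp
      also have "\<dots> \<le> 2 * b^2 * (K' * D x f T) + 2 * (K * D x f T)"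
        by (intro add_mono mult_left_mono K'(2)[OF s T] Fw) auto
      finally show "energy 0 T (F x (Suc k)) \<le> (2 * b^2 * K' + 2 * K) * D x f T"
        by (simp add: algebra_simps)
    qed
  qed
  have "F x n = cascade l \<gamma> x n" for x by (simp add: F_def M_def ann fun_eq_iff)
  with FF[of n] show ?thesis by (simp add: cascade_estimate_def sol_def D_def)
qed

text \<open>While |v|^2 \<le> S, the excess |w|^2 - S weighted by exp (\<gamma> t) is nonincreasing,
  and it starts at -S \<le> 0.\<close>

lemma filter_sup:
  fixes w v :: "real \<Rightarrow> complex^'n"
  assumes der: "\<And>t. t \<ge> 0 \<Longrightarrow> (w has_vector_derivative (l *s w t + \<gamma> *\<^sub>R (v t - w t))) (at t within {0..})"
    and w0: "w 0 = 0" and l: "Re l \<le> 0" and g: "\<gamma> > 0"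
    and S: "\<And>t. 0 \<le> t \<Longrightarrow> t \<le> T \<Longrightarrow> (norm (v t))^2 \<le> S" and t: "0 \<le> t" "t \<le> T"
  shows "(norm (w t))^2 \<le> S"
proof -
  have S0: "S \<ge> 0" using S[OF t] zero_le_power2 order_trans by blast
  let ?F = "\<lambda>t. ((norm (w t))^2 - S) * exp (\<gamma> * t)"
  let ?F' = "\<lambda>t. exp (\<gamma> * t) * (2 * (w t \<bullet> (l *s w t + \<gamma> *\<^sub>R (v t - w t))) + \<gamma> * ((norm (w t))^2 - S))"
  have "?F t - ?F 0 \<le> integral {0..t} (\<lambda>t. 0)"
  proof (rule growth_le_integral[where F = ?F and F' = ?F'])
    fix s assume s: "0 \<le> s" "s \<le> t"
    show "(?F has_real_derivative ?F' s) (at s within {0..})"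
      by (rule derivative_eq_intros has_real_derivative_norm_power2[OF der[OF s(1)]] refl)+
         (simp add: algebra_simps)
    have "w s \<bullet> (l *s w s) \<le> 0"
      using inner_smult_self[of l "w s"] l by (simp add: inner_commute mult_nonpos_nonneg)
    moreover have "2 * (w s \<bullet> v s) \<le> (norm (w s))^2 + S"
      using two_inner_le[of 1 "w s" "v s"] S[of s] s t by simp
    then have "\<gamma> * (2 * (w s \<bullet> v s)) \<le> \<gamma> * ((norm (w s))^2 + S)" using g by (intro mult_left_mono) auto
    ultimately have "2 * (w s \<bullet> (l *s w s + \<gamma> *\<^sub>R (v s - w s))) + \<gamma> * ((norm (w s))^2 - S) \<le> 0"
      by (simp add: inner_add_right inner_diff_right dot_square_norm algebra_simps)
    then show "?F' s \<le> 0" by (simp add: mult_nonneg_nonpos)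
  qed (use t in auto)
  then have "((norm (w t))^2 - S) * exp (\<gamma> * t) \<le> 0" using w0 S0 by simp
  then show ?thesis by (simp add: mult_le_0_iff)
qed

text \<open>Cauchy-Schwarz against the constant function, obtained by integrating the square of
  \<tau> h - I, where I is the integral of h.\<close>

lemma integral_power2_le:
  fixes h :: "real \<Rightarrow> real"
  assumes h: "continuous_on {0..} h" and ab: "0 \<le> a" "a \<le> b"
  shows "(integral {a..b} h)^2 \<le> (b - a) * integral {a..b} (\<lambda>t. (h t)^2)"
proof (cases "a = b")
  case False
  define \<tau> where "\<tau> = b - a"
  define I where "I = integral {a..b} h"
  have tau: "\<tau> > 0" using ab False by (simp add: \<tau>_def)
  have "0 \<le> integral {a..b} (\<lambda>t. (\<tau> * h t - I)^2)"
    by (rule integral_nonneg_Icc) (use ab in \<open>auto intro!: continuous_intros h\<close>)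
  also have "(\<lambda>t. (\<tau> * h t - I)^2) = (\<lambda>t. \<tau>^2 * (h t)^2 - 2 * \<tau> * I * h t + I^2)"
    by (simp add: fun_eq_iff power2_eq_square algebra_simps)
  also have "integral {a..b} \<dots> = integral {a..b} (\<lambda>t. \<tau>^2 * (h t)^2) - integral {a..b} (\<lambda>t. 2 * \<tau> * I * h t)
      + integral {a..b} (\<lambda>t. I^2)"
    by (subst integral_add integral_diff, (intro integrable_Icc continuous_intros h ab)+)+ simp
  also have "\<dots> = \<tau>^2 * integral {a..b} (\<lambda>t. (h t)^2) - 2 * \<tau> * I * I + \<tau> * I^2"
    using ab by (simp add: I_def \<tau>_def)
  finally have "\<tau> * I^2 \<le> \<tau> * (\<tau> * integral {a..b} (\<lambda>t. (h t)^2))"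
    by (simp add: power2_eq_square algebra_simps)
  then show ?thesis using tau by (simp add: I_def \<tau>_def)
qed simp

section \<open>Delays under the integral and delayed tones\<close>

lemma integral_shift:
  fixes h :: "real \<Rightarrow> real"
  assumes "continuous_on {a - \<tau>..b - \<tau>} h"
  shows "integral {a..b} (\<lambda>t. h (t - \<tau>)) = integral {a - \<tau>..b - \<tau>} h"
proof -
  have "(h has_integral integral {a - \<tau>..b - \<tau>} h) (cbox (a - \<tau>) (b - \<tau>))"
    using assms by (simp add: integrable_continuous_interval integrable_integral)
  from has_integral_affinity[OF this, of 1 "-\<tau>"]
  have "((\<lambda>t. h (t - \<tau>)) has_integral integral {a - \<tau>..b - \<tau>} h) ((\<lambda>x. x + \<tau>) ` {a - \<tau>..b - \<tau>})" by simp
  then show ?thesis by (intro integral_unique) simp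
qed

text \<open>With a primitive \<Phi> of h the sliding integral is a difference of \<Phi> and its
  shift, so integrating over t leaves \<Phi> on the last window minus \<Phi> on the first. This
  replaces exchanging the order of integration.\<close>

lemma integral_window_le:
  fixes h :: "real \<Rightarrow> real"
  assumes h: "continuous_on {0..} h" and h0: "\<And>t. t \<ge> 0 \<Longrightarrow> h t \<ge> 0" and tau: "0 \<le> \<tau>" "\<tau> \<le> T"
  shows "integral {\<tau>..T} (\<lambda>t. integral {t - \<tau>..t} h) \<le> \<tau> * integral {0..T} h"
    and "continuous_on {\<tau>..} (\<lambda>t. integral {t - \<tau>..t} h)"
proof -
  define \<Phi> where "\<Phi> t = integral {0..t} h" for t
  have \<Phi>': "(\<Phi> has_vector_derivative h t) (at t within {0..})" if "t \<ge> 0" for t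
    unfolding \<Phi>_def by (rule integral_has_vector_derivative_atLeast[OF h that])
  have \<Phi>c: "continuous_on {0..} \<Phi>" using \<Phi>' by (rule continuous_on_from_vector_derivative)
  have eq: "integral {t - \<tau>..t} h = \<Phi> t - \<Phi> (t - \<tau>)" if "t \<ge> \<tau>" for t
  proof -
    have "\<Phi> (t - \<tau>) + integral {t - \<tau>..t} h = \<Phi> t" unfolding \<Phi>_def
      by (rule integral_combine_Icc[OF h]) (use that tau in auto)
    then show ?thesis by simp
  qed
  have sc: "continuous_on {\<tau>..} (\<lambda>t. \<Phi> (t - \<tau>))"
    by (rule continuous_on_compose2[OF \<Phi>c]) (auto intro!: continuous_intros)
  have c2: "continuous_on {\<tau>..} (\<lambda>t. \<Phi> t - \<Phi> (t - \<tau>))"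
    by (intro continuous_intros sc continuous_on_subset[OF \<Phi>c]) (use tau in auto)
  then show "continuous_on {\<tau>..} (\<lambda>t. integral {t - \<tau>..t} h)"
    by (subst continuous_on_cong[OF refl eq]) auto
  have mono: "\<Phi> s \<le> \<Phi> t" if "0 \<le> s" "s \<le> t" for s t
    unfolding \<Phi>_def by (rule integral_subinterval_le[OF h]) (use that h0 in auto)
  have p0: "\<Phi> t \<ge> 0" if "t \<ge> 0" for t unfolding \<Phi>_def by (rule integral_nonneg_Icc[OF h]) (use h0 in auto)
  have \<Phi>i: "\<Phi> integrable_on {a..b}" if "0 \<le> a" for a b by (rule integrable_Icc[OF \<Phi>c that])
  have "integral {\<tau>..T} (\<lambda>t. integral {t - \<tau>..t} h) = integral {\<tau>..T} (\<lambda>t. \<Phi> t - \<Phi> (t - \<tau>))"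
    by (rule integral_cong) (use eq in auto)
  also have "\<dots> = integral {\<tau>..T} \<Phi> - integral {\<tau>..T} (\<lambda>t. \<Phi> (t - \<tau>))"
    by (rule integral_diff[OF \<Phi>i[OF tau(1)]])
       (intro integrable_continuous_interval continuous_on_subset[OF sc], auto)
  also have "integral {\<tau>..T} (\<lambda>t. \<Phi> (t - \<tau>)) = integral {0..T - \<tau>} \<Phi>"
    using integral_shift[of \<tau> \<tau> T \<Phi>] continuous_on_Icc[OF \<Phi>c] by simp
  also have "integral {\<tau>..T} \<Phi> - integral {0..T - \<tau>} \<Phi> = integral {T - \<tau>..T} \<Phi> - integral {0..\<tau>} \<Phi>"
  proof -
    have "integral {0..\<tau>} \<Phi> + integral {\<tau>..T} \<Phi> = integral {0..T} \<Phi>"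
      by (rule integral_combine_Icc[OF \<Phi>c]) (use tau in auto)
    moreover have "integral {0..T-\<tau>} \<Phi> + integral {T-\<tau>..T} \<Phi> = integral {0..T} \<Phi>"
      by (rule integral_combine_Icc[OF \<Phi>c]) (use tau in auto)
    ultimately show ?thesis by simp
  qed
  also have "\<dots> \<le> integral {T - \<tau>..T} (\<lambda>t. \<Phi> T) - 0"
    by (intro diff_mono integral_le_Icc integral_nonneg_Icc \<Phi>c p0) (use tau mono in auto)
  finally show "integral {\<tau>..T} (\<lambda>t. integral {t - \<tau>..t} h) \<le> \<tau> * integral {0..T} h"
    using tau by (simp add: \<Phi>_def)
qed

text \<open>Variation of constants over one delay: exp (- l s) w s has derivative \<gamma> exp (- l
  s) v s, so w (t - \<tau>) differs from the rotated w t by an integral of \<gamma> v, with bounded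
  weight, over [t - \<tau>, t].\<close>

lemma tone_delay:
  fixes w v :: "real \<Rightarrow> complex^'n"
  assumes der: "\<And>t. t \<ge> 0 \<Longrightarrow> (w has_vector_derivative (l *s w t + \<gamma> *\<^sub>R v t)) (at t within {0..})"
    and v: "continuous_on {0..} v" and g: "\<gamma> > 0" and tau: "0 \<le> \<tau>" "\<tau> \<le> t"
    and D: "exp (cmod l * \<tau>) \<le> D"
  shows "(norm (w (t - \<tau>) - exp (- of_real \<tau> * l) *s w t))^2
    \<le> \<gamma>^2 * D^2 * \<tau> * energy (t - \<tau>) t v"
proof -
  have D0: "D > 0" using D exp_gt_zero[of "cmod l * \<tau>"] by linarith
  \<comment> \<open>The normalization makes h (t - \<tau>) = w (t - \<tau>) and leaves only
    exponentials of times at most \<tau>, so D does not grow with t.\<close>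
  define c where "c = exp (of_real (t - \<tau>) * l)"
  define h where "h s = c *s (exp (of_real s * (- l)) *s w s)" for s
  define h' where "h' s = c *s (exp (of_real s * (- l)) *s (\<gamma> *\<^sub>R v s))" for s
  have hd: "(h has_vector_derivative h' s) (at s within {t-\<tau>..t})" if s: "s \<in> {t-\<tau>..t}" for s
  proof -
    have s0: "s \<ge> 0" using s tau by auto
    have "(h has_vector_derivative c *s (exp (of_real s * (- l)) *s (l *s w s + \<gamma> *\<^sub>R v s)
        + (- l * exp (of_real s * (- l))) *s w s)) (at s within {0..})"
      unfolding h_def
      by (intro has_vector_derivative_smult_right
        bounded_bilinear.has_vector_derivative[OF bounded_bilinear_smult has_vector_derivative_exp_of_real der[OF s0]])
    moreover have "c *s (exp (of_real s * (- l)) *s (l *s w s + \<gamma> *\<^sub>R v s)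
        + (- l * exp (of_real s * (- l))) *s w s) = h' s"
      by (simp add: h'_def vec_eq_iff algebra_simps)
    ultimately have "(h has_vector_derivative h' s) (at s within {0..})" by (simp only:)
    then show ?thesis by (rule has_vector_derivative_within_subset) (use tau in auto)
  qed
  have "(h' has_integral (h t - h (t - \<tau>))) {t-\<tau>..t}"
    by (rule fundamental_theorem_of_calculus) (use tau hd in auto)
  then have I: "h' integrable_on {t-\<tau>..t}" "integral {t-\<tau>..t} h' = h t - h (t - \<tau>)"
    by (auto simp: integral_unique has_integral_integrable)
  have nv: "continuous_on {0..} (\<lambda>s. norm (v s))" by (intro continuous_intros v)
  have "norm (integral {t-\<tau>..t} h') \<le> integral {t-\<tau>..t} (\<lambda>s. (\<gamma> * D) * norm (v s))"
  proof (rule integral_norm_bound_integral[OF I(1)])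
    show "(\<lambda>s. (\<gamma> * D) * norm (v s)) integrable_on {t-\<tau>..t}"
      by (rule integrable_Icc) (use tau in \<open>auto intro!: continuous_intros v\<close>)
    fix s assume s: "s \<in> {t-\<tau>..t}"
    have "cmod c * cmod (exp (of_real s * (- l))) = exp (Re ((of_real (t - \<tau> - s)) * l))"
      by (simp add: c_def norm_exp_eq_Re algebra_simps flip: exp_add)
    also have "\<dots> \<le> exp (cmod l * \<tau>)"
    proof -
      have "Re ((of_real (t - \<tau> - s)) * l) \<le> cmod ((of_real (t - \<tau> - s)) * l)" by (rule complex_Re_le_cmod)
      also have "\<dots> = \<bar>t - \<tau> - s\<bar> * cmod l" by (simp add: norm_mult flip: of_real_diff)
      also have "\<dots> \<le> \<tau> * cmod l" using s by (intro mult_right_mono) auto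
      finally show ?thesis by (simp add: mult.commute)
    qed
    also note D
    finally have "(cmod c * cmod (exp (of_real s * (- l)))) * (\<gamma> * norm (v s)) \<le> D * (\<gamma> * norm (v s))"
      using g by (intro mult_right_mono) auto
    moreover have "norm (h' s) = (cmod c * cmod (exp (of_real s * (- l)))) * (\<gamma> * norm (v s))"
      using g unfolding h'_def norm_smult norm_scaleR by simp
    ultimately show "norm (h' s) \<le> (\<gamma> * D) * norm (v s)" by (simp only: mult_ac)
  qed
  also have "\<dots> = (\<gamma> * D) * integral {t-\<tau>..t} (\<lambda>s. norm (v s))" by simp
  finally have "(norm (integral {t-\<tau>..t} h'))^2 \<le> ((\<gamma> * D) * integral {t-\<tau>..t} (\<lambda>s. norm (v s)))^2"
    by (rule power_mono) simp
  also have "\<dots> = \<gamma>^2 * D^2 * (integral {t-\<tau>..t} (\<lambda>s. norm (v s)))^2" by (simp add: power_mult_distrib)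
  also have "\<dots> \<le> \<gamma>^2 * D^2 * ((t - (t - \<tau>)) * energy (t-\<tau>) t v)"
    by (intro mult_left_mono integral_power2_le[OF nv]) (use tau in auto)
  finally have "(norm (h t - h (t - \<tau>)))^2 \<le> \<gamma>^2 * D^2 * \<tau> * energy (t-\<tau>) t v"
    by (simp add: I algebra_simps)
  moreover have "h (t - \<tau>) = w (t - \<tau>)"
  proof -
    have "c * exp (of_real (t - \<tau>) * (- l)) = 1" by (simp add: c_def flip: exp_add)
    then show ?thesis by (simp add: h_def vector_smult_assoc)
  qed
  moreover have "h t = exp (- of_real \<tau> * l) *s w t"
  proof -
    have "c * exp (of_real t * (- l)) = exp (- of_real \<tau> * l)" by (simp add: c_def algebra_simps flip: exp_add)
    then show ?thesis by (simp add: h_def vector_smult_assoc)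
  qed
  ultimately show ?thesis by (simp add: norm_minus_commute)
qed

subsection \<open>Tone decomposition\<close>

text \<open>The cascade seen at the output: v 0 is the signal, w k its k-th tone and v (Suc k) what
  is left over. Keeping only these relations, and no state space, makes the constants below
  independent of P.\<close>

definition tone_system where
  "tone_system l n \<gamma> w v \<longleftrightarrow> 0 < \<gamma> \<and> continuous_on {0..} (v 0) \<and>
    (\<forall>k<n. Re (l k) \<le> 0 \<and> w k 0 = 0 \<and> v (Suc k) = (\<lambda>t. v k t - w k t) \<and>
      (\<forall>t\<ge>0. (w k has_vector_derivative (l k *s w k t + \<gamma> *\<^sub>R v (Suc k) t)) (at t within {0..})))"
  for w v :: "nat \<Rightarrow> real \<Rightarrow> complex^'m"

lemma tone_system_derivative:
  assumes "tone_system l n \<gamma> w v" "k < n" "t \<ge> 0"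
  shows "(w k has_vector_derivative (l k *s w k t + \<gamma> *\<^sub>R (v k t - w k t))) (at t within {0..})"
proof -
  have "v (Suc k) t = v k t - w k t" using assms by (simp add: tone_system_def)
  moreover have "(w k has_vector_derivative (l k *s w k t + \<gamma> *\<^sub>R v (Suc k) t)) (at t within {0..})"
    using assms unfolding tone_system_def by blast
  ultimately show ?thesis by (simp only:)
qed

lemma tone_system_basic:
  assumes ts: "tone_system l n \<gamma> w v"
  shows "k < n \<Longrightarrow> continuous_on {0..} (w k)" "k \<le> n \<Longrightarrow> continuous_on {0..} (v k)"
    "v 0 t = (\<Sum>k<n. w k t) + v n t"
proof -
  show w: "continuous_on {0..} (w k)" if "k < n" for k
    using ts that unfolding tone_system_def by (intro continuous_on_from_vector_derivative) blast
  show "k \<le> n \<Longrightarrow> continuous_on {0..} (v k)"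
  proof (induction k)
    case (Suc k)
    then show ?case using ts w[of k] by (simp add: tone_system_def continuous_on_diff)
  qed (use ts in \<open>simp add: tone_system_def\<close>)
  have "k \<le> n \<Longrightarrow> v 0 t = (\<Sum>k<k. w k t) + v k t" for k
  proof (induction k)
    case (Suc k)
    then have "v (Suc k) t = v k t - w k t" using ts by (simp add: tone_system_def)
    with Suc show ?case by simp
  qed simp
  then show "v 0 t = (\<Sum>k<n. w k t) + v n t" by blast
qed

text \<open>Telescoping of the energy split of one filter over the cascade.\<close>

lemma tone_system_energy:
  assumes ts: "tone_system l n \<gamma> w v" and T: "T \<ge> 0"
  shows "k \<le> n \<Longrightarrow> energy 0 T (v k) \<le> energy 0 T (v 0)"
    and "k < n \<Longrightarrow> energy 0 T (w k) \<le> energy 0 T (v 0)"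
proof -
  have step: "energy 0 T (w k) + energy 0 T (v (Suc k))
      \<le> energy 0 T (v k)" if k: "k < n" for k
  proof -
    have vS: "v (Suc k) = (\<lambda>t. v k t - w k t)" using ts k by (simp add: tone_system_def)
    show ?thesis unfolding vS
      by (rule filter_contraction[OF tone_system_derivative[OF ts k]])
         (use ts k T tone_system_basic(2)[OF ts, of k] in \<open>simp_all add: tone_system_def\<close>)
  qed
  have nn: "energy 0 T (v k) \<ge> 0" if "k \<le> n" for k
    by (rule integral_nonneg_Icc) (use tone_system_basic(2)[OF ts that] in \<open>auto intro!: continuous_intros\<close>)
  have nw: "energy 0 T (w k) \<ge> 0" if "k < n" for k
    by (rule integral_nonneg_Icc) (use tone_system_basic(1)[OF ts that] in \<open>auto intro!: continuous_intros\<close>)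
  show v: "energy 0 T (v k) \<le> energy 0 T (v 0)" if "k \<le> n" for k
    using that
  proof (induction k)
    case (Suc k)
    then show ?case using step[of k] nw[of k] by simp
  qed simp
  show "k < n \<Longrightarrow> energy 0 T (w k) \<le> energy 0 T (v 0)"
    using step[of k] nn[of "Suc k"] v[of k] by simp
qed

text \<open>A notch contracts energies but not suprema; |v - w|^2 \<le> 2 |v|^2 + 2 |w|^2 costs a
  factor 4 per stage.\<close>

lemma tone_system_sup:
  assumes ts: "tone_system l n \<gamma> w v"
    and S: "\<And>t. 0 \<le> t \<Longrightarrow> t \<le> T \<Longrightarrow> (norm (v 0 t))^2 \<le> S" and t: "0 \<le> t" "t \<le> T"
  shows "k < n \<Longrightarrow> (norm (w k t))^2 \<le> 4 ^ n * S"
proof -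
  have S0: "S \<ge> 0" using S[OF t] zero_le_power2 order_trans by blast
  have w: "(norm (w k t))^2 \<le> S'" if k: "k < n" and S': "\<And>t. 0 \<le> t \<Longrightarrow> t \<le> T \<Longrightarrow> (norm (v k t))^2 \<le> S'"
    and t: "0 \<le> t" "t \<le> T" for k t S'
    by (rule filter_sup[OF tone_system_derivative[OF ts k] _ _ _ S' t])
       (use ts k in \<open>simp_all add: tone_system_def\<close>)
  have v: "k \<le> n \<Longrightarrow> 0 \<le> t \<Longrightarrow> t \<le> T \<Longrightarrow> (norm (v k t))^2 \<le> 4 ^ k * S" for k t
  proof (induction k arbitrary: t)
    case (Suc k)
    have "v (Suc k) t = v k t + (- w k t)" using ts Suc by (simp add: tone_system_def)
    then have "(norm (v (Suc k) t))^2 \<le> 2 * (norm (v k t))^2 + 2 * (norm (w k t))^2"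
      using norm_add_power2_le[of "v k t" "- w k t"] by simp
    also have "\<dots> \<le> 2 * (4 ^ k * S) + 2 * (4 ^ k * S)"
      using Suc w[of k "4 ^ k * S" t] by (intro add_mono mult_left_mono) auto
    finally show ?case by (simp add: mult_ac)
  qed (use S in simp)
  assume k: "k < n"
  have "(norm (w k t))^2 \<le> 4 ^ k * S" using w[OF k _ t] v[of k] k by simp
  also have "\<dots> \<le> 4 ^ n * S" using S0 k by (intro mult_right_mono power_increasing) auto
  finally show ?thesis .
qed

text \<open>Up to terms of size \<gamma>, the derivative of w_k . (a w_j) multiplies the coefficient
  a by l j + cnj (l k). Dividing d by this number turns the wanted integrand into such a derivative
  and leaves boundary values bounded by S. The case k = j with Re (l k) < 0 is included.\<close>

lemma tone_cross:
  assumes ts: "tone_system l n \<gamma> w v" and kj: "k < n" "j < n" and nr: "l j + cnj (l k) \<noteq> 0"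
    and S: "\<And>t. 0 \<le> t \<Longrightarrow> t \<le> T \<Longrightarrow> (norm (v 0 t))^2 \<le> S" and tau: "0 \<le> \<tau>" "\<tau> \<le> T"
    and a: "cmod d \<le> b * cmod (l j + cnj (l k))"
  shows "integral {\<tau>..T} (\<lambda>t. w k t \<bullet> (d *s w j t))
    \<ge> - b * (2 * 4 ^ n * S + 2 * \<gamma> * energy 0 T (v 0))"
proof -
  define J where "J = energy 0 T (v 0)"
  define a where "a = d / (l j + cnj (l k))"
  have ab: "cmod a \<le> b" using a nr by (simp add: a_def norm_divide divide_le_eq)
  have b0: "b \<ge> 0" using ab norm_ge_zero[of a] by linarith
  have g: "\<gamma> > 0" using ts by (simp add: tone_system_def)
  have dw: "(w k has_vector_derivative (l k *s w k t + \<gamma> *\<^sub>R v (Suc k) t)) (at t within {0..})"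
    if "k < n" "t \<ge> 0" for k t using ts that unfolding tone_system_def by blast
  note wc = tone_system_basic(1)[OF ts] and vc = tone_system_basic(2)[OF ts]
  let ?F = "\<lambda>t. w k t \<bullet> (a *s w j t)"
  let ?F' = "\<lambda>t. w k t \<bullet> (a *s (l j *s w j t + \<gamma> *\<^sub>R v (Suc j) t)) + (l k *s w k t + \<gamma> *\<^sub>R v (Suc k) t) \<bullet> (a *s w j t)"
  define q where "q t = (norm (w k t))^2 + (norm (v (Suc j) t))^2 + (norm (w j t))^2 + (norm (v (Suc k) t))^2" for t
  have qc: "continuous_on {0..} q" unfolding q_def
    by (intro continuous_intros wc vc) (use kj in auto)
  have q0: "q t \<ge> 0" for t by (simp add: q_def)
  have dwc: "continuous_on {0..} (\<lambda>t. w k t \<bullet> (d *s w j t))"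
    by (intro continuous_intros continuous_on_smult wc kj)
  have ip: "\<bar>x \<bullet> (a *s y)\<bar> \<le> b / 2 * ((norm x)^2 + (norm y)^2)" for x y :: "complex^'b"
  proof -
    have "\<bar>x \<bullet> (a *s y)\<bar> \<le> norm x * (cmod a * norm y)"
      using Cauchy_Schwarz_ineq2[of x "a *s y"] by (simp add: norm_smult)
    also have "\<dots> \<le> norm x * (b * norm y)" using ab by (intro mult_left_mono mult_right_mono) auto
    also have "\<dots> = b / 2 * (2 * norm x * norm y)" by simp
    also have "\<dots> \<le> b / 2 * ((norm x)^2 + (norm y)^2)" using b0 sum_squares_bound[of "norm x" "norm y"]
      by (intro mult_left_mono) auto
    finally show ?thesis .
  qed
  have "?F T - ?F \<tau> \<le> integral {\<tau>..T} (\<lambda>t. w k t \<bullet> (d *s w j t) + \<gamma> * (b / 2) * q t)"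
  proof (rule growth_le_integral[where F = ?F and F' = ?F', OF tau])
    fix t assume t: "\<tau> \<le> t" "t \<le> T"
    then have t0: "t \<ge> 0" using tau by simp
    show "(?F has_real_derivative ?F' t) (at t within {0..})"
      by (intro has_real_derivative_inner dw kj t0
          has_vector_derivative_smult_right)
    have "?F' t = w k t \<bullet> (a *s (l j *s w j t)) + w k t \<bullet> (cnj (l k) *s (a *s w j t))
      + \<gamma> * (w k t \<bullet> (a *s v (Suc j) t)) + \<gamma> * (v (Suc k) t \<bullet> (a *s w j t))"
    proof -
      have "a *s (\<gamma> *\<^sub>R v (Suc j) t) = \<gamma> *\<^sub>R (a *s v (Suc j) t)" by (simp add: vec_eq_iff)
      then show ?thesis
        by (simp add: vector_add_ldistrib inner_add_left inner_add_right inner_smult_adjoint)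
    qed
    also have "w k t \<bullet> (a *s (l j *s w j t)) + w k t \<bullet> (cnj (l k) *s (a *s w j t)) = w k t \<bullet> (d *s w j t)"
    proof -
      have "a *s (l j *s w j t) + cnj (l k) *s (a *s w j t) = (a * (l j + cnj (l k))) *s w j t"
        by (simp add: vec_eq_iff algebra_simps)
      also have "\<dots> = d *s w j t" using nr by (simp add: a_def)
      finally show ?thesis by (simp flip: inner_add_right)
    qed
    also have "w k t \<bullet> (d *s w j t) + \<gamma> * (w k t \<bullet> (a *s v (Suc j) t)) + \<gamma> * (v (Suc k) t \<bullet> (a *s w j t))
       \<le> w k t \<bullet> (d *s w j t) + \<gamma> * (b / 2 * ((norm (w k t))^2 + (norm (v (Suc j) t))^2))
         + \<gamma> * (b / 2 * ((norm (v (Suc k) t))^2 + (norm (w j t))^2))"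
      using g by (intro add_mono mult_left_mono order_refl order_trans[OF abs_ge_self ip]) auto
    finally show "?F' t \<le> w k t \<bullet> (d *s w j t) + \<gamma> * (b / 2) * q t"
      by (simp add: q_def algebra_simps)
  qed (intro continuous_intros dwc qc)
  also have "\<dots> = integral {\<tau>..T} (\<lambda>t. w k t \<bullet> (d *s w j t)) + \<gamma> * (b / 2) * integral {\<tau>..T} q"
    by (subst integral_add, (intro integrable_Icc continuous_intros dwc qc tau)+) simp
  finally have 1: "?F T - ?F \<tau> \<le> integral {\<tau>..T} (\<lambda>t. w k t \<bullet> (d *s w j t)) + \<gamma> * (b / 2) * integral {\<tau>..T} q" .
  have "integral {\<tau>..T} q \<le> integral {0..T} q"
    by (rule integral_subinterval_le[OF qc]) (use tau q0 in auto)
  also have "\<dots> = energy 0 T (w k) + energy 0 T (v (Suc j))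
     + energy 0 T (w j) + energy 0 T (v (Suc k))"
    unfolding q_def
    by (subst integral_add, (intro integrable_Icc continuous_intros wc vc order_refl; use kj in simp)+)+ simp
  also have "\<dots> \<le> J + J + J + J" unfolding J_def
    by (intro add_mono tone_system_energy[OF ts]) (use kj tau in auto)
  finally have "\<gamma> * (b / 2) * integral {\<tau>..T} q \<le> \<gamma> * (b / 2) * (4 * J)"
    using g b0 by (intro mult_left_mono) auto
  moreover have "\<bar>?F t\<bar> \<le> b * (4 ^ n * S)" if t: "0 \<le> t" "t \<le> T" for t
  proof -
    have "\<bar>?F t\<bar> \<le> b / 2 * ((norm (w k t))^2 + (norm (w j t))^2)" by (rule ip)
    also have "\<dots> \<le> b / 2 * (4 ^ n * S + 4 ^ n * S)"
      using b0 tone_system_sup[OF ts S t] kj by (intro mult_left_mono add_mono) auto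
    finally show ?thesis by (simp add: mult_ac)
  qed
  from this[of T] this[of \<tau>] have "?F T - ?F \<tau> \<ge> - 2 * (b * (4 ^ n * S))" using tau by linarith
  ultimately have "integral {\<tau>..T} (\<lambda>t. w k t \<bullet> (d *s w j t)) \<ge> - 2 * (b * (4 ^ n * S)) - \<gamma> * (b / 2) * (4 * J)"
    using 1 by linarith
  then show ?thesis by (simp add: J_def algebra_simps)
qed

text \<open>Tones with the same frequency do not average out against each other. But they carry the
  same coefficient d, so their sum W \<mu> can be formed first and the double sum collapses to terms
  Re (d \<mu>) |W \<mu>|^2.\<close>

lemma tone_resonant_nonneg:
  fixes w :: "nat \<Rightarrow> complex^'m" and l :: "nat \<Rightarrow> complex"
  assumes fin: "finite I" and d: "\<And>k. k \<in> I \<Longrightarrow> Re (d (l k)) \<ge> 0"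
  shows "(\<Sum>k\<in>I. \<Sum>j\<in>{j\<in>I. l j = l k}. w k \<bullet> (d (l j) *s w j)) \<ge> 0"
proof -
  define W where "W \<mu> = (\<Sum>j\<in>{j\<in>I. l j = \<mu>}. w j)" for \<mu> :: complex
  have "(\<Sum>k\<in>I. \<Sum>j\<in>{j\<in>I. l j = l k}. w k \<bullet> (d (l j) *s w j)) = (\<Sum>k\<in>I. w k \<bullet> (d (l k) *s W (l k)))"
    by (simp add: W_def vec.scale_sum_right inner_sum_right)
  also have "\<dots> = (\<Sum>\<mu>\<in>l ` I. \<Sum>k\<in>{k\<in>I. l k = \<mu>}. w k \<bullet> (d (l k) *s W (l k)))"
    by (rule sum.image_gen[OF fin])
  also have "\<dots> = (\<Sum>\<mu>\<in>l ` I. W \<mu> \<bullet> (d \<mu> *s W \<mu>))"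
  proof (rule sum.cong[OF refl])
    fix \<mu>
    have "(\<Sum>k\<in>{k\<in>I. l k = \<mu>}. w k \<bullet> (d (l k) *s W (l k))) = (\<Sum>k\<in>{k\<in>I. l k = \<mu>}. w k \<bullet> (d \<mu> *s W \<mu>))"
      by (rule sum.cong) auto
    then show "(\<Sum>k\<in>{k\<in>I. l k = \<mu>}. w k \<bullet> (d (l k) *s W (l k))) = W \<mu> \<bullet> (d \<mu> *s W \<mu>)"
      by (simp add: W_def inner_sum_left)
  qed
  also have "\<dots> = (\<Sum>\<mu>\<in>l ` I. Re (d \<mu>) * (norm (W \<mu>))^2)"
    by (simp only: inner_commute[of "W _"] inner_smult_self)
  also have "\<dots> \<ge> 0" using d by (auto intro!: sum_nonneg)
  finally show ?thesis .
qed

text \<open>K is chosen before \<gamma>, \<tau>, the horizon and the signals. The remainder enters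
  with 1 / \<gamma>, which is affordable because its energy is made small after \<gamma> has been
  fixed. The first argument only carries the dimension of the output.\<close>

definition tone_estimate ::
  "'m::finite itself \<Rightarrow> (nat \<Rightarrow> complex) \<Rightarrow> nat \<Rightarrow> real \<Rightarrow> real \<Rightarrow> real \<Rightarrow> bool" where
  "tone_estimate _ l n taubar c K \<longleftrightarrow>
    (\<forall>\<gamma> (w :: nat \<Rightarrow> real \<Rightarrow> complex^'m) v \<tau> T S. tone_system l n \<gamma> w v \<and> \<gamma> \<le> 1 \<and>
      0 \<le> \<tau> \<and> \<tau> \<le> taubar \<and> \<tau> \<le> T \<and> (\<forall>t\<in>{0..T}. (norm (v 0 t))^2 \<le> S) \<longrightarrow>
      c * energy \<tau> T (v 0)
       - K * (\<gamma> * energy 0 T (v 0) + energy 0 T (v n) / \<gamma> + S)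
      \<le> integral {\<tau>..T} (\<lambda>t. v 0 t \<bullet> v 0 (t - \<tau>)))"

text \<open>In v t . (v (t - \<tau>) - c v t) each delayed tone is replaced by exp (- \<tau> l)
  times the tone, which leaves a double sum with the coefficients d = exp (- \<tau> l) - c. Resonant
  pairs contribute a nonnegative amount because Re d = cos (Im l \<tau>) - c \<ge> 0 on the
  imaginary axis; every other pair has small time average.\<close>

lemma tone_lower_bound:
  fixes l :: "nat \<Rightarrow> complex" and taubar c :: real
  assumes l: "\<And>k. k < n \<Longrightarrow> Re (l k) \<le> 0" and taubar: "taubar \<ge> 0" and c: "0 \<le> c" "c \<le> 1"
    and cs: "\<And>k \<tau>. k < n \<Longrightarrow> Re (l k) = 0 \<Longrightarrow> 0 \<le> \<tau> \<Longrightarrow> \<tau> \<le> taubar \<Longrightarrow> c \<le> cos (Im (l k) * \<tau>)"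
  shows "\<exists>K\<ge>0. tone_estimate TYPE('m::finite) l n taubar c K"
proof -
  \<comment> \<open>One constant for the exponentials and, thanks to the added 1, for the
    coefficients d as well, since c \<le> 1.\<close>
  define D where "D = 1 + (\<Sum>k<n. exp (cmod (l k) * taubar))"
  have D1: "D \<ge> 1" unfolding D_def by (simp add: sum_nonneg)
  have Dk: "1 + exp (cmod (l k) * taubar) \<le> D" if "k < n" for k
    unfolding D_def using that by (intro add_left_mono member_le_sum) auto
  \<comment> \<open>The divisor vanishes exactly for resonant pairs; division by zero gives 0 there,
    so these entries do no harm in the sum Kb.\<close>
  define b where "b = (\<lambda>(k, j). D / cmod (l j + cnj (l k)))"
  have b0: "b p \<ge> 0" for p using D1 by (auto simp: b_def split: prod.split)
  define U where "U = {..<n} \<times> {..<n}"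
  have finU: "finite U" by (simp add: U_def)
  define Kb where "Kb = (\<Sum>p\<in>U. b p)"
  have Kb0: "Kb \<ge> 0" unfolding Kb_def by (intro sum_nonneg b0)
  \<comment> \<open>In order, with J and E the energies of v 0 and v n on [0, T]: the coefficients
    of S and of \<gamma> J from the nonresonant pairs, of E / \<gamma>, and of \<gamma> J from the
    pointwise errors.\<close>
  define K where "K = 2 * 4 ^ n * Kb + 2 * Kb + (real n + 2) + real n * D^2 + (real n + 2) + real n * D^2 * taubar^2"
  have K0: "K \<ge> 0" unfolding K_def using Kb0 D1 taubar by simp
  show ?thesis unfolding tone_estimate_def
  proof (rule exI[of _ K], intro conjI K0 allI impI; (elim conjE)?)
    fix \<gamma> and w v :: "nat \<Rightarrow> real \<Rightarrow> complex^'m" and \<tau> T S :: real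
    assume ts: "tone_system l n \<gamma> w v" and g1: "\<gamma> \<le> 1"
      and tau: "0 \<le> \<tau>" "\<tau> \<le> taubar" "\<tau> \<le> T" and S': "\<forall>t\<in>{0..T}. (norm (v 0 t))^2 \<le> S"
    have S: "(norm (v 0 t))^2 \<le> S" if "0 \<le> t" "t \<le> T" for t using S' that by auto
    have T0: "T \<ge> 0" using tau by simp
    have S0: "S \<ge> 0" using S[of 0] T0 zero_le_power2 order_trans by blast
    have g: "\<gamma> > 0" using ts by (simp add: tone_system_def)
    define J where "J = energy 0 T (v 0)"
    define E where "E = energy 0 T (v n)"
    note wc = tone_system_basic(1)[OF ts] and vc = tone_system_basic(2)[OF ts]
    have J0: "J \<ge> 0" unfolding J_def by (rule integral_nonneg_Icc) (auto intro!: continuous_intros vc)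
    have E0: "E \<ge> 0" unfolding E_def by (rule integral_nonneg_Icc) (auto intro!: continuous_intros vc)
    define d where "d \<mu> = exp (- of_real \<tau> * \<mu>) - of_real c" for \<mu> :: complex
    have expD: "exp (cmod (l k) * \<tau>) \<le> D - 1" if "k < n" for k
    proof -
      have "exp (cmod (l k) * \<tau>) \<le> exp (cmod (l k) * taubar)" using tau by (simp add: mult_left_mono)
      with Dk[OF that] show ?thesis by linarith
    qed
    have dD: "cmod (d (l k)) \<le> D" if "k < n" for k
    proof -
      have "Re (- of_real \<tau> * l k) \<le> cmod (- of_real \<tau> * l k)" by (rule complex_Re_le_cmod)
      then have "cmod (exp (- of_real \<tau> * l k)) \<le> exp (cmod (l k) * \<tau>)"
        using tau by (simp add: norm_exp_eq_Re norm_mult mult.commute)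
      moreover have "cmod (of_real c) \<le> 1" using c by simp
      ultimately have "cmod (exp (- of_real \<tau> * l k)) + cmod (of_real c) \<le> D" using expD[OF that] by linarith
      then show ?thesis unfolding d_def using norm_triangle_ineq4 order_trans by blast
    qed
    have cont_shift: "continuous_on {\<tau>..T} (\<lambda>t. f (t - \<tau>))" if "continuous_on {0..} f" for f :: "real \<Rightarrow> complex^'m"
      by (rule continuous_on_compose2[OF that]) (auto intro!: continuous_intros)
    have ct: "continuous_on {\<tau>..T} f" if "continuous_on {0..} f" for f :: "real \<Rightarrow> complex^'m"
      using that tau by (intro continuous_on_Icc)
    define r where "r j t = w j (t - \<tau>) - exp (- of_real \<tau> * l j) *s w j t" for j t
    have rc: "continuous_on {\<tau>..T} (r j)" if "j < n" for j
      unfolding r_def by (intro continuous_intros continuous_on_smult cont_shift ct wc that)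
    \<comment> \<open>Of order \<gamma>^2, so that division by \<gamma> in Young's inequality below
      still leaves order \<gamma>.\<close>
    have rI: "energy \<tau> T (r j) \<le> \<gamma>^2 * D^2 * taubar^2 * J" if j: "j < n" for j
    proof -
      let ?h = "\<lambda>s. (norm (v (Suc j) s))^2"
      have hc: "continuous_on {0..} ?h" by (intro continuous_intros vc) (use j in simp)
      note win = integral_window_le[OF hc _ tau(1,3)]
      have "energy \<tau> T (r j) \<le> integral {\<tau>..T} (\<lambda>t. \<gamma>^2 * D^2 * \<tau> * integral {t - \<tau>..t} ?h)"
      proof (rule integral_le)
        show "(\<lambda>t. (norm (r j t))^2) integrable_on {\<tau>..T}"
          by (intro integrable_continuous_interval continuous_intros rc j)
        show "(\<lambda>t. \<gamma>^2 * D^2 * \<tau> * integral {t - \<tau>..t} ?h) integrable_on {\<tau>..T}"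
          by (intro integrable_continuous_interval continuous_intros continuous_on_subset[OF win(2)]) auto
        fix t assume t: "t \<in> {\<tau>..T}"
        show "(norm (r j t))^2 \<le> \<gamma>^2 * D^2 * \<tau> * integral {t - \<tau>..t} ?h" unfolding r_def
        proof (rule tone_delay[OF _ _ g tau(1)])
          show "(w j has_vector_derivative l j *s w j t + \<gamma> *\<^sub>R v (Suc j) t) (at t within {0..})" if "t \<ge> 0" for t
            using ts j that unfolding tone_system_def by blast
          show "continuous_on {0..} (v (Suc j))" by (rule vc) (use j in simp)
          show "\<tau> \<le> t" using t by simp
          show "exp (cmod (l j) * \<tau>) \<le> D" using expD[OF j] by simp
        qed
      qed
      also have "\<dots> = \<gamma>^2 * D^2 * \<tau> * integral {\<tau>..T} (\<lambda>t. integral {t - \<tau>..t} ?h)" by simp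
      also have "\<dots> \<le> \<gamma>^2 * D^2 * \<tau> * (\<tau> * integral {0..T} ?h)"
        using tau by (intro mult_left_mono win) auto
      also have "\<dots> \<le> \<gamma>^2 * D^2 * \<tau> * (\<tau> * J)" unfolding J_def
        using tau j by (intro mult_left_mono tone_system_energy[OF ts]) auto
      also have "\<dots> = (\<gamma>^2 * D^2 * J) * \<tau>^2" by (simp add: power2_eq_square)
      also have "\<dots> \<le> (\<gamma>^2 * D^2 * J) * taubar^2" using tau J0 by (intro mult_left_mono power_mono) auto
      finally show ?thesis by (simp add: mult_ac)
    qed
    define q where "q p t = w (fst p) t \<bullet> (d (l (snd p)) *s w (snd p) t)" for p t
    \<comment> \<open>All Young inequalities weigh v 0 and the w j by \<gamma>, the remainder and
      the r j by 1 / \<gamma>. Everything is doubled, because Young's inequality bounds twice an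
      inner product.\<close>
    define err where "err t = (real n + 1) / \<gamma> * (norm (v n t))^2 + \<gamma> * D^2 * (\<Sum>j<n. (norm (w j t))^2)
       + (real n + 2) * \<gamma> * (norm (v 0 t))^2 + (norm (v n (t - \<tau>)))^2 / \<gamma> + (\<Sum>j<n. (norm (r j t))^2) / \<gamma>" for t
    have dec: "v 0 t = (\<Sum>k<n. w k t) + v n t" for t by (rule tone_system_basic(3)[OF ts])
    have pw: "2 * (v 0 t \<bullet> v 0 (t - \<tau>)) \<ge> 2 * c * (norm (v 0 t))^2 + 2 * (\<Sum>p\<in>U. q p t) - err t" for t
    proof -
      let ?d = "\<Sum>j<n. d (l j) *s w j t"
      have "v 0 (t - \<tau>) - c *\<^sub>R v 0 t = ?d + v n (t - \<tau>) - c *\<^sub>R v n t + (\<Sum>j<n. r j t)"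
      proof -
        have "(\<Sum>j<n. r j t) = (\<Sum>j<n. w j (t - \<tau>)) - (\<Sum>j<n. exp (- of_real \<tau> * l j) *s w j t)"
          by (simp add: r_def sum_subtractf)
        moreover have "?d = (\<Sum>j<n. exp (- of_real \<tau> * l j) *s w j t) - c *\<^sub>R (\<Sum>j<n. w j t)"
        proof -
          have "of_real c *s y = c *\<^sub>R y" for y :: "complex^'m"
            by (simp add: vec_eq_iff scaleR_conv_of_real[where 'a=complex])
          then show ?thesis by (simp add: d_def vector_sub_rdistrib sum_subtractf scaleR_sum_right)
        qed
        ultimately show ?thesis unfolding dec[of "t - \<tau>"] dec[of t] by (simp add: scaleR_add_right)
      qed
      then have "v 0 t \<bullet> (v 0 (t - \<tau>) - c *\<^sub>R v 0 t)
          = v 0 t \<bullet> ?d + v 0 t \<bullet> v n (t - \<tau>) - c * (v 0 t \<bullet> v n t) + (\<Sum>j<n. v 0 t \<bullet> r j t)"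
        by (simp only: inner_add_right inner_diff_right inner_sum_right inner_scaleR_right)
      also have "v 0 t \<bullet> ?d = (\<Sum>k<n. w k t) \<bullet> ?d + v n t \<bullet> ?d" by (subst dec) (rule inner_add_left)
      also have "(\<Sum>k<n. w k t) \<bullet> ?d = (\<Sum>p\<in>U. q p t)"
        by (subst inner_sum_left) (simp add: inner_sum_right U_def q_def sum.cartesian_product case_prod_beta)
      finally have 1: "v 0 t \<bullet> v 0 (t - \<tau>) = c * (norm (v 0 t))^2 + (\<Sum>p\<in>U. q p t) + v n t \<bullet> ?d
          + v 0 t \<bullet> v n (t - \<tau>) - c * (v 0 t \<bullet> v n t) + (\<Sum>j<n. v 0 t \<bullet> r j t)"
        by (simp add: inner_diff_right dot_square_norm)
      have ti: "- (\<gamma> * (norm x)^2 + (norm y)^2 / \<gamma>) \<le> 2 * (x \<bullet> y)" for x y :: "complex^'m"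
        using two_inner_le[OF g, of x "- y"] by simp
      have "- ((\<Sum>j<n. (norm (v n t))^2 / \<gamma> + \<gamma> * D^2 * (norm (w j t))^2)) \<le> 2 * (v n t \<bullet> ?d)"
      proof -
        have "- ((norm (v n t))^2 / \<gamma> + \<gamma> * D^2 * (norm (w j t))^2) \<le> 2 * (v n t \<bullet> (d (l j) *s w j t))"
          if "j < n" for j
        proof -
          have "(norm (d (l j) *s w j t))^2 \<le> (D * norm (w j t))^2"
            using dD[OF that] by (intro power_mono) (auto simp: norm_smult mult_right_mono)
          then have "\<gamma> * (norm (d (l j) *s w j t))^2 \<le> \<gamma> * (D^2 * (norm (w j t))^2)"
            using g by (simp add: power_mult_distrib)
          with ti[of "d (l j) *s w j t" "v n t"] show ?thesis by (simp add: inner_commute)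
        qed
        then have "(\<Sum>j<n. - ((norm (v n t))^2 / \<gamma> + \<gamma> * D^2 * (norm (w j t))^2)) \<le> (\<Sum>j<n. 2 * (v n t \<bullet> (d (l j) *s w j t)))"
          by (intro sum_mono) auto
        then show ?thesis by (simp only: sum_negf inner_sum_right sum_distrib_left)
      qed
      moreover have "- (\<gamma> * (norm (v 0 t))^2 + (norm (v n (t - \<tau>)))^2 / \<gamma>) \<le> 2 * (v 0 t \<bullet> v n (t - \<tau>))" by (rule ti)
      moreover have "- (\<gamma> * (norm (v 0 t))^2 + (norm (v n t))^2 / \<gamma>) \<le> 2 * (- (c * (v 0 t \<bullet> v n t)))"
      proof -
        have "(norm ((- c) *\<^sub>R v n t))^2 \<le> (norm (v n t))^2"
          using c by (intro power_mono) (auto simp: mult_left_le_one_le)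
        then have "(norm ((- c) *\<^sub>R v n t))^2 / \<gamma> \<le> (norm (v n t))^2 / \<gamma>" using g by (intro divide_right_mono) auto
        with ti[of "v 0 t" "(- c) *\<^sub>R v n t"] show ?thesis by simp
      qed
      moreover have "- (\<Sum>j<n. \<gamma> * (norm (v 0 t))^2 + (norm (r j t))^2 / \<gamma>) \<le> 2 * (\<Sum>j<n. v 0 t \<bullet> r j t)"
      proof -
        have "(\<Sum>j<n. - (\<gamma> * (norm (v 0 t))^2 + (norm (r j t))^2 / \<gamma>)) \<le> (\<Sum>j<n. 2 * (v 0 t \<bullet> r j t))"
          by (intro sum_mono ti)
        then show ?thesis by (simp only: sum_negf sum_distrib_left)
      qed
      moreover have "err t = (\<Sum>j<n. (norm (v n t))^2 / \<gamma> + \<gamma> * D^2 * (norm (w j t))^2)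
        + (\<gamma> * (norm (v 0 t))^2 + (norm (v n (t - \<tau>)))^2 / \<gamma>) + (\<gamma> * (norm (v 0 t))^2 + (norm (v n t))^2 / \<gamma>)
        + (\<Sum>j<n. \<gamma> * (norm (v 0 t))^2 + (norm (r j t))^2 / \<gamma>)"
        using g by (simp add: err_def sum.distrib flip: sum_distrib_left sum_divide_distrib) (simp add: field_simps)
      moreover have "2 * c * x + 2 * y - e \<le> 2 * (c * x + y + b1 + b2 - b3 + b4)"
        if "- a1 \<le> 2 * b1" "- a2 \<le> 2 * b2" "- a3 \<le> 2 * (- b3)" "- a4 \<le> 2 * b4" "e = a1 + a2 + a3 + a4"
        for x y e a1 a2 a3 a4 b1 b2 b3 b4 :: real using that by (simp add: algebra_simps)
      ultimately show ?thesis unfolding 1 by blast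
    qed
    have qc: "continuous_on {0..} (q p)" if "p \<in> U" for p
      unfolding q_def using that by (auto simp: U_def intro!: continuous_intros continuous_on_smult wc)
    have cI: "f integrable_on {\<tau>..T}" if "continuous_on {\<tau>..T} f" for f :: "real \<Rightarrow> real"
      using that by (rule integrable_continuous_interval)
    have n2: "continuous_on {\<tau>..T} (\<lambda>t. (norm (f t))^2)" if "continuous_on {\<tau>..T} f" for f :: "real \<Rightarrow> complex^'m"
      using that by (intro continuous_intros)
    have v0I: "(\<lambda>t. (norm (v 0 t))^2) integrable_on {\<tau>..T}" by (intro cI n2 ct vc) simp
    have vnI: "(\<lambda>t. (norm (v n t))^2) integrable_on {\<tau>..T}" by (intro cI n2 ct vc) simp
    have vnsI: "(\<lambda>t. (norm (v n (t - \<tau>)))^2) integrable_on {\<tau>..T}" by (intro cI n2 cont_shift vc) simp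
    have wI: "(\<lambda>t. (norm (w j t))^2) integrable_on {\<tau>..T}" if "j < n" for j by (intro cI n2 ct wc that)
    have rI': "(\<lambda>t. (norm (r j t))^2) integrable_on {\<tau>..T}" if "j < n" for j by (intro cI n2 rc that)
    have qI: "q p integrable_on {\<tau>..T}" if "p \<in> U" for p
      by (rule integrable_Icc[OF qc[OF that] tau(1)])
    have sub: "energy \<tau> T f \<le> energy 0 T f"
      if "continuous_on {0..} f" for f :: "real \<Rightarrow> complex^'m"
      by (rule integral_subinterval_le) (use tau in \<open>auto intro!: continuous_intros that\<close>)
    have errI: "(err has_integral ((real n + 1) / \<gamma> * energy \<tau> T (v n)
        + \<gamma> * D^2 * (\<Sum>j<n. energy \<tau> T (w j))
        + (real n + 2) * \<gamma> * energy \<tau> T (v 0)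
        + energy \<tau> T (\<lambda>t. v n (t - \<tau>)) / \<gamma>
        + (\<Sum>j<n. energy \<tau> T (r j)) / \<gamma>)) {\<tau>..T}"
      unfolding err_def
      by (intro has_integral_add has_integral_mult_right has_integral_divide has_integral_sum finite_lessThan
          integrable_integral v0I vnI vnsI wI rI') auto
    have errB: "integral {\<tau>..T} err \<le> (2 * real n + 4) * (E / \<gamma>) + (real n * D^2 + (real n + 2) + real n * D^2 * taubar^2) * (\<gamma> * J)"
    proof -
      have "energy \<tau> T (\<lambda>t. v n (t - \<tau>)) \<le> E"
      proof -
        let ?h = "\<lambda>t. (norm (v n t))^2"
        have "continuous_on {0..T - \<tau>} ?h" by (intro continuous_on_Icc continuous_intros vc) auto
        then have "integral {\<tau>..T} (\<lambda>t. ?h (t - \<tau>)) = integral {0..T - \<tau>} ?h"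
          using integral_shift[of \<tau> \<tau> T ?h] by simp
        also have "\<dots> \<le> E" unfolding E_def
          by (rule integral_subinterval_le) (use tau in \<open>auto intro!: continuous_intros vc\<close>)
        finally show ?thesis .
      qed
      moreover have "energy \<tau> T (v n) \<le> E" unfolding E_def by (intro sub vc) simp
      moreover have "energy \<tau> T (v 0) \<le> J" unfolding J_def by (intro sub vc) simp
      moreover have "(\<Sum>j<n. energy \<tau> T (w j)) \<le> (\<Sum>j<n. J)"
      proof (rule sum_mono)
        fix j assume "j \<in> {..<n}"
        then show "energy \<tau> T (w j) \<le> J" unfolding J_def
          using sub[OF wc, of j] tone_system_energy(2)[OF ts T0, of j] by simp
      qed
      moreover have "(\<Sum>j<n. energy \<tau> T (r j)) \<le> (\<Sum>j<n. \<gamma>^2 * D^2 * taubar^2 * J)"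
        by (intro sum_mono rI) simp
      ultimately have "integral {\<tau>..T} err \<le> (real n + 1) / \<gamma> * E + \<gamma> * D^2 * (\<Sum>j<n. J)
          + (real n + 2) * \<gamma> * J + E / \<gamma> + (\<Sum>j<n. \<gamma>^2 * D^2 * taubar^2 * J) / \<gamma>"
        unfolding integral_unique[OF errI] using g
        by (intro add_mono mult_left_mono divide_right_mono) auto
      also have "\<dots> = (real n + 2) * (E / \<gamma>) + (real n * D^2 + (real n + 2) + real n * D^2 * taubar^2) * (\<gamma> * J)"
        using g by (simp add: power2_eq_square field_simps)
      also have "\<dots> \<le> (2 * real n + 4) * (E / \<gamma>) + (real n * D^2 + (real n + 2) + real n * D^2 * taubar^2) * (\<gamma> * J)"
        using E0 g by (intro add_right_mono mult_right_mono) auto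
      finally show ?thesis .
    qed
    define Res where "Res = {p\<in>U. l (snd p) + cnj (l (fst p)) = 0}"
    have ResU: "Res \<subseteq> U" by (auto simp: Res_def)
    have split: "(\<Sum>p\<in>U. f p) = (\<Sum>p\<in>Res. f p) + (\<Sum>p\<in>U - Res. f p)" for f :: "nat \<times> nat \<Rightarrow> real"
      using sum.subset_diff[OF ResU finU, of f] by simp
    have res0: "(\<Sum>p\<in>Res. q p t) \<ge> 0" for t
    proof -
      define I where "I = {k\<in>{..<n}. Re (l k) = 0}"
      \<comment> \<open>In the closed left half plane l j + cnj (l k) = 0 adds two nonpositive real
        parts to zero: both vanish, and the frequencies agree.\<close>
      have "Res = (SIGMA k:I. {j\<in>I. l j = l k})"
      proof -
        have "l j + cnj (l k) = 0 \<longleftrightarrow> Re (l k) = 0 \<and> Re (l j) = 0 \<and> l j = l k" if "k < n" "j < n" for k j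
          using l[OF that(1)] l[OF that(2)] by (auto simp: complex_eq_iff)
        then show ?thesis by (auto simp: Res_def U_def I_def)
      qed
      then have "(\<Sum>p\<in>Res. q p t) = (\<Sum>k\<in>I. \<Sum>j\<in>{j\<in>I. l j = l k}. w k t \<bullet> (d (l j) *s w j t))"
        by (subst sum.Sigma) (auto simp: I_def q_def case_prod_beta)
      also have "\<dots> \<ge> 0"
      proof (rule tone_resonant_nonneg)
        fix k assume k: "k \<in> I"
        then have "c \<le> cos (Im (l k) * \<tau>)" using cs tau by (simp add: I_def)
        then show "Re (d (l k)) \<ge> 0" using k by (simp add: d_def I_def Re_exp mult.commute)
      qed (simp add: I_def)
      finally show ?thesis .
    qed
    have qsum: "integral {\<tau>..T} (\<lambda>t. \<Sum>p\<in>U. q p t) \<ge> - Kb * (2 * 4 ^ n * S + 2 * \<gamma> * J)"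
    proof -
      have "integral {\<tau>..T} (\<lambda>t. \<Sum>p\<in>U. q p t)
          = integral {\<tau>..T} (\<lambda>t. \<Sum>p\<in>Res. q p t) + integral {\<tau>..T} (\<lambda>t. \<Sum>p\<in>U-Res. q p t)"
        unfolding split using ResU finU
        by (intro integral_add integrable_sum qI) (auto intro: finite_subset)
      moreover have "integral {\<tau>..T} (\<lambda>t. \<Sum>p\<in>Res. q p t) \<ge> 0"
        using ResU finU by (intro integral_nonneg integrable_sum qI res0) (auto intro: finite_subset)
      moreover have "integral {\<tau>..T} (\<lambda>t. \<Sum>p\<in>U-Res. q p t) = (\<Sum>p\<in>U-Res. integral {\<tau>..T} (q p))"
        using finU by (intro integral_sum qI) auto
      moreover have "(\<Sum>p\<in>U-Res. integral {\<tau>..T} (q p)) \<ge> (\<Sum>p\<in>U-Res. - b p * (2 * 4 ^ n * S + 2 * \<gamma> * J))"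
      proof (rule sum_mono)
        fix p assume p: "p \<in> U - Res"
        obtain k j where kj: "p = (k, j)" by force
        with p have k: "k < n" "j < n" "l j + cnj (l k) \<noteq> 0" by (auto simp: U_def Res_def)
        show "- b p * (2 * 4 ^ n * S + 2 * \<gamma> * J) \<le> integral {\<tau>..T} (q p)"
          unfolding J_def q_def kj fst_conv snd_conv
          by (rule tone_cross[OF ts k S tau(1,3)]) (use dD[OF k(2)] k in \<open>auto simp: b_def\<close>)
      qed
      moreover have "(\<Sum>p\<in>U-Res. - b p * (2 * 4 ^ n * S + 2 * \<gamma> * J)) \<ge> - Kb * (2 * 4 ^ n * S + 2 * \<gamma> * J)"
      proof -
        have "(\<Sum>p\<in>U-Res. b p) \<le> Kb" unfolding Kb_def using finU b0 by (intro sum_mono2) auto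
        moreover have "2 * 4 ^ n * S + 2 * \<gamma> * J \<ge> 0" using S0 g J0 by simp
        ultimately have "(\<Sum>p\<in>U-Res. b p) * (2 * 4 ^ n * S + 2 * \<gamma> * J) \<le> Kb * (2 * 4 ^ n * S + 2 * \<gamma> * J)"
          by (rule mult_right_mono)
        then show ?thesis by (simp add: sum_distrib_right sum_negf)
      qed
      ultimately show ?thesis by linarith
    qed
    have qsI: "(\<lambda>t. \<Sum>p\<in>U. q p t) integrable_on {\<tau>..T}" by (intro integrable_sum qI finU)
    have "integral {\<tau>..T} (\<lambda>t. 2 * c * (norm (v 0 t))^2 + 2 * (\<Sum>p\<in>U. q p t) - err t)
        \<le> integral {\<tau>..T} (\<lambda>t. 2 * (v 0 t \<bullet> v 0 (t - \<tau>)))"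
    proof (rule integral_le)
      show "(\<lambda>t. 2 * c * (norm (v 0 t))^2 + 2 * (\<Sum>p\<in>U. q p t) - err t) integrable_on {\<tau>..T}"
        by (intro integrable_diff integrable_add integrable_on_mult_right v0I qsI has_integral_integrable[OF errI])
      show "(\<lambda>t. 2 * (v 0 t \<bullet> v 0 (t - \<tau>))) integrable_on {\<tau>..T}"
        by (intro cI continuous_intros ct cont_shift vc) auto
    qed (use pw in simp)
    also have "integral {\<tau>..T} (\<lambda>t. 2 * c * (norm (v 0 t))^2 + 2 * (\<Sum>p\<in>U. q p t) - err t)
      = 2 * c * energy \<tau> T (v 0) + 2 * integral {\<tau>..T} (\<lambda>t. \<Sum>p\<in>U. q p t) - integral {\<tau>..T} err"
      by (intro integral_unique has_integral_diff has_integral_add has_integral_mult_right integrable_integral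
          v0I qsI has_integral_integrable[OF errI])
    finally have fin: "2 * c * energy \<tau> T (v 0) + 2 * integral {\<tau>..T} (\<lambda>t. \<Sum>p\<in>U. q p t) - integral {\<tau>..T} err
      \<le> 2 * integral {\<tau>..T} (\<lambda>t. v 0 t \<bullet> v 0 (t - \<tau>))" by simp
    have "2 * (K * (\<gamma> * J + E / \<gamma> + S)) \<ge> 2 * (Kb * (2 * 4 ^ n * S + 2 * \<gamma> * J))
       + ((2 * real n + 4) * (E / \<gamma>) + (real n * D^2 + (real n + 2) + real n * D^2 * taubar^2) * (\<gamma> * J))"
    proof -
      define a1 a2 a3 where "a1 = \<gamma> * J" and "a2 = E / \<gamma>" and "a3 = S"
      define m where "m = real n * D^2 + (real n + 2) + real n * D^2 * taubar^2"
      have a0: "a1 \<ge> 0" "a2 \<ge> 0" "a3 \<ge> 0" using g J0 E0 S0 by (auto simp: a1_def a2_def a3_def)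
      have m0: "m \<ge> 0" by (simp add: m_def)
      have K: "K = 2 * 4 ^ n * Kb + 2 * Kb + (real n + 2) + m" by (simp add: K_def m_def)
      have k1: "2 * Kb + m \<le> K" "real n + 2 \<le> K" "2 * 4 ^ n * Kb \<le> K" using K Kb0 m0 by auto
      have "(2 * Kb + m) * a1 \<le> K * a1" "(real n + 2) * a2 \<le> K * a2" "2 * 4 ^ n * Kb * a3 \<le> K * a3"
        by (intro mult_right_mono k1 a0)+
      then have "2 * ((2 * Kb + m) * a1 + (real n + 2) * a2 + 2 * 4 ^ n * Kb * a3) \<le> 2 * (K * (a1 + a2 + a3))"
        by (simp add: distrib_left)
      moreover have "m * a1 \<ge> 0" using m0 a0 by simp
      ultimately have "2 * (Kb * (2 * 4 ^ n * a3 + 2 * a1)) + ((2 * real n + 4) * a2 + m * a1) \<le> 2 * (K * (a1 + a2 + a3))"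
        by (simp add: algebra_simps)
      then show ?thesis by (simp add: a1_def a2_def a3_def m_def mult.assoc)
    qed
    moreover have "c * x - k \<le> y" if "2 * (b * z) + m \<le> 2 * k" "2 * c * x + 2 * q - e \<le> 2 * y" "- b * z \<le> q" "e \<le> m"
      for x y k b z m q e :: real using that by (simp add: algebra_simps)
    ultimately show "c * energy \<tau> T (v 0)
       - K * (\<gamma> * energy 0 T (v 0) + energy 0 T (v n) / \<gamma> + S)
      \<le> integral {\<tau>..T} (\<lambda>t. v 0 t \<bullet> v 0 (t - \<tau>))"
      unfolding J_def[symmetric] E_def[symmetric] using fin qsum errB by blast
  qed
qed

subsection \<open>Stability of a single agent\<close>

text \<open>The norm of a matrix as a vector of vectors is the Frobenius norm; Cauchy-Schwarz in
  each row bounds the action.\<close>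

lemma norm_matrix_vector_le:
  fixes M :: "'a::real_normed_field^'n^'m"
  shows "norm (M *v x) \<le> norm M * norm x"
proof -
  have row: "norm ((M *v x) $ i) \<le> norm (M $ i) * norm x" for i
  proof -
    have "norm ((M *v x) $ i) \<le> (\<Sum>j\<in>UNIV. norm (M $ i $ j * x $ j))"
      unfolding matrix_vector_mult_def by (simp add: norm_sum)
    also have "\<dots> = (\<Sum>j\<in>UNIV. \<bar>norm (M $ i $ j)\<bar> * \<bar>norm (x $ j)\<bar>)" by (simp add: norm_mult)
    also have "\<dots> \<le> L2_set (\<lambda>j. norm (M $ i $ j)) UNIV * L2_set (\<lambda>j. norm (x $ j)) UNIV"
      by (rule L2_set_mult_ineq)
    finally show ?thesis by (simp add: norm_vec_def)
  qed
  have "norm (M *v x) \<le> L2_set (\<lambda>i. norm (M $ i) * norm x) UNIV"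
    unfolding norm_vec_def[of "M *v x"] by (rule L2_set_mono) (use row in auto)
  also have "\<dots> = norm M * norm x" by (simp add: norm_vec_def[of M] L2_set_left_distrib)
  finally show ?thesis .
qed

lemma norm_transpose: "norm (transpose M) = norm (M :: real^'n^'m)"
proof -
  have sq: "(norm X)^2 = (\<Sum>i\<in>UNIV. \<Sum>j\<in>UNIV. (X $ i $ j)^2)" for X :: "real^'p^'q"
    by (simp add: norm_vec_def L2_set_def sum_nonneg)
  have "(norm (transpose M))^2 = (norm M)^2"
    unfolding sq by (subst sum.swap) (simp add: transpose_def)
  then show ?thesis by simp
qed

definition complexify :: "real^'n^'m \<Rightarrow> complex^'n^'m" where
  "complexify M = (\<chi> i j. complex_of_real (M $ i $ j))"

lemma complexify_mult_cvec: "complexify M *v cvec x = cvec (M *v x)"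
  by (simp add: complexify_def cvec_def matrix_vector_mult_def vec_eq_iff)

lemma norm_complexify: "norm (complexify M) = norm M"
  by (simp add: complexify_def norm_vec_def)

text \<open>Nonnegativity of the form of P at x - P x / p, expanded with |P| \<le> p, is the
  operator inequality P^2 \<le> p P. It makes the output \<open>transpose B *v (P *v x)\<close>
  small relative to the Lyapunov function when P is small.\<close>

lemma pos_def_norm_le:
  assumes pd: "pos_def P" and p: "norm P \<le> p"
  shows "(norm (P *v x))^2 \<le> p * (x \<bullet> (P *v x))"
proof (cases "P *v x = 0")
  case False
  have p0: "p > 0" using p False by (metis matrix_vector_mult_0 norm_le_zero_iff not_le order_trans)
  have sym: "transpose P = P" using pd by (simp add: pos_def_def)
  have sw: "x \<bullet> (P *v y) = (P *v x) \<bullet> y" for x y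
    by (metis dot_lmul_matrix sym transpose_matrix_vector)
  define y where "y = P *v x"
  define t where "t = 1 / p"
  have "0 \<le> (x - t *\<^sub>R y) \<bullet> (P *v (x - t *\<^sub>R y))"
    using pd by (cases "x - t *\<^sub>R y = 0") (auto simp: pos_def_def less_imp_le)
  also have "\<dots> = x \<bullet> (P *v x) - t * (x \<bullet> (P *v y)) - t * (y \<bullet> (P *v x)) + t * t * (y \<bullet> (P *v y))"
    by (simp add: matrix_vector_mult_diff_distrib matrix_vector_mult_scaleR inner_diff_left
        inner_diff_right algebra_simps)
  also have "x \<bullet> (P *v y) = (norm y)^2" by (simp add: sw y_def[symmetric] dot_square_norm)
  also have "y \<bullet> (P *v x) = (norm y)^2" by (simp add: y_def[symmetric] dot_square_norm)
  finally have 1: "2 * t * (norm y)^2 \<le> x \<bullet> (P *v x) + t * t * (y \<bullet> (P *v y))" by simp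
  have "y \<bullet> (P *v y) \<le> norm y * norm (P *v y)" by (rule norm_cauchy_schwarz)
  also have "\<dots> \<le> norm y * (p * norm y)"
    by (intro mult_left_mono order_trans[OF norm_matrix_vector_le] mult_right_mono p) auto
  finally have "t * t * (y \<bullet> (P *v y)) \<le> t * t * (p * (norm y)^2)"
    using p0 by (intro mult_left_mono) (auto simp: t_def power2_eq_square mult_ac)
  also have "\<dots> = t * (norm y)^2" using p0 by (simp add: t_def)
  finally have "t * (norm y)^2 \<le> x \<bullet> (P *v x)" using 1 by simp
  then show ?thesis using p0 by (simp add: t_def y_def field_simps)
next
  case True
  then show ?thesis using p by simp
qed

section \<open>Frequencies on the imaginary axis\<close>

lemma is_eig_cnj: "is_eig A l \<Longrightarrow> is_eig A (cnj l)"
proof -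
  assume "is_eig A l"
  then obtain y where y: "y \<noteq> 0" "cmat A *v y = l *s y" by (auto simp: is_eig_iff)
  define z where "z = (\<chi> i. cnj (y $ i))"
  have "cmat A *v z = cnj l *s z"
  proof -
    have "(cmat A *v z) $ i = cnj ((cmat A *v y) $ i)" for i
      by (simp add: matrix_vector_mult_def cmat_def z_def cnj_sum)
    then show ?thesis by (simp add: y vec_eq_iff z_def)
  qed
  moreover have "z \<noteq> 0" using y(1) by (auto simp: z_def vec_eq_iff)
  ultimately show ?thesis by (auto simp: is_eig_iff)
qed

text \<open>\<open>omega_max\<close> is a maximum over signed frequencies; since the spectrum of a
  real matrix is closed under conjugation, it bounds their absolute values. If A is not Hurwitz, an
  eigenvalue on the axis exists, so the maximum is not taken over the empty set.\<close>

lemma omega_max_bound: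
  assumes lhp: "\<forall>lam. is_eig A lam \<longrightarrow> Re lam \<le> 0"
  shows "omega_max A \<ge> 0" and "is_eig A l \<Longrightarrow> Re l = 0 \<Longrightarrow> \<bar>Im l\<bar> \<le> omega_max A"
proof -
  define W where "W = {w::real. det (mat (\<i> * complex_of_real w) - cmat A) = 0}"
  have W: "w \<in> W \<longleftrightarrow> is_eig A (\<i> * complex_of_real w)" for w by (simp add: W_def is_eig_def)
  have "W \<subseteq> Im ` {l. is_eig A l}" using W by force
  then have fin: "finite W" using finite_eigenvalues finite_subset by blast
  have ax: "l = \<i> * complex_of_real (Im l)" if "Re l = 0" for l using that by (simp add: complex_eq_iff)
  have b: "\<not> hurwitz A \<and> \<bar>Im l\<bar> \<le> omega_max A" if l: "is_eig A l" "Re l = 0" for l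
  proof -
    have nh: "\<not> hurwitz A" using l by (auto simp: hurwitz_def)
    have "Im l \<in> W" using l ax[of l] W by simp
    moreover have "Im (cnj l) \<in> W" using is_eig_cnj[OF l(1)] l(2) ax[of "cnj l"] W[of "Im (cnj l)"] by simp
    ultimately have "Im l \<le> Max W" "- Im l \<le> Max W" using Max_ge[OF fin] by auto
    with nh show ?thesis by (simp add: omega_max_def W_def)
  qed
  then show "is_eig A l \<Longrightarrow> Re l = 0 \<Longrightarrow> \<bar>Im l\<bar> \<le> omega_max A" by blast
  show "omega_max A \<ge> 0"
  proof (cases "hurwitz A")
    case True
    then show ?thesis by (simp add: omega_max_def)
  next
    case False
    then obtain l where "is_eig A l" "\<not> Re l < 0" by (auto simp: hurwitz_def)
    then have "\<bar>Im l\<bar> \<le> omega_max A" using b lhp by fastforce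
    then show ?thesis by linarith
  qed
qed

text \<open>Barbalat's argument. The slope of |x|^2 is bounded by L, so a late value of at least e
  keeps |x|^2 above e / 2 for a time e / (2 L); the energy spent there exceeds what is left below
  the supremum of the running energy.\<close>

lemma barbalat_norm_power2:
  fixes x :: "real \<Rightarrow> 'a::real_inner"
  assumes der: "\<And>t. t \<ge> 0 \<Longrightarrow> (x has_vector_derivative x' t) (at t within {0..})"
    and xb: "\<And>t. t \<ge> 0 \<Longrightarrow> norm (x t) \<le> M" and x'b: "\<And>t. t \<ge> 0 \<Longrightarrow> norm (x' t) \<le> M"
    and I: "\<And>T. T \<ge> 0 \<Longrightarrow> energy 0 T x \<le> Q"
  shows "(x \<longlongrightarrow> 0) at_top"
proof -
  define h where "h t = (norm (x t))^2" for t
  have M0: "M \<ge> 0" using xb[of 0] norm_ge_zero order_trans by blast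
  have xc: "continuous_on {0..} x" using der by (rule continuous_on_from_vector_derivative)
  have hc: "continuous_on {0..} h" unfolding h_def by (intro continuous_intros xc)
  define \<Phi> where "\<Phi> T = integral {0..T} h" for T
  have comb: "\<Phi> s + integral {s..t} h = \<Phi> t" if "0 \<le> s" "s \<le> t" for s t
    unfolding \<Phi>_def
    by (rule integral_combine_Icc[OF hc]) (use that in auto)
  have h0: "h t \<ge> 0" for t by (simp add: h_def)
  have bdd: "bdd_above (\<Phi> ` {0..})" using I unfolding \<Phi>_def h_def by (intro bdd_aboveI2) auto
  define Z where "Z = (SUP t\<in>{0..}. \<Phi> t)"
  have le: "\<Phi> t \<le> Z" if "t \<ge> 0" for t unfolding Z_def by (rule cSUP_upper[OF _ bdd]) (use that in auto)
  \<comment> \<open>The 1 keeps L positive when M = 0.\<close>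
  define L where "L = 2 * M * M + 1"
  have L: "L > 0" using M0 by (simp add: L_def add_nonneg_pos)
  have drop: "h s - h t \<le> (t - s) * L" if "0 \<le> s" "s \<le> t" for s t
  proof -
    have "(- h t) - (- h s) \<le> integral {s..t} (\<lambda>_. L)"
    proof (rule growth_le_integral[where F' = "\<lambda>t. - (2 * (x t \<bullet> x' t))"])
      fix r assume r: "s \<le> r" "r \<le> t"
      then have r0: "r \<ge> 0" using that by simp
      show "((\<lambda>t. - h t) has_real_derivative - (2 * (x r \<bullet> x' r))) (at r within {0..})"
        unfolding h_def by (intro DERIV_minus has_real_derivative_norm_power2 der r0)
      have "- (x r \<bullet> x' r) \<le> norm (x r) * norm (x' r)"
        using norm_cauchy_schwarz[of "- x r" "x' r"] by simp
      also have "\<dots> \<le> M * M" using xb[OF r0] x'b[OF r0] M0 by (intro mult_mono) auto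
      finally show "- (2 * (x r \<bullet> x' r)) \<le> L" by (simp add: L_def)
    qed (use that in auto)
    then show ?thesis using that by simp
  qed
  have "((\<lambda>t. h t) \<longlongrightarrow> 0) at_top"
  proof (rule tendstoI)
    fix e :: real assume e: "e > 0"
    define \<delta> where "\<delta> = e / (2 * L)"
    have \<delta>: "\<delta> > 0" using e L by (simp add: \<delta>_def)
    have "Z - \<delta> * (e / 2) < Z" using \<delta> e by simp
    then obtain t1 where t1: "t1 \<ge> 0" "Z - \<delta> * (e / 2) < \<Phi> t1"
      unfolding Z_def using less_cSUP_iff[OF _ bdd] by (metis atLeast_iff empty_iff order_refl)
    have "h t < e" if t: "t \<ge> t1" for t
    proof (rule ccontr)
      assume "\<not> h t < e"
      then have he: "h t \<ge> e" by simp
      have "integral {t..t+\<delta>} (\<lambda>_. e / 2) \<le> integral {t..t+\<delta>} h"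
      proof (rule integral_le_Icc[OF _ hc])
        fix r assume r: "t \<le> r" "r \<le> t + \<delta>"
        have "h t - h r \<le> (r - t) * L" by (rule drop) (use r t t1 in auto)
        also have "\<dots> \<le> \<delta> * L" using r L by (intro mult_right_mono) auto
        also have "\<dots> = e / 2" using L by (simp add: \<delta>_def)
        finally show "e / 2 \<le> h r" using he by simp
      qed (use t t1 in auto)
      moreover have "integral {t..t+\<delta>} h = \<Phi> (t + \<delta>) - \<Phi> t" using comb[of t "t + \<delta>"] t t1 \<delta> by simp
      moreover have "\<Phi> t \<ge> \<Phi> t1"
        using comb[of t1 t] t t1 integral_nonneg_Icc[OF hc, of t1 t] h0 by simp
      ultimately show False using t1 le[of "t + \<delta>"] t \<delta> by simp
    qed
    then show "\<forall>\<^sub>F t in at_top. dist (h t) 0 < e"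
      using h0 by (auto simp: eventually_at_top_linorder dist_real_def)
  qed
  then have "((\<lambda>t. sqrt (h t)) \<longlongrightarrow> sqrt 0) at_top" by (rule tendsto_real_sqrt)
  then show ?thesis by (simp add: h_def tendsto_norm_zero_iff)
qed

section \<open>Energy balance of one delayed agent\<close>

lemma complexify_mult: "complexify (M ** N) = complexify M ** complexify N"
  by (simp add: complexify_def matrix_matrix_mult_def vec_eq_iff)

text \<open>Integrating V' and inserting the tone estimate leaves a budget in J, the energy of v:
  the Riccati equation costs J, the feedback gains 2 \<rho> c J = 4 J, and \<open>s1\<close> and
  \<open>s2\<close> cost J each. The supremum term becomes Vm / 2 by \<open>s3\<close>. Q collects
  what does not depend on the horizon; Vm remains a parameter, to be fixed when the bound on V is
  closed.\<close>

lemma agent_energy: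
  fixes A P :: "real^'n^'n" and B :: "real^'m^'n" and x w :: "real \<Rightarrow> real^'n" and l :: "nat \<Rightarrow> complex"
  assumes pd: "pos_def P"
    and are: "riccati A B eps P" and eps: "eps > 0"
    and rho: "\<rho> > 0" "\<rho> * c = 2"
    and gam: "0 < \<gamma>" "\<gamma> \<le> 1" and l: "\<And>k. k < n \<Longrightarrow> Re (l k) \<le> 0"
    and tone: "tone_estimate TYPE('m) l n taubar c K" and casc: "cascade_estimate (cmat A) l \<gamma> n Kc"
    and K0: "K \<ge> 0" "Kc \<ge> 0"
    and s1: "2 * \<rho> * K * \<gamma> \<le> 1"
    and s2: "(2 * \<rho> * K / \<gamma>) * ((norm B * norm P)^2 * Kc * (2 * \<rho>^2 * (norm B)^2)) \<le> 1"
    and s3: "2 * \<rho> * K * ((norm B)^2 * norm P) \<le> 1 / 2"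
    and tau: "0 \<le> \<tau>" "\<tau> \<le> taubar"
    and xc: "continuous_on {-taubar..} x" and wc: "continuous_on {0..} w"
    and W: "\<And>T. T \<ge> 0 \<Longrightarrow> energy 0 T w \<le> W"
    and der: "\<And>t. t \<ge> 0 \<Longrightarrow> (x has_vector_derivative
       (A *v x t + B *v (- \<rho> *\<^sub>R ((transpose B ** P) *v x (t - \<tau>))) + w t)) (at t within {0..})"
  shows "\<exists>Q. \<forall>T\<ge>\<tau>. \<forall>Vm. (\<forall>t\<in>{0..T}. x t \<bullet> (P *v x t) \<le> Vm) \<longrightarrow>
     x T \<bullet> (P *v x T) + eps / 2 * energy 0 T x \<le> Q + Vm / 2"
proof -
  define C where "C = transpose B ** P"
  define v where "v t = C *v x t" for t
  have sym: "transpose P = P" using pd by (simp add: pos_def_def)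
  have sw: "x \<bullet> (P *v y) = (P *v x) \<bullet> y" for x y
    by (metis dot_lmul_matrix sym transpose_matrix_vector)
  have trB: "x \<bullet> (B *v y) = (transpose B *v x) \<bullet> y" for x y
    by (metis dot_lmul_matrix transpose_matrix_vector)
  have Cx: "C *v y = transpose B *v (P *v y)" for y by (simp add: C_def matrix_vector_mul_assoc)
  have vc': "continuous_on {-\<tau>..} v" unfolding v_def
    by (intro continuous_on_matrix_mult continuous_on_subset[OF xc])
       (use tau in auto)
  have vc: "continuous_on {0..} v" by (rule continuous_on_subset[OF vc']) (use tau in auto)
  have vdc: "continuous_on {0..} (\<lambda>t. v (t - \<tau>))"
    by (rule continuous_on_compose2[OF vc']) (auto intro!: continuous_intros)
  have xc0: "continuous_on {0..} x" by (rule continuous_on_subset[OF xc]) (use tau in auto)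
  have cxc: "continuous_on {0..} (\<lambda>t. cvec (x t))" by (rule bounded_linear.continuous_on[OF bounded_linear_cvec xc0])
  define CC where "CC = complexify C"
  have CCb: "norm (CC *v y) \<le> norm B * norm P * norm y" for y
  proof -
    have "CC *v y = complexify (transpose B) *v (complexify P *v y)"
      by (simp add: CC_def C_def complexify_mult matrix_vector_mul_assoc)
    also have "norm \<dots> \<le> norm B * norm (complexify P *v y)"
      using norm_matrix_vector_le[of "complexify (transpose B)"] by (simp add: norm_complexify norm_transpose)
    also have "\<dots> \<le> norm B * (norm P * norm y)"
      using norm_matrix_vector_le[of "complexify P" y] by (intro mult_left_mono) (auto simp: norm_complexify)
    finally show ?thesis by (simp add: mult.assoc)
  qed
  \<comment> \<open>The filters act on the state, where the annihilating product is available; the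
    tones of the output are images under CC, the complexified \<open>transpose B ** P\<close>, which
    contributes the factor |P| by which the remainder is small.\<close>
  define X where "X = cascade l \<gamma> (\<lambda>t. cvec (x t))"
  have Xc: "continuous_on {0..} (X k)" for k unfolding X_def by (rule cascade_continuous[OF cxc])
  define tw where "tw k t = CC *v (\<gamma> *\<^sub>R causal_filter (l k - of_real \<gamma>) (X k) t)" for k t
  define tv where "tv k t = CC *v X k t" for k t
  have tvc: "continuous_on {0..} (tv k)" for k unfolding tv_def
    by (rule continuous_on_matrix_mult[OF Xc])
  have tv0: "tv 0 t = cvec (v t)" for t
    by (simp add: tv_def X_def CC_def v_def complexify_mult_cvec)
  have ts: "tone_system l n \<gamma> tw tv"
    unfolding tone_system_def
  proof (intro conjI allI impI)
    fix k assume k: "k < n"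
    show "Re (l k) \<le> 0" by (rule l[OF k])
    show "tw k 0 = 0" by (simp add: tw_def causal_filter_0)
    show "tv (Suc k) = (\<lambda>t. tv k t - tw k t)"
      by (simp add: tv_def tw_def X_def fun_eq_iff matrix_vector_mult_diff_distrib)
    fix t :: real assume t: "t \<ge> 0"
    let ?f = "\<gamma> *\<^sub>R causal_filter (l k - of_real \<gamma>) (X k) t"
    have "(tw k has_vector_derivative CC *v (l k *s ?f + \<gamma> *\<^sub>R X (Suc k) t)) (at t within {0..})"
      unfolding tw_def using cascade_tone_derivative[OF cxc t, of \<gamma> l k, folded X_def]
      by (rule has_vector_derivative_matrix_mult)
    moreover have "CC *v (l k *s ?f + \<gamma> *\<^sub>R X (Suc k) t) = l k *s tw k t + \<gamma> *\<^sub>R tv (Suc k) t"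
      unfolding tw_def tv_def matrix_vector_right_distrib vector_scalar_commute
      by (simp add: linear_scale[OF bounded_linear.linear[OF matrix_vector_mul_bounded_linear]])
    ultimately show "(tw k has_vector_derivative l k *s tw k t + \<gamma> *\<^sub>R tv (Suc k) t) (at t within {0..})"
      by (simp only:)
  qed (use gam tvc in auto)
  \<comment> \<open>The delayed feedback counts as forcing, with energy at most a fixed multiple of
    that of v plus contributions of the initial function and the disturbance.\<close>
  define f where "f t = - \<rho> *\<^sub>R (B *v v (t - \<tau>)) + w t" for t
  have fc: "continuous_on {0..} f" unfolding f_def
    by (intro continuous_intros continuous_on_matrix_mult vdc wc)
  have der2: "(x has_vector_derivative (A *v x t + f t)) (at t within {0..})" if "t \<ge> 0" for t
  proof -
    have "B *v (- \<rho> *\<^sub>R ((transpose B ** P) *v x (t - \<tau>))) = - \<rho> *\<^sub>R (B *v v (t - \<tau>))"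
      unfolding v_def C_def by (rule matrix_vector_mult_scaleR)
    then show ?thesis using der[OF that] unfolding f_def by (simp only: add.assoc)
  qed
  have derc: "((\<lambda>t. cvec (x t)) has_vector_derivative (cmat A *v cvec (x t) + cvec (f t))) (at t within {0..})"
    if "t \<ge> 0" for t
    using bounded_linear.has_vector_derivative[OF bounded_linear_cvec der2[OF that]]
    by (simp add: cmat_mult_cvec linear_add[OF linear_cvec])
  define V where "V t = x t \<bullet> (P *v x t)" for t
  define b p where "b = norm B" and "p = norm P"
  have b0: "b \<ge> 0" "p \<ge> 0" by (auto simp: b_def p_def)
  have vV: "(norm (v t))^2 \<le> b^2 * p * V t" for t
  proof -
    have "norm (v t) \<le> b * norm (P *v x t)"
      using norm_matrix_vector_le[of "transpose B"] by (simp add: v_def Cx b_def norm_transpose)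
    then have "(norm (v t))^2 \<le> (b * norm (P *v x t))^2" by (rule power_mono) simp
    also have "\<dots> = b^2 * (norm (P *v x t))^2" by (simp add: power_mult_distrib)
    also have "\<dots> \<le> b^2 * (p * V t)"
      unfolding V_def p_def by (intro mult_left_mono pos_def_norm_le[OF pd]) auto
    finally show ?thesis by (simp add: mult.assoc)
  qed
  \<comment> \<open>The tone estimate covers [\<tau>, T] only, because before \<tau> the delayed
    output reads the initial function. H0, J0 and I0 collect what this stretch contributes.\<close>
  define H0 where "H0 = energy (-\<tau>) 0 v"
  define J0 where "J0 = energy 0 \<tau> v"
  define I0 where "I0 = integral {0..\<tau>} (\<lambda>t. v t \<bullet> v (t - \<tau>))"
  define Ec where "Ec = (b * p)^2 * Kc * (2 * \<rho>^2 * b^2 * H0 + 2 * W + (norm (x 0))^2)"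
  define Q where "Q = V 0 - 2 * \<rho> * I0 + 4 * J0 + (2 * \<rho> * K / \<gamma>) * Ec + 2 / eps * p^2 * W"
  have main: "V T + eps / 2 * energy 0 T x \<le> Q + Vm / 2"
    if T: "T \<ge> \<tau>" and Vm: "\<And>t. 0 \<le> t \<Longrightarrow> t \<le> T \<Longrightarrow> V t \<le> Vm" for T Vm
  proof -
    have T0: "T \<ge> 0" using T tau by simp
    define J where "J = energy 0 T v"
    define E where "E = energy 0 T (tv n)"
    define Y where "Y = integral {0..T} (\<lambda>t. v t \<bullet> v (t - \<tau>))"
    define Yt where "Yt = integral {\<tau>..T} (\<lambda>t. v t \<bullet> v (t - \<tau>))"
    have J0': "J \<ge> 0" unfolding J_def by (rule integral_nonneg_Icc) (auto intro!: continuous_intros vc)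
    have Y: "Y = I0 + Yt" unfolding Y_def I0_def Yt_def
      by (rule integral_combine_Icc[symmetric]) (use T tau in \<open>auto intro!: continuous_intros vc vdc\<close>)
    have JJ: "energy \<tau> T v = J - J0"
    proof -
      have "J0 + energy \<tau> T v = J" unfolding J_def J0_def
        by (rule integral_combine_Icc) (use T tau in \<open>auto intro!: continuous_intros vc\<close>)
      then show ?thesis by simp
    qed
    have step1: "V T - V 0 \<le> J - eps / 2 * energy 0 T x - 2 * \<rho> * Y + 2 / eps * p^2 * W"
    proof -
      let ?h = "\<lambda>t. (norm (v t))^2 - eps / 2 * (norm (x t))^2 - 2 * \<rho> * (v t \<bullet> v (t - \<tau>)) + 2 / eps * p^2 * (norm (w t))^2"
      have "V T - V 0 \<le> integral {0..T} ?h"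
      proof (rule growth_le_integral[where F' = "\<lambda>t. x t \<bullet> (P *v (A *v x t + f t)) + (A *v x t + f t) \<bullet> (P *v x t)"])
        fix t assume t: "0 \<le> t" "t \<le> T"
        show "(V has_real_derivative x t \<bullet> (P *v (A *v x t + f t)) + (A *v x t + f t) \<bullet> (P *v x t)) (at t within {0..})"
          unfolding V_def
          by (intro has_real_derivative_inner der2 t has_vector_derivative_matrix_mult)
        have "x t \<bullet> (P *v (A *v x t + f t)) + (A *v x t + f t) \<bullet> (P *v x t)
            = 2 * (x t \<bullet> (P *v (A *v x t))) + 2 * (x t \<bullet> (P *v f t))"
        proof -
          have "(A *v x t + f t) \<bullet> (P *v x t) = x t \<bullet> (P *v (A *v x t + f t))" by (metis sw inner_commute)
          then show ?thesis by (simp add: matrix_vector_right_distrib inner_add_right)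
        qed
        also have "2 * (x t \<bullet> (P *v (A *v x t))) = (norm (v t))^2 - eps * (norm (x t))^2"
          using riccati_quadratic[OF sym are, of "x t"] by (simp add: v_def Cx)
        also have "2 * (x t \<bullet> (P *v f t)) = - 2 * \<rho> * (v t \<bullet> v (t - \<tau>)) + 2 * (x t \<bullet> (P *v w t))"
        proof -
          have "x t \<bullet> (P *v (B *v y)) = v t \<bullet> y" for y
            by (simp add: sw trB v_def Cx)
          then show ?thesis
            unfolding f_def matrix_vector_right_distrib matrix_vector_mult_scaleR
            by (simp add: inner_add_right inner_diff_right)
        qed
        also have "2 * (x t \<bullet> (P *v w t)) \<le> eps / 2 * (norm (x t))^2 + 2 / eps * p^2 * (norm (w t))^2"
        proof -
          have "(norm (P *v w t))^2 \<le> (p * norm (w t))^2"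
            unfolding p_def by (rule power_mono[OF norm_matrix_vector_le]) simp
          then have "(norm (P *v w t))^2 / (eps / 2) \<le> 2 / eps * p^2 * (norm (w t))^2"
            using eps by (simp add: field_simps)
          with two_inner_le[of "eps / 2" "x t" "P *v w t"] eps show ?thesis by simp
        qed
        finally show "x t \<bullet> (P *v (A *v x t + f t)) + (A *v x t + f t) \<bullet> (P *v x t) \<le> ?h t" by simp
      qed (use T0 eps in \<open>auto intro!: continuous_intros vc vdc xc0 wc\<close>)
      also have "\<dots> = J - eps / 2 * energy 0 T x - 2 * \<rho> * Y
          + 2 / eps * p^2 * energy 0 T w"
        unfolding J_def Y_def
        by (intro integral_unique has_integral_add has_integral_diff has_integral_mult_right integrable_integral
            integrable_Icc continuous_intros vc vdc xc0 wc order_refl)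
      also have "\<dots> \<le> J - eps / 2 * energy 0 T x - 2 * \<rho> * Y + 2 / eps * p^2 * W"
        using W[OF T0] eps by (intro add_left_mono mult_left_mono) auto
      finally show ?thesis .
    qed
    have E: "E \<le> (b * p)^2 * Kc * (2 * \<rho>^2 * b^2) * J + Ec"
    proof -
      have "E \<le> integral {0..T} (\<lambda>t. (b * p)^2 * (norm (X n t))^2)"
        unfolding E_def
      proof (rule integral_le_Icc)
        fix t
        show "(norm (tv n t))^2 \<le> (b * p)^2 * (norm (X n t))^2"
          unfolding tv_def b_def p_def power_mult_distrib[symmetric] by (rule power_mono[OF CCb]) simp
      qed (intro continuous_intros tvc Xc order_refl)+
      also have "\<dots> = (b * p)^2 * energy 0 T (X n)" by simp
      also have "\<dots> \<le> (b * p)^2 * (Kc * (energy 0 T (\<lambda>t. cvec (f t)) + (norm (cvec (x 0)))^2))"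
        unfolding X_def
        by (intro mult_left_mono casc[unfolded cascade_estimate_def, THEN spec, THEN spec, THEN spec, THEN mp]
          conjI allI impI derc bounded_linear.continuous_on[OF bounded_linear_cvec fc] T0) auto
      also have "\<dots> \<le> (b * p)^2 * (Kc * ((2 * \<rho>^2 * b^2 * (H0 + J) + 2 * W) + (norm (x 0))^2))"
      proof (intro mult_left_mono add_mono K0)
        have "energy 0 T f
            \<le> integral {0..T} (\<lambda>t. 2 * \<rho>^2 * b^2 * (norm (v (t - \<tau>)))^2 + 2 * (norm (w t))^2)"
        proof (rule integral_le_Icc)
          fix t
          have "norm (- \<rho> *\<^sub>R (B *v v (t - \<tau>))) \<le> \<rho> * (b * norm (v (t - \<tau>)))"
            using rho norm_matrix_vector_le[of B "v (t - \<tau>)"] by (simp add: b_def)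
          then have "(norm (- \<rho> *\<^sub>R (B *v v (t - \<tau>))))^2 \<le> (\<rho> * (b * norm (v (t - \<tau>))))^2"
            by (rule power_mono) simp
          then show "(norm (f t))^2 \<le> 2 * \<rho>^2 * b^2 * (norm (v (t - \<tau>)))^2 + 2 * (norm (w t))^2"
            unfolding f_def using norm_add_power2_le[of "- \<rho> *\<^sub>R (B *v v (t - \<tau>))" "w t"]
            by (simp add: power_mult_distrib)
        qed (intro continuous_intros fc vdc wc order_refl)+
        also have "\<dots> = 2 * \<rho>^2 * b^2 * energy 0 T (\<lambda>t. v (t - \<tau>)) + 2 * energy 0 T w"
          by (intro integral_unique has_integral_add has_integral_mult_right integrable_integral
            integrable_Icc continuous_intros vdc wc order_refl)
        also have "\<dots> \<le> 2 * \<rho>^2 * b^2 * (H0 + J) + 2 * W"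
        proof (intro add_mono mult_left_mono W T0)
          have v2: "continuous_on {-\<tau>..} (\<lambda>t. (norm (v t))^2)" by (intro continuous_intros vc')
          have "energy 0 T (\<lambda>t. v (t - \<tau>)) = energy (0 - \<tau>) (T - \<tau>) v"
            by (intro integral_shift continuous_on_subset[OF v2]) auto
          also have "\<dots> = H0 + energy 0 (T - \<tau>) v"
            unfolding H0_def diff_0
          proof (rule Henstock_Kurzweil_Integration.integral_combine[symmetric])
            show "(\<lambda>t. (norm (v t))^2) integrable_on {- \<tau>..T - \<tau>}"
              by (intro integrable_continuous_interval continuous_on_subset[OF v2]) auto
          qed (use T tau in auto)
          also have "\<dots> \<le> H0 + J" unfolding J_def
            by (intro add_left_mono integral_subinterval_le continuous_intros vc) (use tau in auto)
          finally show "energy 0 T (\<lambda>t. v (t - \<tau>)) \<le> H0 + J" .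
        qed auto
        finally show "energy 0 T (\<lambda>t. cvec (f t)) \<le> 2 * \<rho>^2 * b^2 * (H0 + J) + 2 * W" by simp
      qed auto
      also have "\<dots> = (b * p)^2 * Kc * (2 * \<rho>^2 * b^2) * J + Ec"
        by (simp add: Ec_def algebra_simps)
      finally show ?thesis .
    qed
    have tn: "c * (J - J0) - K * (\<gamma> * J + E / \<gamma> + b^2 * p * Vm) \<le> Yt"
    proof -
      have "\<forall>t\<in>{0..T}. (norm (tv 0 t))^2 \<le> b^2 * p * Vm"
      proof
        fix t assume "t \<in> {0..T}"
        then have "b^2 * p * V t \<le> b^2 * p * Vm" using b0 Vm by (intro mult_left_mono) auto
        then show "(norm (tv 0 t))^2 \<le> b^2 * p * Vm" using vV[of t] by (simp add: tv0)
      qed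
      with ts gam tau T have "tone_system l n \<gamma> tw tv \<and> \<gamma> \<le> 1 \<and> 0 \<le> \<tau> \<and> \<tau> \<le> taubar \<and> \<tau> \<le> T \<and>
        (\<forall>t\<in>{0..T}. (norm (tv 0 t))^2 \<le> b^2 * p * Vm)" by blast
      from tone[unfolded tone_estimate_def, THEN spec, THEN spec, THEN spec, THEN spec, THEN spec, THEN spec, THEN mp, OF this]
      show ?thesis
        by (simp add: tv0 JJ J_def[symmetric] Yt_def[symmetric] E_def)
    qed
    have Vm0: "Vm \<ge> 0"
    proof -
      have "V 0 \<ge> 0" using pd by (cases "x 0 = 0") (auto simp: V_def pos_def_def less_imp_le)
      then show ?thesis using Vm[of 0] T0 by simp
    qed
    define k where "k = 2 * \<rho> * K"
    have k0: "k \<ge> 0" using rho K0 by (simp add: k_def)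
    have "2 * \<rho> * (c * (J - J0) - K * (\<gamma> * J + E / \<gamma> + b^2 * p * Vm)) \<le> 2 * \<rho> * Yt"
      using tn rho by (intro mult_left_mono) auto
    moreover have "2 * \<rho> * (c * (J - J0) - K * (\<gamma> * J + E / \<gamma> + b^2 * p * Vm))
        = 4 * (J - J0) - (k * \<gamma> * J + k / \<gamma> * E + k * (b^2 * p) * Vm)"
    proof -
      have "2 * \<rho> * (c * (J - J0)) = 2 * (\<rho> * c) * (J - J0)" by simp
      also have "\<dots> = 4 * (J - J0)" by (simp add: rho)
      finally show ?thesis by (simp add: k_def right_diff_distrib algebra_simps)
    qed
    moreover have "k * \<gamma> * J \<le> 1 * J" using s1 J0' unfolding k_def by (intro mult_right_mono) auto
    moreover have "k * (b^2 * p) * Vm \<le> 1 / 2 * Vm" using s3 Vm0 unfolding k_def b_def p_def by (intro mult_right_mono) auto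
    moreover have "k / \<gamma> * E \<le> J + k / \<gamma> * Ec"
    proof -
      have "k / \<gamma> * E \<le> k / \<gamma> * ((b * p)^2 * Kc * (2 * \<rho>^2 * b^2) * J + Ec)"
        using k0 gam by (intro mult_left_mono E) auto
      also have "\<dots> = (k / \<gamma> * ((b * p)^2 * Kc * (2 * \<rho>^2 * b^2))) * J + k / \<gamma> * Ec" by (simp add: algebra_simps)
      also have "\<dots> \<le> 1 * J + k / \<gamma> * Ec"
        using s2 J0' unfolding k_def b_def p_def by (intro add_right_mono mult_right_mono) auto
      finally show ?thesis by simp
    qed
    moreover have "2 * \<rho> * Y = 2 * \<rho> * I0 + 2 * \<rho> * Yt" by (simp add: Y distrib_left)
    moreover have "vt + ex \<le> v0 - i + 4 * j0 + ke + pw + vm / 2"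
      if "z \<le> yt" "z = 4 * (j - j0) - (kj + e + kv)" "kj \<le> 1 * j" "kv \<le> 1 / 2 * vm" "e \<le> j + ke" "y = i + yt"
        "vt - v0 \<le> j - ex - y + pw" "0 \<le> j"
      for vt ex v0 i j0 ke pw vm z yt j kj e kv y :: real using that by (simp add: algebra_simps)
    ultimately show ?thesis using step1 J0' unfolding Q_def k_def[symmetric] by blast
  qed
  show ?thesis
    by (rule exI[of _ Q]) (use main in \<open>auto simp: V_def\<close>)
qed

text \<open>The bound Q + Vm / 2 closes on itself at a maximum point s of V: with Vm = V s it gives
  V s \<le> 2 Q if s > \<tau>, and otherwise V s is one of the values on [0, \<tau>]. Boundedness of
  V then bounds the energy, the state and its derivative, and Barbalat's argument applies.\<close>

lemma agent_converges:
  fixes P A :: "real^'n^'n" and B :: "real^'m^'n" and x w :: "real \<Rightarrow> real^'n"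
  assumes pd: "pos_def P" and eps: "eps > 0" and tau: "0 \<le> \<tau>" "\<tau> \<le> taubar"
    and xc: "continuous_on {-taubar..} x" and wb: "\<And>t. t \<ge> 0 \<Longrightarrow> norm (w t) \<le> W"
    and der: "\<And>t. t \<ge> 0 \<Longrightarrow> (x has_vector_derivative
       (A *v x t + B *v (- \<rho> *\<^sub>R ((transpose B ** P) *v x (t - \<tau>))) + w t)) (at t within {0..})"
    and Q: "\<And>T Vm. T \<ge> \<tau> \<Longrightarrow> (\<forall>t\<in>{0..T}. x t \<bullet> (P *v x t) \<le> Vm) \<Longrightarrow>
     x T \<bullet> (P *v x T) + eps / 2 * energy 0 T x \<le> Q + Vm / 2"
  shows "(x \<longlongrightarrow> 0) at_top"
proof -
  define V where "V t = x t \<bullet> (P *v x t)" for t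
  have xc0: "continuous_on {0..} x" by (rule continuous_on_subset[OF xc]) (use tau in auto)
  have Vc: "continuous_on {0..} V" unfolding V_def
    by (intro continuous_intros continuous_on_matrix_mult xc0)
  have V0: "V t \<ge> 0" for t using pd by (cases "x t = 0") (auto simp: V_def pos_def_def less_imp_le)
  have x2c: "continuous_on {0..} (\<lambda>t. (norm (x t))^2)" by (intro continuous_intros xc0)
  have I0: "energy 0 T x \<ge> 0" for T
    by (rule integral_nonneg_Icc[OF x2c]) auto
  have Q': "V T + eps / 2 * energy 0 T x \<le> Q + Vm / 2"
    if "T \<ge> \<tau>" "\<And>t. 0 \<le> t \<Longrightarrow> t \<le> T \<Longrightarrow> V t \<le> Vm" for T Vm
    unfolding V_def by (rule Q[OF that(1)]) (use that(2) in \<open>auto simp: V_def\<close>)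
  obtain s0 where s0: "s0 \<in> {0..\<tau>}" "\<And>t. t \<in> {0..\<tau>} \<Longrightarrow> V t \<le> V s0"
    using continuous_attains_sup[of "{0..\<tau>}" V] continuous_on_Icc[OF Vc, of 0 \<tau>] tau by auto
  define Vb where "Vb = max (V s0) (2 * Q)"
  have Vb: "V t \<le> Vb" if t: "t \<ge> 0" for t
  proof -
    define T where "T = max t \<tau>"
    have T: "T \<ge> t" "T \<ge> \<tau>" "T \<ge> 0" using t by (auto simp: T_def)
    obtain s where s: "s \<in> {0..T}" "\<And>r. r \<in> {0..T} \<Longrightarrow> V r \<le> V s"
      using continuous_attains_sup[of "{0..T}" V] continuous_on_Icc[OF Vc, of 0 T] T by auto
    have "V s \<le> Vb"
    proof (cases "s \<le> \<tau>")
      case True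
      then show ?thesis using s0(2)[of s] s by (simp add: Vb_def)
    next
      case False
      have "V s + eps / 2 * energy 0 s x \<le> Q + V s / 2"
        by (rule Q') (use s False in auto)
      moreover have "eps / 2 * energy 0 s x \<ge> 0" using eps I0 by simp
      ultimately have "V s \<le> 2 * Q" by linarith
      then show ?thesis by (simp add: Vb_def)
    qed
    with s(2)[of t] t T show ?thesis by simp
  qed
  have I: "energy 0 T x \<le> (Q + Vb / 2) / (eps / 2)" if T: "T \<ge> 0" for T
  proof -
    have "energy 0 T x \<le> energy 0 (max T \<tau>) x"
      by (rule integral_subinterval_le[OF x2c]) auto
    moreover have "V (max T \<tau>) + eps / 2 * energy 0 (max T \<tau>) x \<le> Q + Vb / 2"
      by (rule Q') (use Vb in auto)
    then have "eps / 2 * energy 0 (max T \<tau>) x \<le> Q + Vb / 2"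
      using V0[of "max T \<tau>"] by linarith
    then have "energy 0 (max T \<tau>) x \<le> (Q + Vb / 2) / (eps / 2)"
      using eps by (simp add: pos_le_divide_eq mult.commute)
    ultimately show ?thesis by linarith
  qed
  \<comment> \<open>Injectivity bounds |P y| below by m |y|, which converts the bound on V into one
    on x.\<close>
  have "inj ((*v) P)"
  proof (rule linear_injective_0[THEN iffD2], simp, clarify)
    fix y assume "P *v y = 0"
    then have "y \<bullet> (P *v y) = 0" by simp
    then show "y = 0" using pd by (auto simp: pos_def_def)
  qed
  then obtain m where m: "m > 0" "\<And>y. m * norm y \<le> norm (P *v y)"
    using linear_inj_bounded_below_pos[of "(*v) P"] by auto
  define M1 where "M1 = sqrt (norm P * Vb) / m"
  have xM1: "norm (x t) \<le> M1" if t: "t \<ge> 0" for t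
  proof -
    have "(norm (P *v x t))^2 \<le> norm P * V t" unfolding V_def by (rule pos_def_norm_le[OF pd order_refl])
    also have "\<dots> \<le> norm P * Vb" by (intro mult_left_mono Vb t) auto
    finally have "norm (P *v x t) \<le> sqrt (norm P * Vb)" by (rule real_le_rsqrt)
    with m(2)[of "x t"] m(1) show ?thesis by (simp add: M1_def pos_le_divide_eq mult.commute)
  qed
  \<comment> \<open>The derivative at t involves x (t - \<tau>), so the initial function has to be
    bounded as well.\<close>
  have "compact (x ` {-taubar..0})"
    by (intro compact_continuous_image continuous_on_subset[OF xc]) auto
  then have "bounded (x ` {-taubar..0})" by (rule compact_imp_bounded)
  then obtain M2 where "\<forall>y\<in>x ` {-taubar..0}. norm y \<le> M2" unfolding bounded_iff ..
  then have M2: "norm (x t) \<le> M2" if "t \<in> {-taubar..0}" for t using that by blast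
  define M where "M = max M1 M2"
  have xM: "norm (x t) \<le> M" if "t \<ge> - taubar" for t
    using xM1[of t] M2[of t] that by (cases "t \<ge> 0") (auto simp: M_def le_max_iff_disj)
  define L where "L = norm A * M + norm B * (\<bar>\<rho>\<bar> * (norm (transpose B ** P) * M)) + W"
  have L: "norm (A *v x t + B *v (- \<rho> *\<^sub>R ((transpose B ** P) *v x (t - \<tau>))) + w t) \<le> L" if t: "t \<ge> 0" for t
  proof -
    have "norm (A *v x t) \<le> norm A * M"
      by (intro order_trans[OF norm_matrix_vector_le] mult_left_mono xM) (use t tau in auto)
    moreover have "norm (B *v (- \<rho> *\<^sub>R ((transpose B ** P) *v x (t - \<tau>)))) \<le> norm B * (\<bar>\<rho>\<bar> * (norm (transpose B ** P) * M))"
    proof (intro order_trans[OF norm_matrix_vector_le] mult_left_mono)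
      have "norm ((transpose B ** P) *v x (t - \<tau>)) \<le> norm (transpose B ** P) * M"
        by (intro order_trans[OF norm_matrix_vector_le] mult_left_mono xM) (use t tau in auto)
      then show "norm (- \<rho> *\<^sub>R ((transpose B ** P) *v x (t - \<tau>))) \<le> \<bar>\<rho>\<bar> * (norm (transpose B ** P) * M)"
        by (simp add: mult_left_mono)
    qed auto
    ultimately show ?thesis unfolding L_def using wb[OF t] by (intro norm_triangle_mono) auto
  qed
  show ?thesis
  proof (rule barbalat_norm_power2[OF der])
    show "norm (x t) \<le> max M L" if "t \<ge> 0" for t using xM[of t] that tau by (simp add: le_max_iff_disj)
    show "norm (A *v x t + B *v (- \<rho> *\<^sub>R ((transpose B ** P) *v x (t - \<tau>))) + w t) \<le> max M L" if "t \<ge> 0" for t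
      using L[OF that] by (simp add: le_max_iff_disj)
  qed (use I in auto)
qed

text \<open>One W bounds both the size and the energy of the disturbance: the former gives a bounded
  derivative, the latter enters the energy estimate.\<close>

definition delay_stable :: "real^'n^'n \<Rightarrow> real^'m^'n \<Rightarrow> real^'n^'n \<Rightarrow> real \<Rightarrow> real \<Rightarrow> bool" where
  "delay_stable A B P \<rho> taubar \<longleftrightarrow> (\<forall>\<tau> x w W. 0 \<le> \<tau> \<and> \<tau> \<le> taubar \<and>
      continuous_on {-taubar..} x \<and> continuous_on {0..} w \<and>
      (\<forall>t\<ge>0. norm (w t) \<le> W) \<and> (\<forall>T\<ge>0. energy 0 T w \<le> W) \<and>
      (\<forall>t\<ge>0. (x has_vector_derivative
       (A *v x t + B *v (- \<rho> *\<^sub>R ((transpose B ** P) *v x (t - \<tau>))) + w t)) (at t within {0..}))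
      \<longrightarrow> (x \<longlongrightarrow> 0) at_top)"

lemma low_gain_delay_stabilization:
  fixes A :: "real^'n^'n" and B :: "real^'m^'n" and taubar :: real
  assumes stab: "stabilizable A B"
    and lhp: "\<forall>lam. is_eig A lam \<longrightarrow> Re lam \<le> 0"
    and taubar: "taubar \<ge> 0"
    and delay: "taubar * omega_max A < pi / 2"
  shows "\<exists>\<rho>>1. \<exists>e0>0. \<forall>eps P. 0 < eps \<and> eps \<le> e0 \<and> pos_def P \<and>
      riccati A B eps P \<longrightarrow>
    delay_stable A B P \<rho> taubar"
proof -
  obtain ls where ls: "\<And>l. l \<in> set ls \<Longrightarrow> is_eig A l" "\<And>y. shifts (cmat A) ls y = 0"
    using ex_eigenvalue_shifts_zero[of A] by blast
  define n where "n = length ls"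
  define l where "l = (!) ls"
  have leig: "is_eig A (l k)" if "k < n" for k using ls(1) that by (simp add: l_def n_def)
  have lRe: "Re (l k) \<le> 0" if "k < n" for k using leig[OF that] lhp by blast
  have ann: "shifts (cmat A) (map l [0..<n]) y = 0" for y
    using ls(2)[of y] by (simp add: l_def n_def map_nth)
  define c where "c = cos (taubar * omega_max A)"
  have om: "omega_max A \<ge> 0" by (rule omega_max_bound(1)[OF lhp])
  have tom: "0 \<le> taubar * omega_max A" using om taubar by simp
  have c: "0 < c" "c \<le> 1" unfolding c_def using tom delay by (auto intro: cos_gt_zero_pi)
  have cs: "c \<le> cos (Im (l k) * \<tau>)" if k: "k < n" "Re (l k) = 0" and t: "0 \<le> \<tau>" "\<tau> \<le> taubar" for k \<tau>
  proof -
    have "\<bar>Im (l k)\<bar> * \<tau> \<le> omega_max A * taubar"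
      using omega_max_bound(2)[OF lhp leig[OF k(1)] k(2)] t om by (intro mult_mono) auto
    then have "cos (taubar * omega_max A) \<le> cos (\<bar>Im (l k)\<bar> * \<tau>)"
      using t delay tom by (intro cos_monotone_0_pi_le) (auto simp: mult.commute)
    also have "cos (\<bar>Im (l k)\<bar> * \<tau>) = cos \<bar>Im (l k) * \<tau>\<bar>" using t by (simp add: abs_mult)
    finally show ?thesis by (simp add: c_def)
  qed
  \<comment> \<open>c \<le> 1 gives \<rho> > 1, and \<rho> c = 2 makes the feedback gain 4 J against
    costs of 3 J.\<close>
  define \<rho> where "\<rho> = 2 / c"
  have rho: "\<rho> > 1" "\<rho> * c = 2" using c by (auto simp: \<rho>_def)
  have "\<exists>K\<ge>0. tone_estimate TYPE('m) l n taubar c K"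
    using tone_lower_bound[OF lRe taubar less_imp_le[OF c(1)] c(2) cs] .
  then obtain K where K0: "K \<ge> 0" and tone: "tone_estimate TYPE('m) l n taubar c K" by blast
  \<comment> \<open>K + 1 in place of K covers K = 0; \<gamma> \<le> 1 is demanded by the tone
    estimate.\<close>
  define \<gamma> where "\<gamma> = min 1 (1 / (2 * \<rho> * (K + 1)))"
  have gam: "0 < \<gamma>" "\<gamma> \<le> 1" using rho K0 by (auto simp: \<gamma>_def)
  have s1: "2 * \<rho> * K * \<gamma> \<le> 1"
  proof -
    have "2 * \<rho> * K * \<gamma> \<le> 2 * \<rho> * (K + 1) * \<gamma>" using rho gam by (intro mult_right_mono mult_left_mono) auto
    also have "\<dots> \<le> 2 * \<rho> * (K + 1) * (1 / (2 * \<rho> * (K + 1)))"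
      using rho K0 by (intro mult_left_mono) (auto simp: \<gamma>_def)
    also have "\<dots> = 1" using rho K0 by simp
    finally show ?thesis .
  qed
  have "\<exists>K\<ge>0. cascade_estimate (cmat A) l \<gamma> n K" using cascade_bound[OF gam(1) lRe ann] .
  then obtain K2 where K2: "K2 \<ge> 0" and casc: "cascade_estimate (cmat A) l \<gamma> n K2" by blast
  \<comment> \<open>The first summand belongs to \<open>s2\<close>, where |P|^2 \<le> |P| since
    \<eta> \<le> 1; the second to \<open>s3\<close>, where the bound 1 / 2 doubles the coefficient;
    the last gives \<eta> \<le> 1.\<close>
  define a where "a = (2 * \<rho> * K / \<gamma>) * ((norm B)^2 * K2 * (2 * \<rho>^2 * (norm B)^2)) + 4 * \<rho> * K * (norm B)^2 + 1"
  have a1: "(2 * \<rho> * K / \<gamma>) * ((norm B)^2 * K2 * (2 * \<rho>^2 * (norm B)^2)) \<ge> 0" "4 * \<rho> * K * (norm B)^2 \<ge> 0"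
    using rho K0 gam K2 by auto
  have a: "a \<ge> 1" "(2 * \<rho> * K / \<gamma>) * ((norm B)^2 * K2 * (2 * \<rho>^2 * (norm B)^2)) \<le> a" "4 * \<rho> * K * (norm B)^2 \<le> a"
    using a1 unfolding a_def by linarith+
  define \<eta> where "\<eta> = 1 / a"
  have eta: "\<eta> > 0" "\<eta> \<le> 1" "a * \<eta> = 1" using a by (auto simp: \<eta>_def)
  obtain e0 where e0: "e0 > 0" and small: "\<And>eps P. 0 < eps \<Longrightarrow> eps \<le> e0 \<Longrightarrow> pos_def P \<Longrightarrow>
      riccati A B eps P \<Longrightarrow> norm P \<le> \<eta>"
    using low_gain[OF stab lhp eta(1)] by blast
  show ?thesis unfolding delay_stable_def
  proof (rule exI[of _ \<rho>], rule conjI[OF rho(1)], rule exI[of _ e0], rule conjI[OF e0], intro allI impI, elim conjE)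
    fix eps P \<tau> W and x w :: "real \<Rightarrow> real^'n"
    assume eps: "0 < eps" "eps \<le> e0" and pd: "pos_def P"
      and are: "riccati A B eps P"
      and tau: "0 \<le> \<tau>" "\<tau> \<le> taubar" and xc: "continuous_on {-taubar..} x" and wc: "continuous_on {0..} w"
      and wb: "\<forall>t\<ge>0. norm (w t) \<le> W" and WI: "\<forall>T\<ge>0. energy 0 T w \<le> W"
      and der: "\<forall>t\<ge>0. (x has_vector_derivative
       (A *v x t + B *v (- \<rho> *\<^sub>R ((transpose B ** P) *v x (t - \<tau>))) + w t)) (at t within {0..})"
    have nP: "norm P \<le> \<eta>" by (rule small[OF eps pd are])
    have s3: "2 * \<rho> * K * ((norm B)^2 * norm P) \<le> 1 / 2"
    proof -
      have "4 * \<rho> * K * (norm B)^2 * norm P \<le> a * \<eta>" using a nP by (intro mult_mono) auto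
      then show ?thesis using eta by simp
    qed
    have s2: "(2 * \<rho> * K / \<gamma>) * ((norm B * norm P)^2 * K2 * (2 * \<rho>^2 * (norm B)^2)) \<le> 1"
    proof -
      have "(norm P)^2 \<le> norm P * 1" unfolding power2_eq_square using nP eta by (intro mult_left_mono) auto
      then have "(norm P)^2 \<le> \<eta>" using nP by simp
      then have "((2 * \<rho> * K / \<gamma>) * ((norm B)^2 * K2 * (2 * \<rho>^2 * (norm B)^2))) * (norm P)^2 \<le> a * \<eta>"
        using a by (intro mult_mono) auto
      then show ?thesis using eta by (simp add: power_mult_distrib mult_ac)
    qed
    have "\<exists>Q. \<forall>T\<ge>\<tau>. \<forall>Vm. (\<forall>t\<in>{0..T}. x t \<bullet> (P *v x t) \<le> Vm) \<longrightarrow>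
       x T \<bullet> (P *v x T) + eps / 2 * energy 0 T x \<le> Q + Vm / 2"
      by (rule agent_energy[where \<gamma> = \<gamma> and K = K and Kc = K2 and l = l and n = n and c = c
            and taubar = taubar and \<tau> = \<tau> and \<rho> = \<rho> and w = w and W = W,
            OF pd are eps(1) _ rho(2) gam lRe tone casc K0 K2 s1 s2 s3 tau xc wc])
        (use rho(1) WI der in auto)
    then obtain Q where "\<And>T Vm. T \<ge> \<tau> \<Longrightarrow> (\<forall>t\<in>{0..T}. x t \<bullet> (P *v x t) \<le> Vm) \<Longrightarrow>
       x T \<bullet> (P *v x T) + eps / 2 * energy 0 T x \<le> Q + Vm / 2" by blast
    then show "(x \<longlongrightarrow> 0) at_top"
      using agent_converges[OF pd eps(1) tau xc, of w W A B \<rho> Q] wb der by blast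
  qed
qed

section \<open>The network as a whole\<close>

lemma exp_decay_integral_le:
  fixes w :: "real \<Rightarrow> 'a::real_normed_vector"
  assumes w: "continuous_on {0..} w" and k: "k > 0" and L: "L \<ge> 0" and T: "T \<ge> 0"
    and le: "\<And>t. t \<ge> 0 \<Longrightarrow> (norm (w t))^2 \<le> L * exp (- k * t)"
  shows "energy 0 T w \<le> L / k"
proof -
  have "energy 0 T w \<le> integral {0..T} (\<lambda>t. L * exp (- k * t))"
    by (rule integral_le_Icc) (use le in \<open>auto intro!: continuous_intros w\<close>)
  also have "\<dots> = (- L / k * exp (- k * T)) - (- L / k * exp (- k * 0))"
  proof (intro integral_unique fundamental_theorem_of_calculus T)
    fix t assume "t \<in> {0..T}"
    show "((\<lambda>t. - L / k * exp (- k * t)) has_vector_derivative L * exp (- k * t)) (at t within {0..T})"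
      unfolding has_real_derivative_iff_has_vector_derivative[symmetric]
      using k by (auto intro!: derivative_eq_intros)
  qed
  also have "\<dots> \<le> L / k" using k L by simp
  finally show ?thesis .
qed

theorem theorem1:
  fixes A :: "real^'n^'n" and B :: "real^'m^'n" and taubar :: real
  assumes stab: "stabilizable A B"
    and cl_lhp: "\<forall>lam. is_eig A lam \<longrightarrow> Re lam \<le> 0"
    and taubar_nn: "taubar \<ge> 0"
    and delay_bound: "taubar * omega_max A < pi / 2"
  shows "\<exists>rho > 1. \<exists>epsstar > 0. \<forall>eps. 0 < eps \<and> eps \<le> epsstar \<longrightarrow>
    (\<forall>P :: real^'n^'n. pos_def P \<and>
        transpose A ** P + P ** A - P ** B ** transpose B ** P + mat eps = 0 \<longrightarrow>
     (\<forall>(N::nat) (C::nat set) (a::nat \<Rightarrow> nat \<Rightarrow> real) (tau::nat \<Rightarrow> real)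
        (x::nat \<Rightarrow> real \<Rightarrow> real^'n) (chi::nat \<Rightarrow> real \<Rightarrow> real^'n) (xr::real \<Rightarrow> real^'n).
       N \<ge> 1 \<and> C \<noteq> {} \<and> graph_class N C a \<and>
       (\<forall>i\<in>{1..N}. 0 \<le> tau i \<and> tau i \<le> taubar) \<and>
       (\<forall>i\<in>{1..N}. continuous_on {-taubar..} (x i) \<and> continuous_on {-taubar..} (chi i)) \<and>
       (\<forall>t\<ge>0. (xr has_vector_derivative (A *v xr t)) (at t within {0..})) \<and>
       (\<forall>i\<in>{1..N}. \<forall>t\<ge>0.
          (x i has_vector_derivative
             (A *v x i t + B *v (- rho *\<^sub>R ((transpose B ** P) *v chi i (t - tau i)))))
          (at t within {0..})) \<and>
       (\<forall>i\<in>{1..N}. \<forall>t\<ge>0.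
          (chi i has_vector_derivative
             (A *v chi i t + B *v (- rho *\<^sub>R ((transpose B ** P) *v chi i (t - tau i)))
              + ((\<Sum>j=1..N. a i j *\<^sub>R (x i t - x j t))
                 + (if i \<in> C then 1 else 0) *\<^sub>R (x i t - xr t))
              - (\<Sum>j=1..N. a i j *\<^sub>R (chi i t - chi j t))
              - (if i \<in> C then 1 else 0) *\<^sub>R chi i t))
          (at t within {0..}))
       \<longrightarrow> (\<forall>i\<in>{1..N}. ((\<lambda>t. x i t - xr t) \<longlongrightarrow> 0) at_top)))"
proof -
  from low_gain_delay_stabilization[OF stab cl_lhp taubar_nn delay_bound]
  obtain \<rho> e0 where rho: "\<rho> > 1" "e0 > 0" and agent: "\<forall>eps P. 0 < eps \<and> eps \<le> e0 \<and> pos_def P \<and>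
      riccati A B eps P \<longrightarrow>
    delay_stable A B P \<rho> taubar"
    by (elim exE conjE) (rule that)
  show ?thesis
  proof (rule exI[of _ \<rho>], rule conjI[OF rho(1)], rule exI[of _ e0], rule conjI[OF rho(2)],
      intro allI impI ballI, elim conjE)
    fix eps and P :: "real^'n^'n" and N :: nat and C :: "nat set" and a :: "nat \<Rightarrow> nat \<Rightarrow> real" and tau :: "nat \<Rightarrow> real"
      and x chi :: "nat \<Rightarrow> real \<Rightarrow> real^'n" and xr :: "real \<Rightarrow> real^'n" and i :: nat
    assume eps: "0 < eps" "eps \<le> e0" and pd: "pos_def P"
      and are: "riccati A B eps P"
      and g: "graph_class N C a" and i: "i \<in> {1..N}"
      and tau: "\<forall>i\<in>{1..N}. 0 \<le> tau i \<and> tau i \<le> taubar"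
      and cont: "\<forall>i\<in>{1..N}. continuous_on {-taubar..} (x i) \<and> continuous_on {-taubar..} (chi i)"
      and dr: "\<forall>t\<ge>0. (xr has_vector_derivative (A *v xr t)) (at t within {0..})"
      and dx: "\<forall>i\<in>{1..N}. \<forall>t\<ge>0. (x i has_vector_derivative
             (A *v x i t + B *v (- \<rho> *\<^sub>R ((transpose B ** P) *v chi i (t - tau i))))) (at t within {0..})"
      and dchi: "\<forall>i\<in>{1..N}. \<forall>t\<ge>0. (chi i has_vector_derivative
             (A *v chi i t + B *v (- \<rho> *\<^sub>R ((transpose B ** P) *v chi i (t - tau i)))
              + ((\<Sum>j=1..N. a i j *\<^sub>R (x i t - x j t))
                 + (if i \<in> C then 1 else 0) *\<^sub>R (x i t - xr t))
              - (\<Sum>j=1..N. a i j *\<^sub>R (chi i t - chi j t))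
              - (if i \<in> C then 1 else 0) *\<^sub>R chi i t)) (at t within {0..})"
    define c where "c i = (if i \<in> C then 1 else 0 :: real)" for i
    \<comment> \<open>x i and chi i receive the same delayed input, which cancels in e; this frees
      the error from the delays.\<close>
    define e where "e i t = x i t - xr t - chi i t" for i t
    define w where "w i t = (\<Sum>j=1..N. a i j *\<^sub>R (e i t - e j t)) + c i *\<^sub>R e i t" for i t
    \<comment> \<open>The correction terms of the protocol combine into the pinned Laplacian applied
      to e, so the other agents enter the equation of chi i only through a disturbance.\<close>
    have w: "w i t = ((\<Sum>j=1..N. a i j *\<^sub>R (x i t - x j t)) + c i *\<^sub>R (x i t - xr t))
        - (\<Sum>j=1..N. a i j *\<^sub>R (chi i t - chi j t)) - c i *\<^sub>R chi i t" for i t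
      by (simp add: w_def e_def scaleR_diff_right scaleR_add_right sum_subtractf sum.distrib algebra_simps)
    have dchi': "(chi i has_vector_derivative
        (A *v chi i t + B *v (- \<rho> *\<^sub>R ((transpose B ** P) *v chi i (t - tau i))) + w i t)) (at t within {0..})"
      if "i \<in> {1..N}" "t \<ge> 0" for i t
      using dchi[rule_format, OF that] unfolding w c_def by (simp only: add_diff_eq)
    have de: "(e i has_vector_derivative (A *v e i t - (\<Sum>j=1..N. a i j *\<^sub>R (e i t - e j t)) - c i *\<^sub>R e i t)) (at t within {0..})"
      if "i \<in> {1..N}" "t \<ge> 0" for i t
    proof -
      let ?u = "B *v (- \<rho> *\<^sub>R ((transpose B ** P) *v chi i (t - tau i)))"
      have "(e i has_vector_derivative ((A *v x i t + ?u) - A *v xr t - (A *v chi i t + ?u + w i t))) (at t within {0..})"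
        unfolding e_def using that dx dr by (intro has_vector_derivative_diff dchi') auto
      moreover have "(A *v x i t + ?u) - A *v xr t - (A *v chi i t + ?u + w i t)
          = A *v e i t - (\<Sum>j=1..N. a i j *\<^sub>R (e i t - e j t)) - c i *\<^sub>R e i t"
        by (simp add: w_def e_def[of i] matrix_vector_mult_diff_distrib)
      ultimately show ?thesis by (simp only:)
    qed
    obtain K k where K: "K \<ge> 0" "k > 0" and dec: "\<And>i t. i \<in> {1..N} \<Longrightarrow> t \<ge> 0 \<Longrightarrow> (norm (e i t))^2 \<le> K * exp (- k * t)"
      using network_decay[OF g cl_lhp de[unfolded c_def]] by blast
    have ec: "continuous_on {0..} (e i)" if "i \<in> {1..N}" for i
      by (rule continuous_on_from_vector_derivative[OF de[OF that]])
    \<comment> \<open>Incoming weights count twice, for |e i - e j|, and the 1 is for the pinning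
      term.\<close>
    define R where "R = (\<Sum>j=1..N. a i j * 2) + 1"
    have a0: "a i j \<ge> 0" if "j \<in> {1..N}" for j using g i that by (simp add: graph_class_def)
    have R0: "R \<ge> 0" unfolding R_def using a0 by (intro add_nonneg_nonneg sum_nonneg) auto
    have wd: "(norm (w i t))^2 \<le> R^2 * K * exp (- k * t)" if t: "t \<ge> 0" for t
    proof -
      define s where "s = sqrt (K * exp (- k * t))"
      have s0: "s \<ge> 0" using K by (simp add: s_def)
      have es: "norm (e j t) \<le> s" if "j \<in> {1..N}" for j
        unfolding s_def by (rule real_le_rsqrt[OF dec[OF that t]])
      have "norm (w i t) \<le> (\<Sum>j=1..N. norm (a i j *\<^sub>R (e i t - e j t))) + norm (c i *\<^sub>R e i t)"
        unfolding w_def by (intro norm_triangle_mono norm_sum order_refl)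
      also have "\<dots> \<le> (\<Sum>j=1..N. a i j * (2 * s)) + s"
      proof (intro add_mono sum_mono)
        show "norm (c i *\<^sub>R e i t) \<le> s" using es[OF i] s0 by (simp add: c_def)
        fix j assume j: "j \<in> {1..N}"
        have "norm (e i t - e j t) \<le> 2 * s" using norm_triangle_ineq4[of "e i t" "e j t"] es[OF i] es[OF j] by simp
        then show "norm (a i j *\<^sub>R (e i t - e j t)) \<le> a i j * (2 * s)" using a0[OF j] by (simp add: mult_left_mono)
      qed
      also have "\<dots> = R * s" by (simp add: R_def distrib_right sum_distrib_right mult.assoc)
      finally have "(norm (w i t))^2 \<le> (R * s)^2" by (rule power_mono) simp
      also have "\<dots> = R^2 * K * exp (- k * t)" using K by (simp add: power_mult_distrib s_def)
      finally show ?thesis .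
    qed
    have wc: "continuous_on {0..} (w i)" unfolding w_def by (intro continuous_intros ec i)
    define W where "W = max (R * sqrt K) (R^2 * K / k)"
    have wb: "norm (w i t) \<le> W" if t: "t \<ge> 0" for t
    proof -
      have "R^2 * K * exp (- k * t) \<le> R^2 * K * 1" using K t by (intro mult_left_mono) auto
      with wd[OF t] have "(norm (w i t))^2 \<le> R^2 * K" by simp
      then have "norm (w i t) \<le> sqrt (R^2 * K)" by (rule real_le_rsqrt)
      then show ?thesis using R0 by (simp add: W_def real_sqrt_mult)
    qed
    have WI: "energy 0 T (w i) \<le> W" if "T \<ge> 0" for T
      using exp_decay_integral_le[OF wc K(2) _ that wd] K by (simp add: W_def le_max_iff_disj)
    have "delay_stable A B P \<rho> taubar" using agent eps pd are by blast
    note stable = this[unfolded delay_stable_def, THEN spec, THEN spec, THEN spec, THEN spec, THEN mp]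
    have chi0: "(chi i \<longlongrightarrow> 0) at_top"
    proof (rule stable, intro conjI)
      show "\<forall>t\<ge>0. norm (w i t) \<le> W" using wb by blast
      show "\<forall>T\<ge>0. energy 0 T (w i) \<le> W" using WI by blast
      show "\<forall>t\<ge>0. (chi i has_vector_derivative (A *v chi i t
        + B *v (- \<rho> *\<^sub>R ((transpose B ** P) *v chi i (t - tau i))) + w i t)) (at t within {0..})"
        using dchi'[OF i] by blast
    qed (use tau cont i wc in auto)
    have "((\<lambda>t. (norm (e i t))^2) \<longlongrightarrow> 0) at_top"
    proof (rule tendsto_sandwich[where f = "\<lambda>_. 0" and h = "\<lambda>t. K * exp (- k * t)"])
      show "\<forall>\<^sub>F t in at_top. (norm (e i t))^2 \<le> K * exp (- k * t)"
        using eventually_ge_at_top[of "0::real"] by eventually_elim (rule dec[OF i])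
      have "((\<lambda>t. exp (- k * t)) \<longlongrightarrow> 0) at_top"
        using K by (intro filterlim_compose[OF exp_at_bot] filterlim_tendsto_neg_mult_at_bot[OF tendsto_const])
          (auto simp: filterlim_ident)
      then show "((\<lambda>t. K * exp (- k * t)) \<longlongrightarrow> 0) at_top" by (rule tendsto_mult_right_zero)
    qed auto
    then have "((\<lambda>t. sqrt ((norm (e i t))^2)) \<longlongrightarrow> sqrt 0) at_top" by (rule tendsto_real_sqrt)
    then have "(e i \<longlongrightarrow> 0) at_top" by (simp add: tendsto_norm_zero_iff)
    from tendsto_add[OF chi0 this] show "((\<lambda>t. x i t - xr t) \<longlongrightarrow> 0) at_top" by (simp add: e_def)
  qed
qed

end
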